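(* Let $N\ge1$, $\bar p:=2+\frac4N<p<2^*$, $a>0$, and suppose that one of the following holds: (A) $2<q<\bar p$, $\mu>0$ and $$\left(\mu a^{(1-\gamma_q)q}\right)^{\gamma_pp-2}\left(a^{(1-\gamma_p)p}\right)^{2-\gamma_qq}<\left(\frac{p(2-\gamma_qq)}{2C_{N,p}^p(\gamma_pp-\gamma_qq)}\right)^{2-\gamma_qq}\left(\frac{q(\gamma_pp-2)}{2C_{N,q}^q(\gamma_pp-\gamma_qq)}\right)^{\gamma_pp-2};$$ (B) $q=\bar p$, $\mu>0$ and $\mu a^{\frac4N}<\frac{\bar p}{2C_{N,\bar p}^{\bar p}}$; (C) $2<q\le\bar p$, $\mu<0$ and $$\left(|\mu|a^{q(1-\gamma_q)}\right)^{p\gamma_p-2}a^{p(1-\gamma_p)(2-q\gamma_q)}<\left(\frac{1-\gamma_p}{C_{N,q}^q(\gamma_p-\gamma_q)}\right)^{p\gamma_p-2}\left(\frac1{\gamma_pC_{N,p}^p}\right)^{2-q\gamma_q}.$$ Then $\mathcal P_{a,\mu}$ is a smooth manifold of codimension $1$ in $S_a$. Moreover, if $u\in\mathcal P_{a,\mu}$ is a critical point for $E_\mu|_{\mathcal P_{a,\mu}}$, then $u$ is a critical point for $E_\mu|_{S_a}$.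
   Context: Notation: $2^*=2N/(N-2)$ if $N\ge3$, $2^*=+\infty$ if $N=1,2$; $\gamma_r=\frac{N(r-2)}{2r}$; $H=H^1(\mathbb R^N,\mathbb C)$; $|\cdot|_r$ is the $L^r(\mathbb R^N)$ norm; $C_{N,r}$ is the best constant in $|u|_r\le C_{N,r}|\nabla u|_2^{\gamma_r}|u|_2^{1-\gamma_r}$, $u\in H$. $S_a=\{u\in H:\int|u|^2=a^2\}$, $E_\mu(u)=\int_{\mathbb R^N}(\tfrac12|\nabla u|^2-\tfrac1p|u|^p-\tfrac{\mu}{q}|u|^q)$, and the Pohozaev set is $$\mathcal P_{a,\mu}=\{u\in S_a:P_\mu(u)=0\},\qquad P_\mu(u)=|\nabla u|_2^2-\gamma_p|u|_p^p-\mu\gamma_q|u|_q^q.$$ (Smoothness is understood as: $\mathcal P_{a,\mu}$ is the common zero set in $H$ of the $C^1$ functionals $P_\mu$ and $u\mapsto|u|_2^2-a^2$, whose joint differential $H\to\mathbb R^2$ is surjective at every point of $\mathcal P_{a,\mu}$.) *)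

theory Defs
  imports "HOL-Analysis.Analysis"
begin

(* Ck k f: f is k times continuously differentiable. Differentiability (not just existence of
   partials) is required at each stage, so the clause for Suc is the usual "f is differentiable and all
   first partials are of class C^k". test_function is then C_c^infinity(R^n, R). *)
fun Ck :: "nat \<Rightarrow> (real^'n::finite \<Rightarrow> real) \<Rightarrow> bool" where
  "Ck 0 f = continuous_on UNIV f"
| "Ck (Suc k) f = ((\<forall>x. f differentiable at x) \<and>
     (\<forall>i. Ck k (\<lambda>x. frechet_derivative f (at x) (axis i 1))))"

definition test_function :: "(real^'n::finite \<Rightarrow> real) \<Rightarrow> bool" where
  "test_function \<phi> \<longleftrightarrow> (\<forall>k. Ck k \<phi>) \<and> compact (closure {x. \<phi> x \<noteq> 0})"

lemma Ck_SucI: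
  assumes "\<And>x. (f has_derivative f' x) (at x)" "\<And>i. Ck k (\<lambda>x. f' x (axis i 1))"
  shows "Ck (Suc k) f"
proof -
  have "frechet_derivative f (at x) = f' x" for x
    using frechet_derivative_at[OF assms(1)] by simp
  then show ?thesis
    using assms by (auto simp: differentiable_def)
qed

lemma Ck_Suc_derivative:
  assumes "Ck (Suc k) f"
  shows "(f has_derivative frechet_derivative f (at x)) (at x)"
  using assms by (simp add: frechet_derivative_works[symmetric])

lemma Ck_mono: "Ck (Suc k) f \<Longrightarrow> Ck k f"
proof (induction k arbitrary: f)
  case 0
  then show ?case
    by (simp add: continuous_on_eq_continuous_at differentiable_imp_continuous_within)
next
  case (Suc k)
  from Suc.prems have "\<forall>x. f differentiable at x"
    "\<And>i. Ck (Suc k) (\<lambda>x. frechet_derivative f (at x) (axis i 1))"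
    unfolding Ck.simps(2)[of "Suc k" f] by blast+
  with Suc.IH show ?case unfolding Ck.simps(2)[of k f] by blast
qed

lemma Ck_const: "Ck k (\<lambda>x. c)"
proof (induction k arbitrary: c)
  case (Suc k)
  show ?case by (rule Ck_SucI[where f' = "\<lambda>_ _. 0"]) (auto intro: Suc)
qed auto

lemma Ck_add:
  assumes "Ck k f" "Ck k g"
  shows "Ck k (\<lambda>x. f x + g x)"
  using assms
proof (induction k arbitrary: f g)
  case (Suc k)
  show ?case
    by (rule Ck_SucI, rule has_derivative_add[OF Ck_Suc_derivative[OF Suc.prems(1)] Ck_Suc_derivative[OF Suc.prems(2)]])
       (use Suc in auto)
qed (auto intro: continuous_on_add)

lemma Ck_mult:
  assumes "Ck k f" "Ck k g"
  shows "Ck k (\<lambda>x. f x * g x)"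
  using assms
proof (induction k arbitrary: f g)
  case (Suc k)
  have "Ck k f" "Ck k g" by (rule Suc.prems[THEN Ck_mono])+
  then show ?case
    by (intro Ck_SucI[OF has_derivative_mult[OF Suc.prems[THEN Ck_Suc_derivative]]] Ck_add Suc.IH)
       (use Suc.prems in auto)
qed (auto intro: continuous_on_mult)

lemma Ck_prod:
  assumes "\<And>i. i \<in> I \<Longrightarrow> Ck k (f i)"
  shows "Ck k (\<lambda>x. \<Prod>i\<in>I. f i x)"
  using assms by (induction I rule: infinite_finite_induct) (auto intro: Ck_const Ck_mult)

definition flat :: "nat \<Rightarrow> real \<Rightarrow> real" where
  "flat m t = (if t > 0 then inverse t ^ m * exp (- inverse t) else 0)"

lemma flat_lim: "(flat m \<longlongrightarrow> 0) (at_right 0)"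
proof -
  have "((\<lambda>t::real. inverse t ^ m / exp (inverse t)) \<longlongrightarrow> 0) (at_right 0)"
    by (rule filterlim_compose[OF tendsto_power_div_exp_0 filterlim_inverse_at_top_right])
  moreover have "eventually (\<lambda>t. inverse t ^ m / exp (inverse t) = flat m t) (at_right 0)"
    by (auto simp: flat_def eventually_at_right_less exp_minus divide_simps
        intro!: eventually_mono[OF eventually_at_right_less[of "0::real"]])
  ultimately show ?thesis by (rule Lim_transform_eventually)
qed

lemma flat_deriv: "(flat m has_real_derivative (flat (m + 2) t - real m * flat (m + 1) t)) (at t)"
proof -
  consider "t > 0" | "t < 0" | "t = 0" by linarith
  then show ?thesis
  proof cases
    case 1
    define i where "i = inverse t"
    have d: "(inverse has_real_derivative - (i * i)) (at t)"
      using 1 DERIV_inverse[of t UNIV] by (simp add: i_def power2_eq_square)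
    have "((\<lambda>t. inverse t ^ m * exp (- inverse t)) has_real_derivative
        (i ^ m * (exp (- i) * (i * i)) + real m * (- (i * i) * i ^ (m - 1)) * exp (- i))) (at t)"
      unfolding i_def by (intro DERIV_mult' DERIV_chain'[OF DERIV_minus DERIV_exp, THEN DERIV_cong] DERIV_power[THEN DERIV_cong])
        (use d in \<open>auto simp: i_def\<close>)
    moreover have "i ^ m * (exp (- i) * (i * i)) + real m * (- (i * i) * i ^ (m - 1)) * exp (- i)
        = flat (m + 2) t - real m * flat (m + 1) t"
      using 1 by (cases m) (auto simp: flat_def i_def[symmetric] algebra_simps)
    ultimately have "((\<lambda>t. inverse t ^ m * exp (- inverse t)) has_real_derivative
        (flat (m + 2) t - real m * flat (m + 1) t)) (at t)" by simp
    moreover have "eventually (\<lambda>s. inverse s ^ m * exp (- inverse s) = flat m s) (nhds t)"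
      using 1 eventually_nhds_in_open[of "{0<..}" t]
      by (auto elim!: eventually_mono simp: flat_def)
    ultimately show ?thesis
      by (metis (mono_tags, lifting) DERIV_cong_ev eventually_mono)
  next
    case 2
    have "((\<lambda>t. 0) has_real_derivative (flat (m + 2) t - real m * flat (m + 1) t)) (at t)"
      using 2 by (auto simp: flat_def)
    moreover have "eventually (\<lambda>s. 0 = flat m s) (nhds t)"
      using 2 eventually_nhds_in_open[of "{..<0}" t]
      by (auto elim!: eventually_mono simp: flat_def)
    ultimately show ?thesis
      by (metis (mono_tags, lifting) DERIV_cong_ev eventually_mono)
  next
    case 3
    have r: "((\<lambda>h. flat m h / h) \<longlongrightarrow> 0) (at_right 0)"
      by (rule Lim_transform_eventually[OF flat_lim[of "Suc m"]])
         (auto simp: flat_def divide_simps intro!: eventually_mono[OF eventually_at_right_less[of "0::real"]])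
    have l: "((\<lambda>h. flat m h / h) \<longlongrightarrow> 0) (at_left 0)"
    proof (rule Lim_transform_eventually[OF tendsto_const])
      show "eventually (\<lambda>h. 0 = flat m h / h) (at_left 0)"
        by (auto simp: flat_def eventually_at_filter)
    qed
    from l r have "((\<lambda>h. flat m h / h) \<longlongrightarrow> 0) (at 0)"
      by (rule filterlim_split_at)
    then show ?thesis using 3 by (simp add: flat_def DERIV_def)
  qed
qed

lemma Ck_flat: "Ck k (\<lambda>x::real^'n::finite. flat m (c * (x $ i - a)))"
proof (induction k arbitrary: m)
  case 0
  have "continuous_on UNIV (flat m)"
    by (meson DERIV_isCont continuous_at_imp_continuous_on flat_deriv)
  then have "continuous_on UNIV (\<lambda>x::real^'n. flat m (c * (x $ i - a)))"
    by (rule continuous_on_compose2) (auto intro!: continuous_intros)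
  then show ?case by simp
next
  case (Suc k)
  show ?case
  proof (rule Ck_SucI)
    fix x :: "real^'n"
    show "((\<lambda>x. flat m (c * (x $ i - a))) has_derivative
       (\<lambda>h. (c * (h $ i)) * (flat (m + 2) (c * (x $ i - a)) + (- real m) * flat (m + 1) (c * (x $ i - a))))) (at x)"
    proof (rule has_derivative_eq_rhs)
      have "((\<lambda>x. x $ i) has_derivative (\<lambda>h. h $ i)) (at x)"
        by (rule bounded_linear_imp_has_derivative[OF bounded_linear_vec_nth])
      then have "((\<lambda>x. c * (x $ i - a)) has_derivative (\<lambda>h. c * (h $ i - 0))) (at x)"
        by (rule has_derivative_mult_right[OF has_derivative_diff[OF _ has_derivative_const]])
      from has_derivative_compose[OF this flat_deriv[unfolded has_field_derivative_def]]
      show "((\<lambda>x. flat m (c * (x $ i - a))) has_derivative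
        (\<lambda>h. (flat (m + 2) (c * (x $ i - a)) - real m * flat (m + 1) (c * (x $ i - a))) * (c * (h $ i - 0)))) (at x)" .
    qed (simp add: mult.commute)
  next
    fix j
    show "Ck k (\<lambda>x. (c * (axis j 1 $ i)) * (flat (m + 2) (c * (x $ i - a)) + (- real m) * flat (m + 1) (c * (x $ i - a))))"
      by (rule Ck_mult[OF Ck_const Ck_add[OF Suc Ck_mult[OF Ck_const Suc]]])
  qed
qed

definition bump :: "nat \<Rightarrow> real^'n::finite \<Rightarrow> real^'n \<Rightarrow> real^'n \<Rightarrow> real" where
  "bump k a b x = (\<Prod>i\<in>UNIV. flat 0 (real (Suc k) * (x $ i - a $ i)) * flat 0 (- real (Suc k) * (x $ i - b $ i)))"

lemma bump_zero: "x \<notin> box a b \<Longrightarrow> bump k a b x = 0"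
  by (fastforce simp: bump_def mem_box_cart flat_def zero_less_mult_iff)

lemma bump_bound: "norm (bump k a b x) \<le> indicator (box a b) x"
proof (cases "x \<in> box a b")
  case True
  have "0 \<le> flat 0 t \<and> flat 0 t \<le> 1" for t by (auto simp: flat_def)
  then have "0 \<le> bump k a b x \<and> bump k a b x \<le> 1"
    unfolding bump_def by (intro conjI prod_nonneg ballI mult_nonneg_nonneg prod_le_1 mult_le_one) auto
  with True show ?thesis by auto
qed (auto simp: bump_zero)

lemma bump_test: "test_function (bump k a b)"
proof -
  have "Ck n (bump k a b)" for n
    unfolding bump_def by (intro Ck_prod Ck_mult Ck_flat)
  moreover have "bounded {x. bump k a b x \<noteq> 0}"
    by (rule bounded_subset[OF bounded_box[of a b]]) (auto intro: ccontr bump_zero)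
  ultimately show ?thesis unfolding test_function_def compact_closure by blast
qed

lemma bump_lim: "(\<lambda>k. bump k a b x) \<longlonglongrightarrow> indicator (box a b) x"
proof (cases "x \<in> box a b")
  case True
  have *: "(\<lambda>k. flat 0 (real (Suc k) * t)) \<longlonglongrightarrow> 1" if "t > 0" for t
  proof -
    have "(\<lambda>k. exp (- (inverse (real (Suc k)) * inverse t))) \<longlonglongrightarrow> exp (- (0 * inverse t))"
      by (rule tendsto_exp[OF tendsto_minus[OF tendsto_mult[OF LIMSEQ_inverse_real_of_nat tendsto_const]]])
    moreover have "flat 0 (real (Suc k) * t) = exp (- (inverse (real (Suc k)) * inverse t))" for k
      using that by (simp add: flat_def del: of_nat_Suc)
    ultimately show ?thesis by simp
  qed
  have "(\<lambda>k. \<Prod>i\<in>UNIV. flat 0 (real (Suc k) * (x $ i - a $ i)) * flat 0 (real (Suc k) * (b $ i - x $ i)))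
     \<longlonglongrightarrow> (\<Prod>i\<in>(UNIV::'a set). 1 * 1)"
    using True by (intro tendsto_prod tendsto_mult *) (auto simp: mem_box_cart)
  moreover have neg: "- c * (y - z) = c * (z - y)" for c y z :: real by (simp add: algebra_simps)
  have "bump k a b x = (\<Prod>i\<in>UNIV. flat 0 (real (Suc k) * (x $ i - a $ i)) * flat 0 (real (Suc k) * (b $ i - x $ i)))" for k
    unfolding bump_def by (subst neg) (rule refl)
  ultimately show ?thesis using True by simp
qed (auto simp: bump_zero)

lemma test_function_measurable:
  assumes "test_function \<phi>"
  shows "\<phi> \<in> borel_measurable borel"
proof (rule borel_measurable_continuous_onI)
  have "Ck 0 \<phi>" using assms unfolding test_function_def by blast
  then show "continuous_on UNIV \<phi>" by simp
qed

(* Steps towards the fundamental lemma of the calculus of variations, which makes weak gradients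
   unique almost everywhere and hence the vector space operations and the inner product on H^1
   compatible with taking weak gradients. *)
lemma AE_zero_if_box_integrals_zero:
  fixes f :: "'a::euclidean_space \<Rightarrow> real"
  assumes f: "integrable lborel f"
    and box0: "\<And>a b. (LINT x:box a b|lborel. f x) = 0"
  shows "AE x in lborel. f x = 0"
proof (rule density_unique_real[OF f integrable_zero])
  fix A :: "'a set" assume "A \<in> sets lborel"
  then have A: "A \<in> sigma_sets UNIV (range (\<lambda>(a, b). box a b))"
    by (simp add: borel_eq_box)
  have "Int_stable (range (\<lambda>(a, b). box a b :: 'a set))"
    by (auto simp: Int_stable_def box_Int_box)
  moreover have "range (\<lambda>(a, b). box a b :: 'a set) \<subseteq> Pow UNIV"
    by simp
  ultimately have "A \<in> sets borel \<and> (LINT x:A|lborel. f x) = 0"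
    using A
  proof (induction rule: sigma_sets_induct_disjoint)
    case (basic B)
    then show ?case using box0 by auto
  next
    case empty
    then show ?case by (simp add: set_lebesgue_integral_def)
  next
    case (compl B)
    have UNIV0: "(LINT x|lborel. f x) = 0"
    proof -
      have "(\<lambda>n. LINT x:box (- (real n *\<^sub>R One)) (real n *\<^sub>R One)|lborel. f x) \<longlonglongrightarrow>
        (LINT x:(\<Union>n::nat. box (- (real n *\<^sub>R One)) (real n *\<^sub>R One))|lborel. f x)"
      proof (rule set_integral_cont_up)
        show "incseq (\<lambda>n. box (- (real n *\<^sub>R One)) (real n *\<^sub>R One) :: 'a set)"
          by (intro incseq_SucI subset_box_imp) auto
      qed (simp_all add: UN_box_eq_UNIV set_integrable_def f)
      then have "(LINT x:(\<Union>n::nat. box (- (real n *\<^sub>R One)) (real n *\<^sub>R One))|lborel. f x) = 0"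
        by (simp only: box0 LIMSEQ_const_iff)
      then show ?thesis
        by (simp add: UN_box_eq_UNIV set_lebesgue_integral_def)
    qed
    have B: "set_integrable lborel B f" "set_integrable lborel (UNIV - B) f"
      using compl unfolding set_integrable_def by (intro integrable_mult_indicator f; auto)+
    have "(LINT x:B \<union> (UNIV - B)|lborel. f x) = (LINT x:B|lborel. f x) + (LINT x:UNIV - B|lborel. f x)"
      by (rule set_integral_Un) (use B in auto)
    moreover have "UNIV - B \<in> sets borel"
      using compl sets.compl_sets[of B borel] by simp
    ultimately show ?case using compl UNIV0 by (simp add: set_lebesgue_integral_def)
  next
    case (union F)
    have "set_integrable lborel (\<Union>i. F i) f"
      unfolding set_integrable_def using union by (intro integrable_mult_indicator f) auto
    from lebesgue_integral_countable_add[OF _ _ this]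
    have "(LINT x:(\<Union>i. F i)|lborel. f x) = (\<Sum>i. LINT x:F i|lborel. f x)"
      using union by (auto simp: disjoint_family_on_def)
    with union show ?case by auto
  qed
  then show "(LINT x:A|lborel. f x) = (LINT x:A|lborel. 0)"
    by (simp add: set_lebesgue_integral_def)
qed

lemma fundamental_lemma:
  fixes g :: "real^'n::finite \<Rightarrow> real"
  assumes [measurable]: "g \<in> borel_measurable lborel" and sq: "integrable lborel (\<lambda>x. (norm (g x))\<^sup>2)"
    and zero: "\<And>\<phi>. test_function \<phi> \<Longrightarrow> (LINT x|lborel. \<phi> x * g x) = 0"
  shows "AE x in lborel. g x = 0"
proof -
  have int: "integrable lborel (\<lambda>x. indicator (box a b) x * g x)" for a b
  proof (rule Bochner_Integration.integrable_bound)
    show "integrable lborel (\<lambda>x. indicator (box a b) x + (norm (g x))\<^sup>2)"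
      by (intro Bochner_Integration.integrable_add sq) (auto simp: emeasure_lborel_box_eq less_top[symmetric])
    have "norm (g x) \<le> 1 + (norm (g x))\<^sup>2" for x
      using zero_le_power2[of "norm (g x) - 1"] norm_ge_zero[of "g x"]
      by (simp only: power2_diff) simp
    then show "AE x in lborel. norm (indicator (box a b) x * g x) \<le> norm (indicator (box a b) x + (norm (g x))\<^sup>2)"
      by (auto simp: indicator_def)
  qed measurable
  have box0: "(LINT x|lborel. indicator (box a b) x * g x) = 0" for a b
  proof -
    have m: "bump k a b \<in> borel_measurable borel" for k
      by (rule test_function_measurable[OF bump_test])
    have "(\<lambda>k. LINT x|lborel. bump k a b x * g x) \<longlonglongrightarrow> (LINT x|lborel. indicator (box a b) x * g x)"
    proof (rule integral_dominated_convergence[where w = "\<lambda>x. norm (indicator (box a b) x * g x)"])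
      show "AE x in lborel. (\<lambda>k. bump k a b x * g x) \<longlonglongrightarrow> indicator (box a b) x * g x"
        by (intro AE_I2 tendsto_intros bump_lim)
      show "AE x in lborel. norm (bump k a b x * g x) \<le> norm (indicator (box a b) x * g x)" for k
        using bump_bound[of k a b] by (intro AE_I2) (auto simp: abs_mult intro!: mult_right_mono)
      show "integrable lborel (\<lambda>x. norm (indicator (box a b) x * g x))"
        using int by (rule integrable_norm)
    qed (use m in measurable)
    then show ?thesis
      by (simp add: zero[OF bump_test] LIMSEQ_const_iff)
  qed
  have key: "AE x in lborel. indicator (box a b) x * g x = 0" for a b :: "real^'n"
  proof (rule AE_zero_if_box_integrals_zero[OF int])
    fix c d :: "real^'n"
    have "(LINT x:box c d|lborel. indicator (box a b) x * g x) = (LINT x|lborel. indicator (box c d \<inter> box a b) x * g x)"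
      unfolding set_lebesgue_integral_def
      by (rule Bochner_Integration.integral_cong) (auto simp: indicator_def)
    then show "(LINT x:box c d|lborel. indicator (box a b) x * g x) = 0"
      by (simp only: box_Int_box box0)
  qed
  have "AE x in lborel. \<forall>n::nat. indicator (box (- (real n *\<^sub>R One)) (real n *\<^sub>R One)) x * g x = 0"
    unfolding AE_all_countable by (intro allI key)
  then show ?thesis
  proof (rule AE_mp, intro AE_I2 impI)
    fix x :: "real^'n" assume *: "\<forall>n::nat. indicator (box (- (real n *\<^sub>R One)) (real n *\<^sub>R One)) x * g x = 0"
    have "x \<in> (\<Union>n::nat. box (- (real n *\<^sub>R One)) (real n *\<^sub>R One))"
      unfolding UN_box_eq_UNIV by simp
    then obtain n :: nat where "x \<in> box (- (real n *\<^sub>R One)) (real n *\<^sub>R One)" by blast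
    with *[rule_format, of n] show "g x = 0" by simp
  qed
qed


definition square_integrable :: "(real^'n::finite \<Rightarrow> 'b::euclidean_space) \<Rightarrow> bool" where
  "square_integrable f \<longleftrightarrow>
     f \<in> borel_measurable lborel \<and> integrable lborel (\<lambda>x. (norm (f x))\<^sup>2)"

lemma square_integrable_inner:
  assumes "square_integrable f" "square_integrable g"
  shows "integrable lborel (\<lambda>x. f x \<bullet> g x)"
proof (rule Bochner_Integration.integrable_bound)
  show "integrable lborel (\<lambda>x. (norm (f x))\<^sup>2 + (norm (g x))\<^sup>2)"
    using assms by (auto simp: square_integrable_def)
  show "(\<lambda>x. f x \<bullet> g x) \<in> borel_measurable lborel"
    using assms by (auto simp: square_integrable_def)
  have "\<bar>f x \<bullet> g x\<bar> \<le> (norm (f x))\<^sup>2 + (norm (g x))\<^sup>2" for x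
  proof -
    have "\<bar>f x \<bullet> g x\<bar> \<le> norm (f x) * norm (g x)" by (rule Cauchy_Schwarz_ineq2)
    also have "\<dots> \<le> (norm (f x))\<^sup>2 + (norm (g x))\<^sup>2"
      using sum_squares_bound[of "norm (f x)" "norm (g x)"]
        mult_nonneg_nonneg[OF norm_ge_zero norm_ge_zero, of "f x" "g x"] by linarith
    finally show ?thesis .
  qed
  then show "AE x in lborel. norm (f x \<bullet> g x) \<le> norm ((norm (f x))\<^sup>2 + (norm (g x))\<^sup>2)"
    by (intro AE_I2) simp
qed

lemma square_integrable_scaleR: "square_integrable f \<Longrightarrow> square_integrable (\<lambda>x. c *\<^sub>R f x)"
  by (auto simp: square_integrable_def power_mult_distrib)

lemma square_integrable_add:
  assumes "square_integrable f" "square_integrable g"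
  shows "square_integrable (\<lambda>x. f x + g x)"
proof -
  have "(norm (f x + g x))\<^sup>2 = (norm (f x))\<^sup>2 + 2 * (f x \<bullet> g x) + (norm (g x))\<^sup>2" for x
    by (simp add: power2_norm_eq_inner inner_add_left inner_add_right inner_commute)
  then show ?thesis
    using assms square_integrable_inner[OF assms] by (auto simp: square_integrable_def)
qed

lemma square_integrable_component:
  assumes "square_integrable f"
  shows "square_integrable (\<lambda>x. f x \<bullet> b)"
proof -
  have "integrable lborel (\<lambda>x. (norm (f x \<bullet> b))\<^sup>2)"
  proof (rule Bochner_Integration.integrable_bound)
    show "integrable lborel (\<lambda>x. (norm b)\<^sup>2 * (norm (f x))\<^sup>2)"
      using assms by (auto simp: square_integrable_def)
    show "(\<lambda>x. (norm (f x \<bullet> b))\<^sup>2) \<in> borel_measurable lborel"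
      using assms by (auto simp: square_integrable_def)
    have "(norm (f x \<bullet> b))\<^sup>2 \<le> (norm b)\<^sup>2 * (norm (f x))\<^sup>2" for x
      using power_mono[OF Cauchy_Schwarz_ineq2[of "f x" b], of 2]
      by (simp add: power_mult_distrib mult.commute)
    then show "AE x in lborel. norm ((norm (f x \<bullet> b))\<^sup>2) \<le> norm ((norm b)\<^sup>2 * (norm (f x))\<^sup>2)"
      by (intro AE_I2) simp
  qed
  then show ?thesis using assms by (auto simp: square_integrable_def)
qed

lemma test_function_square_integrable:
  assumes "test_function \<phi>"
  shows "square_integrable \<phi>"
proof -
  let ?K = "closure {x. \<phi> x \<noteq> 0}"
  have K: "compact ?K" and c: "continuous_on UNIV \<phi>"
    using assms Ck.simps(1)[of \<phi>] unfolding test_function_def by blast+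
  have "integrable lborel (\<lambda>x. indicator ?K x *\<^sub>R (norm (\<phi> x))\<^sup>2)"
    by (rule borel_integrable_compact[OF K])
       (intro continuous_intros continuous_on_subset[OF c]; simp)
  moreover have "indicator ?K x *\<^sub>R (norm (\<phi> x))\<^sup>2 = (norm (\<phi> x))\<^sup>2" for x
    using closure_subset[of "{x. \<phi> x \<noteq> 0}"] by (auto simp: indicator_def)
  ultimately show ?thesis
    using test_function_measurable[OF assms] by (simp only: square_integrable_def measurable_lborel2)
qed

lemma test_function_partial:
  assumes "test_function \<phi>"
  shows "test_function (\<lambda>x. frechet_derivative \<phi> (at x) (axis i 1))" (is "test_function ?d")
proof -
  have "Ck k ?d" for k
  proof -
    have "Ck (Suc k) \<phi>" using assms unfolding test_function_def by blast
    then show ?thesis by simp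
  qed
  moreover have "{x. ?d x \<noteq> 0} \<subseteq> closure {x. \<phi> x \<noteq> 0}"
  proof (rule subsetI, rule ccontr)
    fix x assume x: "x \<in> {x. ?d x \<noteq> 0}" "x \<notin> closure {x. \<phi> x \<noteq> 0}"
    have "(\<phi> has_derivative (\<lambda>_. 0)) (at x)"
    proof (rule has_derivative_transform_within_open[OF has_derivative_const])
      show "open (- closure {x. \<phi> x \<noteq> 0})" by auto
      show "x \<in> - closure {x. \<phi> x \<noteq> 0}" using x by simp
      show "0 = \<phi> y" if "y \<in> - closure {x. \<phi> x \<noteq> 0}" for y
        using that closure_subset[of "{x. \<phi> x \<noteq> 0}"] by auto
    qed
    from frechet_derivative_at[OF this, symmetric] x(1) show False by simp
  qed
  moreover have "bounded (closure {x. \<phi> x \<noteq> 0})"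
    using assms unfolding test_function_def by (blast intro: compact_imp_bounded)
  ultimately show ?thesis
    unfolding test_function_def compact_closure by (blast intro: bounded_subset)
qed

lemma test_function_scaleR_integrable:
  fixes f :: "real^'n::finite \<Rightarrow> 'b::euclidean_space"
  assumes "test_function \<phi>" "square_integrable f"
  shows "integrable lborel (\<lambda>x. \<phi> x *\<^sub>R f x)"
proof -
  have "integrable lborel (\<lambda>x. \<Sum>b\<in>Basis. (\<phi> x \<bullet> (f x \<bullet> b)) *\<^sub>R b)"
    by (intro Bochner_Integration.integrable_sum integrable_scaleR_left square_integrable_inner
        test_function_square_integrable square_integrable_component assms)
  moreover have "(\<Sum>b\<in>Basis. (\<phi> x \<bullet> (f x \<bullet> b)) *\<^sub>R b) = \<phi> x *\<^sub>R f x" for x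
    by (subst (2) euclidean_representation[symmetric, of "f x"]) (simp add: scaleR_sum_right)
  ultimately show ?thesis by simp
qed

(* Real test functions suffice also for complex-valued u, by linearity. The integrals are
   meaningful for square integrable u and G, and the predicate is only used for those. *)
definition is_weak_gradient :: "(real^'n::finite \<Rightarrow> complex) \<Rightarrow> (real^'n \<Rightarrow> complex^'n) \<Rightarrow> bool" where
  "is_weak_gradient u G \<longleftrightarrow> (\<forall>\<phi> i. test_function \<phi> \<longrightarrow>
     (LINT x|lborel. frechet_derivative \<phi> (at x) (axis i 1) *\<^sub>R u x) =
       - (LINT x|lborel. \<phi> x *\<^sub>R (G x $ i)))"

definition sobolev_fun :: "(real^'n::finite \<Rightarrow> complex) \<Rightarrow> bool" where
  "sobolev_fun u \<longleftrightarrow> square_integrable u \<and> (\<exists>G. square_integrable G \<and> is_weak_gradient u G)"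

definition weak_gradient :: "(real^'n::finite \<Rightarrow> complex) \<Rightarrow> real^'n \<Rightarrow> complex^'n" where
  "weak_gradient u = (SOME G. square_integrable G \<and> is_weak_gradient u G)"

lemma square_integrable_nth:
  fixes G :: "real^'n::finite \<Rightarrow> complex^'m::finite"
  assumes "square_integrable G"
  shows "square_integrable (\<lambda>x. G x $ i)"
proof -
  have [measurable]: "G \<in> borel_measurable lborel" using assms by (simp add: square_integrable_def)
  have m: "(\<lambda>x. G x $ i) \<in> borel_measurable lborel"
    by (rule measurable_compose[of G lborel borel])
       (auto intro!: borel_measurable_continuous_onI linear_continuous_on bounded_linear_vec_nth)
  have "integrable lborel (\<lambda>x. (norm (G x $ i))\<^sup>2)"
  proof (rule Bochner_Integration.integrable_bound)
    show "integrable lborel (\<lambda>x. (norm (G x))\<^sup>2)"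
      using assms by (simp add: square_integrable_def)
    show "AE x in lborel. norm ((norm (G x $ i))\<^sup>2) \<le> norm ((norm (G x))\<^sup>2)"
      by (intro AE_I2) (simp add: power_mono Finite_Cartesian_Product.norm_nth_le)
  qed (use m in measurable)
  with m show ?thesis by (simp add: square_integrable_def)
qed

lemma is_weak_gradient_unique:
  assumes "is_weak_gradient u G" "is_weak_gradient v K" "AE x in lborel. u x = v x"
    and u: "square_integrable u" "square_integrable v" and G: "square_integrable G" "square_integrable K"
  shows "AE x in lborel. G x = K x"
proof -
  have *: "AE x in lborel. (G x $ i - K x $ i) \<bullet> b = 0" for i b
  proof (rule fundamental_lemma)
    have D: "square_integrable (\<lambda>x. (G x $ i - K x $ i))"
      using square_integrable_add[OF square_integrable_nth[OF G(1), of i]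
          square_integrable_scaleR[OF square_integrable_nth[OF G(2), of i], of "-1"]] by simp
    from square_integrable_component[OF this, of b]
    show "(\<lambda>x. (G x $ i - K x $ i) \<bullet> b) \<in> borel_measurable lborel"
      "integrable lborel (\<lambda>x. (norm ((G x $ i - K x $ i) \<bullet> b))\<^sup>2)"
      unfolding square_integrable_def by blast+
    fix \<phi> :: "real^'a \<Rightarrow> real" assume t: "test_function \<phi>"
    have "(LINT x|lborel. frechet_derivative \<phi> (at x) (axis i 1) *\<^sub>R u x) =
       (LINT x|lborel. frechet_derivative \<phi> (at x) (axis i 1) *\<^sub>R v x)"
      using assms(3) test_function_scaleR_integrable[OF test_function_partial[OF t, of i] u(1)]
        test_function_scaleR_integrable[OF test_function_partial[OF t, of i] u(2)]
      by (intro integral_cong_AE) auto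
    then have "- (LINT x|lborel. \<phi> x *\<^sub>R (G x $ i)) = - (LINT x|lborel. \<phi> x *\<^sub>R (K x $ i))"
      by (simp only: assms(1,2)[unfolded is_weak_gradient_def, rule_format, OF t])
    then have eq: "(LINT x|lborel. \<phi> x *\<^sub>R (G x $ i)) = (LINT x|lborel. \<phi> x *\<^sub>R (K x $ i))"
      by (simp only: neg_equal_iff_equal)
    note int = test_function_scaleR_integrable[OF t square_integrable_nth[OF G(1), of i]]
      test_function_scaleR_integrable[OF t square_integrable_nth[OF G(2), of i]]
    have "(LINT x|lborel. \<phi> x * ((G x $ i - K x $ i) \<bullet> b)) =
        (LINT x|lborel. (\<phi> x *\<^sub>R (G x $ i) - \<phi> x *\<^sub>R (K x $ i)) \<bullet> b)"
      by (rule Bochner_Integration.integral_cong) (auto simp: inner_diff_left algebra_simps)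
    also have "\<dots> = (LINT x|lborel. \<phi> x *\<^sub>R (G x $ i) - \<phi> x *\<^sub>R (K x $ i)) \<bullet> b"
      by (rule integral_inner_left) (use int in auto)
    also have "\<dots> = 0" using int eq by simp
    finally show "(LINT x|lborel. \<phi> x * ((G x $ i - K x $ i) \<bullet> b)) = 0" .
  qed
  have "AE x in lborel. \<forall>i\<in>UNIV. \<forall>b\<in>Basis. (G x $ i - K x $ i) \<bullet> b = 0"
    by (intro AE_finite_allI *) auto
  then show ?thesis
  proof (rule AE_mp, intro AE_I2 impI)
    fix x assume "\<forall>i\<in>UNIV. \<forall>b\<in>Basis. (G x $ i - K x $ i) \<bullet> b = 0"
    then have "G x $ i - K x $ i = 0" for i
      by (simp only: euclidean_all_zero_iff ball_UNIV)
    then show "G x = K x" by (simp add: vec_eq_iff)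
  qed
qed

lemma weak_gradient:
  assumes "sobolev_fun u"
  shows "square_integrable (weak_gradient u)" "is_weak_gradient u (weak_gradient u)"
proof -
  have "square_integrable (weak_gradient u) \<and> is_weak_gradient u (weak_gradient u)"
    using assms someI_ex[of "\<lambda>G. square_integrable G \<and> is_weak_gradient u G"]
    unfolding weak_gradient_def sobolev_fun_def by blast
  then show "square_integrable (weak_gradient u)" "is_weak_gradient u (weak_gradient u)" by blast+
qed

lemma weak_gradient_AE_eq:
  assumes "sobolev_fun u" "square_integrable v" "AE x in lborel. u x = v x"
    "square_integrable G" "is_weak_gradient v G"
  shows "AE x in lborel. weak_gradient u x = G x"
  using is_weak_gradient_unique[OF weak_gradient(2)[OF assms(1)] assms(5,3) _ assms(2) weak_gradient(1)[OF assms(1)] assms(4)]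
    assms(1) sobolev_fun_def by blast

lemma is_weak_gradient_scaleR:
  assumes "is_weak_gradient u G"
  shows "is_weak_gradient (\<lambda>x. c *\<^sub>R u x) (\<lambda>x. c *\<^sub>R G x)"
  unfolding is_weak_gradient_def
proof (intro allI impI)
  fix \<phi> :: "real^'a \<Rightarrow> real" and i assume t: "test_function \<phi>"
  have "c *\<^sub>R (LINT x|lborel. frechet_derivative \<phi> (at x) (axis i 1) *\<^sub>R u x) =
       c *\<^sub>R (- (LINT x|lborel. \<phi> x *\<^sub>R (G x $ i)))"
    by (simp only: assms[unfolded is_weak_gradient_def, rule_format, OF t])
  moreover have "c *\<^sub>R (LINT x|lborel. h x *\<^sub>R f x) = (LINT x|lborel. h x *\<^sub>R (c *\<^sub>R f x))"
    for h :: "real^'a \<Rightarrow> real" and f :: "real^'a \<Rightarrow> complex"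
    by (subst integral_scaleR_right[symmetric]) (simp add: mult.commute)
  ultimately show "(LINT x|lborel. frechet_derivative \<phi> (at x) (axis i 1) *\<^sub>R (c *\<^sub>R u x)) =
       - (LINT x|lborel. \<phi> x *\<^sub>R ((c *\<^sub>R G x) $ i))"
    by (simp only: vector_scaleR_component scaleR_minus_right)
qed

lemma is_weak_gradient_add:
  assumes "is_weak_gradient u G" "is_weak_gradient v K"
    and u: "square_integrable u" "square_integrable v" and G: "square_integrable G" "square_integrable K"
  shows "is_weak_gradient (\<lambda>x. u x + v x) (\<lambda>x. G x + K x)"
  unfolding is_weak_gradient_def
proof (intro allI impI)
  fix \<phi> :: "real^'a \<Rightarrow> real" and i assume t: "test_function \<phi>"
  note t' = test_function_partial[OF t, of i]
  have "(LINT x|lborel. frechet_derivative \<phi> (at x) (axis i 1) *\<^sub>R (u x + v x)) =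
     (LINT x|lborel. frechet_derivative \<phi> (at x) (axis i 1) *\<^sub>R u x) +
     (LINT x|lborel. frechet_derivative \<phi> (at x) (axis i 1) *\<^sub>R v x)"
    unfolding scaleR_add_right
    by (intro Bochner_Integration.integral_add test_function_scaleR_integrable t' u)
  also have "\<dots> = - (LINT x|lborel. \<phi> x *\<^sub>R (G x $ i)) + - (LINT x|lborel. \<phi> x *\<^sub>R (K x $ i))"
    by (simp only: assms(1,2)[unfolded is_weak_gradient_def, rule_format, OF t])
  also have "\<dots> = - (LINT x|lborel. \<phi> x *\<^sub>R (G x $ i) + \<phi> x *\<^sub>R (K x $ i))"
    by (subst Bochner_Integration.integral_add)
       (auto intro!: test_function_scaleR_integrable t square_integrable_nth G)
  finally show "(LINT x|lborel. frechet_derivative \<phi> (at x) (axis i 1) *\<^sub>R (u x + v x)) =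
       - (LINT x|lborel. \<phi> x *\<^sub>R ((G x + K x) $ i))"
    by (simp only: vector_add_component scaleR_add_right)
qed

lemma sobolev_funI:
  "square_integrable u \<Longrightarrow> square_integrable G \<Longrightarrow> is_weak_gradient u G \<Longrightarrow> sobolev_fun u"
  unfolding sobolev_fun_def by blast

lemma sobolev_fun_square_integrable: "sobolev_fun u \<Longrightarrow> square_integrable u"
  unfolding sobolev_fun_def by blast

lemma sobolev_fun_scaleR:
  assumes "sobolev_fun u"
  shows "sobolev_fun (\<lambda>x. c *\<^sub>R u x)"
  by (rule sobolev_funI[OF square_integrable_scaleR[OF sobolev_fun_square_integrable[OF assms]]
        square_integrable_scaleR[OF weak_gradient(1)[OF assms]]
        is_weak_gradient_scaleR[OF weak_gradient(2)[OF assms]]])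

lemma sobolev_fun_add:
  assumes "sobolev_fun u" "sobolev_fun v"
  shows "sobolev_fun (\<lambda>x. u x + v x)"
  by (rule sobolev_funI[OF square_integrable_add[OF assms[THEN sobolev_fun_square_integrable]]
        square_integrable_add[OF assms[THEN weak_gradient(1)]]
        is_weak_gradient_add[OF assms[THEN weak_gradient(2)] assms[THEN sobolev_fun_square_integrable]
          assms[THEN weak_gradient(1)]]])

lemma sobolev_fun_zero: "sobolev_fun (\<lambda>x. 0)"
proof -
  have "square_integrable (\<lambda>x::real^'n. 0 :: 'b::euclidean_space)"
    by (simp add: square_integrable_def)
  moreover have "is_weak_gradient (\<lambda>x::real^'n. 0) (\<lambda>x. 0)"
    by (simp add: is_weak_gradient_def)
  ultimately show ?thesis
    unfolding sobolev_fun_def by (auto simp: square_integrable_def intro!: exI[of _ "\<lambda>x. 0"])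
qed

(* H^1(R^n, C): square integrable functions with a square integrable weak gradient, modulo
   equality almost everywhere. It is treated as a real Hilbert space, so that derivatives of
   real-valued functionals are R-linear; for complex vectors the inner product used here is
   Re <u, v>, so the norm is the usual sqrt (|u|_2^2 + |grad u|_2^2). *)
quotient_type (overloaded) 'n h1 = "real^'n::finite \<Rightarrow> complex" /
  partial: "\<lambda>u v. sobolev_fun u \<and> sobolev_fun v \<and> (AE x in lborel. u x = v x)"
  morphisms rep_h1 abs_h1
proof (rule part_equivpI)
  show "\<exists>u::real^'n \<Rightarrow> complex. sobolev_fun u \<and> sobolev_fun u \<and> (AE x in lborel. u x = u x)"
    using sobolev_fun_zero by auto
  show "symp (\<lambda>u v::real^'n \<Rightarrow> complex. sobolev_fun u \<and> sobolev_fun v \<and> (AE x in lborel. u x = v x))"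
    by (rule sympI) (auto elim: AE_mp)
  show "transp (\<lambda>u v::real^'n \<Rightarrow> complex. sobolev_fun u \<and> sobolev_fun v \<and> (AE x in lborel. u x = v x))"
    by (rule transpI) (auto elim: AE_mp)
qed

lemma weak_gradient_cong:
  assumes "sobolev_fun u" "sobolev_fun v" "AE x in lborel. u x = v x"
  shows "AE x in lborel. weak_gradient u x = weak_gradient v x"
  using weak_gradient_AE_eq[OF assms(1) sobolev_fun_square_integrable assms(3) weak_gradient]
    assms(2) by blast

lemma weak_gradient_scaleR_AE:
  assumes "sobolev_fun u"
  shows "AE x in lborel. weak_gradient (\<lambda>x. c *\<^sub>R u x) x = c *\<^sub>R weak_gradient u x"
  by (rule weak_gradient_AE_eq[OF sobolev_fun_scaleR[OF assms]
        square_integrable_scaleR[OF sobolev_fun_square_integrable[OF assms]] _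
        square_integrable_scaleR[OF weak_gradient(1)[OF assms]]
        is_weak_gradient_scaleR[OF weak_gradient(2)[OF assms]]]) simp

lemma weak_gradient_add_AE:
  assumes "sobolev_fun u" "sobolev_fun v"
  shows "AE x in lborel. weak_gradient (\<lambda>x. u x + v x) x = weak_gradient u x + weak_gradient v x"
  by (rule weak_gradient_AE_eq[OF sobolev_fun_add[OF assms]
        square_integrable_add[OF assms[THEN sobolev_fun_square_integrable]] _
        square_integrable_add[OF assms[THEN weak_gradient(1)]]
        is_weak_gradient_add[OF assms[THEN weak_gradient(2)] assms[THEN sobolev_fun_square_integrable]
          assms[THEN weak_gradient(1)]]]) simp

instantiation h1 :: (finite) real_vector
begin

lift_definition zero_h1 :: "'a h1" is "\<lambda>_. 0"
  using sobolev_fun_zero by simp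

lift_definition plus_h1 :: "'a h1 \<Rightarrow> 'a h1 \<Rightarrow> 'a h1" is "\<lambda>u v x. u x + v x"
  by (auto intro: sobolev_fun_add)

lift_definition scaleR_h1 :: "real \<Rightarrow> 'a h1 \<Rightarrow> 'a h1" is "\<lambda>c u x. c *\<^sub>R u x"
  using sobolev_fun_scaleR by auto

definition uminus_h1 :: "'a h1 \<Rightarrow> 'a h1" where "uminus_h1 u = (-1) *\<^sub>R u"

definition minus_h1 :: "'a h1 \<Rightarrow> 'a h1 \<Rightarrow> 'a h1" where "minus_h1 u v = u + - v"

instance
proof
  fix u v w :: "'a h1" and c d :: real
  show "u + v + w = u + (v + w)"
    by transfer (auto simp: add.assoc intro!: sobolev_fun_add)
  show "u + v = v + u"
    by transfer (auto simp: add.commute intro!: sobolev_fun_add)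
  show "0 + u = u" by transfer auto
  show "- u + u = 0"
    unfolding uminus_h1_def by transfer (simp add: sobolev_fun_zero)
  show "u - v = u + - v" by (fact minus_h1_def)
  show "c *\<^sub>R (u + v) = c *\<^sub>R u + c *\<^sub>R v"
    by transfer (simp add: scaleR_add_right sobolev_fun_add sobolev_fun_scaleR)
  show "(c + d) *\<^sub>R u = c *\<^sub>R u + d *\<^sub>R u"
    by transfer (simp add: scaleR_add_left sobolev_fun_add sobolev_fun_scaleR)
  show "c *\<^sub>R d *\<^sub>R u = (c * d) *\<^sub>R u"
    by transfer (simp add: sobolev_fun_scaleR)
  show "1 *\<^sub>R u = u" by transfer auto
qed

end

instantiation h1 :: (finite) real_inner
begin

lift_definition inner_h1 :: "'a h1 \<Rightarrow> 'a h1 \<Rightarrow> real" is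
  "\<lambda>u v. (LINT x|lborel. u x \<bullet> v x) + (LINT x|lborel. weak_gradient u x \<bullet> weak_gradient v x)"
proof -
  fix u u' v v' :: "real^'a \<Rightarrow> complex"
  assume u: "sobolev_fun u \<and> sobolev_fun u' \<and> (AE x in lborel. u x = u' x)"
    and v: "sobolev_fun v \<and> sobolev_fun v' \<and> (AE x in lborel. v x = v' x)"
  have *: "(LINT x|lborel. f x \<bullet> g x) = (LINT x|lborel. f' x \<bullet> g' x)"
    if "square_integrable f" "square_integrable g" "square_integrable f'" "square_integrable g'"
      "AE x in lborel. f x = f' x" "AE x in lborel. g x = g' x"
    for f g f' g' :: "real^'a \<Rightarrow> 'c::euclidean_space"
  proof (rule integral_cong_AE)
    show "AE x in lborel. f x \<bullet> g x = f' x \<bullet> g' x" using that(5,6) by eventually_elim simp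
  qed (use that in \<open>auto simp: square_integrable_def\<close>)
  show "(LINT x|lborel. u x \<bullet> v x) + (LINT x|lborel. weak_gradient u x \<bullet> weak_gradient v x) =
    (LINT x|lborel. u' x \<bullet> v' x) + (LINT x|lborel. weak_gradient u' x \<bullet> weak_gradient v' x)"
    by (intro arg_cong2[where f = "(+)"] *)
       (use u v weak_gradient weak_gradient_cong sobolev_fun_square_integrable in blast)+
qed

definition norm_h1 :: "'a h1 \<Rightarrow> real" where "norm_h1 u = sqrt (u \<bullet> u)"

definition sgn_h1 :: "'a h1 \<Rightarrow> 'a h1" where "sgn_h1 u = u /\<^sub>R norm u"

definition dist_h1 :: "'a h1 \<Rightarrow> 'a h1 \<Rightarrow> real" where "dist_h1 u v = norm (u - v)"

definition uniformity_h1 :: "('a h1 \<times> 'a h1) filter" where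
  "uniformity_h1 = (INF e\<in>{0<..}. principal {(x, y). dist x y < e})"

definition open_h1 :: "'a h1 set \<Rightarrow> bool" where
  "open_h1 U = (\<forall>x\<in>U. \<forall>\<^sub>F (x', y) in uniformity. x' = x \<longrightarrow> y \<in> U)"

instance
proof
  fix u v w :: "'a h1" and c :: real
  show "dist u v = norm (u - v)" by (fact dist_h1_def)
  show "sgn u = u /\<^sub>R norm u" by (fact sgn_h1_def)
  show "uniformity = (INF e\<in>{0<..}. principal {(x, y). dist (x::'a h1) y < e})"
    by (fact uniformity_h1_def)
  show "open U = (\<forall>x\<in>U. \<forall>\<^sub>F (x', y) in uniformity. x' = x \<longrightarrow> y \<in> U)" for U :: "'a h1 set"
    by (fact open_h1_def)
  show "norm u = sqrt (u \<bullet> u)" by (fact norm_h1_def)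
  show "u \<bullet> v = v \<bullet> u" by transfer (simp add: inner_commute)
  show "(u + v) \<bullet> w = u \<bullet> w + v \<bullet> w"
  proof transfer
    fix u v w :: "real^'a \<Rightarrow> complex"
    assume "sobolev_fun u \<and> sobolev_fun u \<and> (AE x in lborel. u x = u x)"
      "sobolev_fun v \<and> sobolev_fun v \<and> (AE x in lborel. v x = v x)"
      "sobolev_fun w \<and> sobolev_fun w \<and> (AE x in lborel. w x = w x)"
    then have S: "sobolev_fun u" "sobolev_fun v" "sobolev_fun w" by blast+
    note L = S[THEN sobolev_fun_square_integrable] S[THEN weak_gradient(1)]
    have 1: "(LINT x|lborel. (u x + v x) \<bullet> w x) = (LINT x|lborel. u x \<bullet> w x) + (LINT x|lborel. v x \<bullet> w x)"
      unfolding inner_add_left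
      by (rule Bochner_Integration.integral_add[OF square_integrable_inner[OF L(1,3)] square_integrable_inner[OF L(2,3)]])
    have "(LINT x|lborel. weak_gradient (\<lambda>x. u x + v x) x \<bullet> weak_gradient w x) =
      (LINT x|lborel. weak_gradient u x \<bullet> weak_gradient w x + weak_gradient v x \<bullet> weak_gradient w x)"
    proof (rule integral_cong_AE)
      show "AE x in lborel. weak_gradient (\<lambda>x. u x + v x) x \<bullet> weak_gradient w x =
          weak_gradient u x \<bullet> weak_gradient w x + weak_gradient v x \<bullet> weak_gradient w x"
        using weak_gradient_add_AE[OF S(1,2)] by eventually_elim (simp add: inner_add_left)
    qed (use square_integrable_inner[OF L(4,6)] square_integrable_inner[OF L(5,6)]
         square_integrable_inner[OF weak_gradient(1)[OF sobolev_fun_add[OF S(1,2)]] L(6)] in auto)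
    also have "\<dots> = (LINT x|lborel. weak_gradient u x \<bullet> weak_gradient w x) +
        (LINT x|lborel. weak_gradient v x \<bullet> weak_gradient w x)"
      by (rule Bochner_Integration.integral_add[OF square_integrable_inner[OF L(4,6)] square_integrable_inner[OF L(5,6)]])
    finally show "(LINT x|lborel. (u x + v x) \<bullet> w x) +
        (LINT x|lborel. weak_gradient (\<lambda>x. u x + v x) x \<bullet> weak_gradient w x) =
      (LINT x|lborel. u x \<bullet> w x) + (LINT x|lborel. weak_gradient u x \<bullet> weak_gradient w x) +
      ((LINT x|lborel. v x \<bullet> w x) + (LINT x|lborel. weak_gradient v x \<bullet> weak_gradient w x))"
      using 1 by simp
  qed
  show scale: "c *\<^sub>R u \<bullet> v = c * (u \<bullet> v)" for c and u v :: "'a h1"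
  proof transfer
    fix c :: real and u v :: "real^'a \<Rightarrow> complex"
    assume "sobolev_fun u \<and> sobolev_fun u \<and> (AE x in lborel. u x = u x)"
      "sobolev_fun v \<and> sobolev_fun v \<and> (AE x in lborel. v x = v x)"
    then have S: "sobolev_fun u" "sobolev_fun v" by blast+
    note L = S[THEN weak_gradient(1)]
    have "(LINT x|lborel. weak_gradient (\<lambda>x. c *\<^sub>R u x) x \<bullet> weak_gradient v x) =
      (LINT x|lborel. c * (weak_gradient u x \<bullet> weak_gradient v x))"
    proof (rule integral_cong_AE)
      show "AE x in lborel. weak_gradient (\<lambda>x. c *\<^sub>R u x) x \<bullet> weak_gradient v x =
          c * (weak_gradient u x \<bullet> weak_gradient v x)"
        using weak_gradient_scaleR_AE[OF S(1), of c] by eventually_elim simp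
    qed (use square_integrable_inner[OF L]
         square_integrable_inner[OF weak_gradient(1)[OF sobolev_fun_scaleR[OF S(1), of c]] L(2)] in auto)
    then show "(LINT x|lborel. c *\<^sub>R u x \<bullet> v x) +
        (LINT x|lborel. weak_gradient (\<lambda>x. c *\<^sub>R u x) x \<bullet> weak_gradient v x) =
      c * ((LINT x|lborel. u x \<bullet> v x) + (LINT x|lborel. weak_gradient u x \<bullet> weak_gradient v x))"
      by (simp add: distrib_left)
  qed
  show "0 \<le> u \<bullet> u"
    by transfer (intro add_nonneg_nonneg Bochner_Integration.integral_nonneg inner_ge_zero)
  have "u = 0" if "u \<bullet> u = 0"
    using that
  proof transfer
    fix u :: "real^'a \<Rightarrow> complex"
    assume "sobolev_fun u \<and> sobolev_fun u \<and> (AE x in lborel. u x = u x)"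
    then have S: "sobolev_fun u" by blast
    assume "(LINT x|lborel. u x \<bullet> u x) + (LINT x|lborel. weak_gradient u x \<bullet> weak_gradient u x) = 0"
    moreover have "0 \<le> (LINT x|lborel. u x \<bullet> u x)" "0 \<le> (LINT x|lborel. weak_gradient u x \<bullet> weak_gradient u x)"
      by (intro Bochner_Integration.integral_nonneg inner_ge_zero)+
    ultimately have "(LINT x|lborel. u x \<bullet> u x) = 0" by linarith
    moreover have "integrable lborel (\<lambda>x. u x \<bullet> u x)"
      by (intro square_integrable_inner sobolev_fun_square_integrable S)
    ultimately have "AE x in lborel. u x = 0"
      by (subst (asm) integral_nonneg_eq_0_iff_AE) auto
    with S sobolev_fun_zero show "sobolev_fun u \<and> sobolev_fun (\<lambda>_::real^'a. 0) \<and> (AE x in lborel. u x = 0)"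
      by blast
  qed
  moreover have "(0::'a h1) \<bullet> 0 = 0"
    using scale[of 0 0 0] by simp
  ultimately show "u \<bullet> u = 0 \<longleftrightarrow> u = 0" by blast
qed

end

definition h1_grad :: "'n::finite h1 \<Rightarrow> real^'n \<Rightarrow> complex^'n" where
  "h1_grad u = weak_gradient (rep_h1 u)"

(* The L^r norm of a function in L^r. Outside L^r the integral would be 0 by convention; this does
   not interfere below, where r is 2 or lies strictly between 2 and the Sobolev exponent, so that
   H^1 is contained in L^r. *)
definition Lnorm :: "real \<Rightarrow> (real^'n::finite \<Rightarrow> 'b::real_normed_vector) \<Rightarrow> real" where
  "Lnorm r f = (LINT x|lborel. norm (f x) powr r) powr (1 / r)"

definition gam :: "nat \<Rightarrow> real \<Rightarrow> real" where
  "gam N r = real N * (r - 2) / (2 * r)"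

definition sobolev_exponent :: "nat \<Rightarrow> ereal" where
  "sobolev_exponent N = (if N \<ge> 3 then ereal (2 * real N / (real N - 2)) else \<infinity>)"

definition mass_critical_exponent :: "nat \<Rightarrow> real" where
  "mass_critical_exponent N = 2 + 4 / real N"

(* Best (smallest) constant in the Gagliardo-Nirenberg inequality on H^1(R^n, C). *)
definition gn_const :: "'n::finite itself \<Rightarrow> real \<Rightarrow> real" where
  "gn_const _ r = Inf {C. \<forall>u :: 'n h1. Lnorm r (rep_h1 u) \<le>
     C * Lnorm 2 (h1_grad u) powr gam CARD('n) r * Lnorm 2 (rep_h1 u) powr (1 - gam CARD('n) r)}"

definition mass_sphere :: "real \<Rightarrow> 'n::finite h1 set" where
  "mass_sphere a = {u. (LINT x|lborel. (norm (rep_h1 u x))\<^sup>2) = a\<^sup>2}"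

definition energy :: "real \<Rightarrow> real \<Rightarrow> real \<Rightarrow> 'n::finite h1 \<Rightarrow> real" where
  "energy p q \<mu> u = (LINT x|lborel. 1 / 2 * (norm (h1_grad u x))\<^sup>2
     - 1 / p * norm (rep_h1 u x) powr p - \<mu> / q * norm (rep_h1 u x) powr q)"

definition pohozaev_functional :: "real \<Rightarrow> real \<Rightarrow> real \<Rightarrow> 'n::finite h1 \<Rightarrow> real" where
  "pohozaev_functional p q \<mu> u = (Lnorm 2 (h1_grad u))\<^sup>2
     - gam CARD('n) p * Lnorm p (rep_h1 u) powr p
     - \<mu> * gam CARD('n) q * Lnorm q (rep_h1 u) powr q"

definition pohozaev_set :: "real \<Rightarrow> real \<Rightarrow> real \<Rightarrow> real \<Rightarrow> 'n::finite h1 set" where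
  "pohozaev_set p q a \<mu> = {u \<in> mass_sphere a. pohozaev_functional p q \<mu> u = 0}"

definition C1_functional :: "('a::real_normed_vector \<Rightarrow> real) \<Rightarrow> bool" where
  "C1_functional f \<longleftrightarrow> (\<exists>f' :: 'a \<Rightarrow> 'a \<Rightarrow>\<^sub>L real.
     (\<forall>u. (f has_derivative blinfun_apply (f' u)) (at u)) \<and> continuous_on UNIV f')"

(* M is the common zero set of the C^1 functionals P and G, S that of G alone, and the joint
   differential of P and G is onto R^2 at each point of M. *)
definition smooth_codim1_in ::
  "('a::real_normed_vector \<Rightarrow> real) \<Rightarrow> ('a \<Rightarrow> real) \<Rightarrow> 'a set \<Rightarrow> 'a set \<Rightarrow> bool" where
  "smooth_codim1_in P G M S \<longleftrightarrow>
     S = {u. G u = 0} \<and> M = {u. P u = 0 \<and> G u = 0} \<and>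
     C1_functional P \<and> C1_functional G \<and>
     (\<forall>u\<in>M. surj (\<lambda>h. (frechet_derivative P (at u) h, frechet_derivative G (at u) h)))"

(* Velocities at u of C^1 curves in M through u. *)
definition tangent_vectors :: "'a::real_normed_vector set \<Rightarrow> 'a \<Rightarrow> 'a set" where
  "tangent_vectors M u = {v. \<exists>\<epsilon>>0. \<exists>c c'. c 0 = u \<and> c' 0 = v \<and>
     (\<forall>t\<in>{-\<epsilon><..<\<epsilon>}. c t \<in> M \<and> (c has_vector_derivative c' t) (at t)) \<and>
     continuous_on {-\<epsilon><..<\<epsilon>} c'}"

(* The differential of the restriction of E to M vanishes at u. *)
definition critical_point_on :: "('a::real_normed_vector \<Rightarrow> real) \<Rightarrow> 'a set \<Rightarrow> 'a \<Rightarrow> bool" where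
  "critical_point_on E M u \<longleftrightarrow> u \<in> M \<and>
     (\<exists>E'. (E has_derivative E') (at u) \<and> (\<forall>v\<in>tangent_vectors M u. E' v = 0))"

end

theory Submission
  imports Defs
begin

text \<open>
  Write \<open>T\<close>, \<open>A\<close>, \<open>B\<close> for the squared \<open>L\<^sup>2\<close> norm of the gradient of \<open>u\<close> and for the \<open>p\<close>-th and
  \<open>q\<close>-th powers of its \<open>L\<^sup>p\<close> and \<open>L\<^sup>q\<close> norms. If the differentials of the Pohozaev functional and
  of the mass are linearly dependent at \<open>u\<close>, then \<open>u\<close> is a weak solution of an elliptic equation,
  whose Pohozaev identity reads \<open>2 T = p \<gamma>\<^sub>p\<^sup>2 A + \<mu> q \<gamma>\<^sub>q\<^sup>2 B\<close>. Together with
  \<open>T = \<gamma>\<^sub>p A + \<mu> \<gamma>\<^sub>q B\<close> this forces \<open>A = 0\<close> unless \<open>\<mu> > 0\<close> and \<open>q\<close> is mass subcritical, and there it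
  contradicts the Gagliardo-Nirenberg inequality and the smallness of \<open>\<mu>\<close>. A critical point of the
  energy on the Pohozaev set solves the equation with a multiplier \<open>\<nu>\<close> for the Pohozaev functional,
  and the Pohozaev identity of that equation is \<open>\<nu>\<close> times the excluded relation, so \<open>\<nu> = 0\<close>.

  The Pohozaev identity needs neither decay nor bootstrapping. Testing the difference of the
  equation and its translate by \<open>k\<close> with \<open>u(\<cdot> + k) - u\<close>, the strictly subcritical
  Gagliardo-Nirenberg inequality absorbs the nonlinear terms and shows that this difference is
  \<open>O(|k|)\<close> in the Sobolev space. Hence the equation may be tested with \<open>R sin(x\<^sub>i / R)\<close> times the
  difference quotient of \<open>u\<close> in direction \<open>i\<close>, all remainders being quadratic in the step, and
  \<open>R \<rightarrow> \<infinity>\<close> gives the identity.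
\<close>

section \<open>Translations and smooth multipliers in the Sobolev space\<close>

text \<open>Differences of translates always are admissible, so everything rests on remainders that
  are quadratic in the step; for the r-th power these come from convexity at both end points. The
  multiplier of the Pohozaev functional may be 1/2, and then the gradient term drops out of the
  equation. Monotonicity of the leading power replaces ellipticity in that case, which is why the
  equation carries a coefficient \<open>c\<close> that may vanish. The Gagliardo-Nirenberg
  inequality is obtained for all dimensions at once. Its analytic input is that a translation by h
  changes u by at most |h| |grad u|_2 in L^2; this controls averages over dyadic cubes. Criticality
  speaks of velocities of curves, so Lagrange multipliers require that every vector in the kernel of
  the joint differential be such a velocity. The curve is found in the three-dimensional slice
  through u spanned by that vector and a dual pair for the two differentials, where the inverse
  function theorem applies.\<close>

abbreviation L2_square :: "(real^'n::finite \<Rightarrow> 'b::real_normed_vector) \<Rightarrow> real" where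
  "L2_square f \<equiv> LINT x|lborel. (norm (f x))\<^sup>2"

lemma nn_integral_lborel_shift:
  fixes f :: "'a::euclidean_space \<Rightarrow> ennreal"
  assumes [measurable]: "f \<in> borel_measurable borel"
  shows "(\<integral>\<^sup>+x. f (x + h) \<partial>lborel) = (\<integral>\<^sup>+x. f x \<partial>lborel)"
proof -
  have "(\<integral>\<^sup>+x. f x \<partial>lborel) = (\<integral>\<^sup>+x. f x \<partial>distr lborel borel ((+) h))"
    by (simp add: lborel_distr_plus)
  also have "\<dots> = (\<integral>\<^sup>+x. f (h + x) \<partial>lborel)"
    by (rule nn_integral_distr) auto
  finally show ?thesis by (simp add: add.commute)
qed

lemma integral_lborel_shift:
  fixes f :: "'a::euclidean_space \<Rightarrow> 'b::{banach,second_countable_topology}"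
  assumes [measurable]: "f \<in> borel_measurable borel"
  shows "(LINT x|lborel. f (x + h)) = (LINT x|lborel. f x)"
proof -
  have "(LINT x|lborel. f x) = (LINT x|distr lborel borel ((+) h). f x)"
    by (simp add: lborel_distr_plus)
  also have "\<dots> = (LINT x|lborel. f (h + x))"
    by (rule integral_distr) auto
  finally show ?thesis by (simp add: add.commute)
qed

lemma integrable_lborel_shift:
  fixes f :: "'a::euclidean_space \<Rightarrow> 'b::{banach,second_countable_topology}"
  assumes "integrable lborel f"
  shows "integrable lborel (\<lambda>x. f (x + h))"
proof -
  have "integrable (distr lborel borel ((+) h)) f" using assms by (simp add: lborel_distr_plus)
  then have "integrable lborel (\<lambda>x. f (h + x))"
    by (subst (asm) integrable_distr_eq) (use assms in auto)
  then show ?thesis by (simp add: add.commute)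
qed

lemma square_integrable_measurable: "square_integrable f \<Longrightarrow> f \<in> borel_measurable borel"
  by (simp add: square_integrable_def)

lemma square_integrable_shift:
  assumes "square_integrable f"
  shows "square_integrable (\<lambda>x. f (x + h))"
  using assms integrable_lborel_shift[of "\<lambda>x. (norm (f x))\<^sup>2" h]
  by (auto simp: square_integrable_def intro: measurable_compose[of "\<lambda>x. x + h" borel])

lemma square_integrable_bounded_mult:
  fixes f :: "real^'n::finite \<Rightarrow> 'b::euclidean_space"
  assumes f: "square_integrable f" and [measurable]: "\<eta> \<in> borel_measurable borel"
    and b: "\<And>x. \<bar>\<eta> x\<bar> \<le> K"
  shows "square_integrable (\<lambda>x. \<eta> x *\<^sub>R f x)"
proof -
  have [measurable]: "f \<in> borel_measurable borel" using f by (simp add: square_integrable_def)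
  have "integrable lborel (\<lambda>x. (norm (\<eta> x *\<^sub>R f x))\<^sup>2)"
  proof (rule Bochner_Integration.integrable_bound)
    show "integrable lborel (\<lambda>x. K\<^sup>2 * (norm (f x))\<^sup>2)"
      using f by (auto simp: square_integrable_def)
    have "(\<bar>\<eta> x\<bar> * norm (f x))\<^sup>2 \<le> K\<^sup>2 * (norm (f x))\<^sup>2" for x
      using b[of x] by (simp add: power_mult_distrib mult_right_mono power2_le_iff_abs_le[THEN iffD2] abs_le_square_iff)
    then show "AE x in lborel. norm ((norm (\<eta> x *\<^sub>R f x))\<^sup>2) \<le> norm (K\<^sup>2 * (norm (f x))\<^sup>2)"
      by (intro AE_I2) simp
  qed measurable
  then show ?thesis by (simp add: square_integrable_def)
qed

lemma has_derivative_shift: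
  fixes f :: "'a::real_normed_vector \<Rightarrow> 'b::real_normed_vector"
  assumes "(f has_derivative f') (at (x + h))"
  shows "((\<lambda>x. f (x + h)) has_derivative f') (at x)"
proof -
  have "((\<lambda>x. x + h) has_derivative (\<lambda>x. x)) (at x)"
    by (auto intro!: derivative_eq_intros)
  from has_derivative_compose[OF this assms] show ?thesis .
qed

lemma Ck_shift:
  assumes "Ck k f"
  shows "Ck k (\<lambda>x. f (x + h))"
  using assms
proof (induction k arbitrary: f)
  case 0
  then show ?case by (auto intro!: continuous_on_compose2[of UNIV f] continuous_intros)
next
  case (Suc k)
  show ?case
    by (rule Ck_SucI[OF has_derivative_shift[OF Ck_Suc_derivative[OF Suc.prems]]])
       (use Suc.prems in \<open>auto intro!: Suc.IH[of "\<lambda>x. frechet_derivative f (at x) (axis _ 1)"]\<close>)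
qed

lemma frechet_derivative_shift:
  assumes "Ck (Suc k) f"
  shows "frechet_derivative (\<lambda>x. f (x + h)) (at x) = frechet_derivative f (at (x + h))"
  by (rule frechet_derivative_at[symmetric])
     (rule has_derivative_shift[OF Ck_Suc_derivative[OF assms]])

lemma test_function_Ck: "test_function \<phi> \<Longrightarrow> Ck k \<phi>"
  unfolding test_function_def by blast

lemma test_function_shift:
  assumes "test_function \<phi>"
  shows "test_function (\<lambda>x. \<phi> (x + h))"
proof -
  have "{x. \<phi> (x + h) \<noteq> 0} = (+) (- h) ` {x. \<phi> x \<noteq> 0}"
  proof (intro set_eqI iffI)
    fix x assume "x \<in> {x. \<phi> (x + h) \<noteq> 0}"
    then show "x \<in> (+) (- h) ` {x. \<phi> x \<noteq> 0}" by (intro image_eqI[of _ _ "x + h"]) auto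
  qed auto
  then have "closure {x. \<phi> (x + h) \<noteq> 0} = (+) (- h) ` closure {x. \<phi> x \<noteq> 0}"
    by (simp only: closure_translation)
  then show ?thesis
    using assms Ck_shift[of _ \<phi> h] compact_translation[of "closure {x. \<phi> x \<noteq> 0}" "- h"]
    unfolding test_function_def by simp
qed

text \<open>The translation by \<open>h\<close> is moved onto the test function as a translation by
  \<open>- h\<close>, which commutes with differentiation; undoing the substitution afterwards gives
  the claim.\<close>

lemma is_weak_gradient_shift:
  assumes w: "is_weak_gradient u G" and u: "square_integrable u" "square_integrable G"
  shows "is_weak_gradient (\<lambda>x. u (x + h)) (\<lambda>x. G (x + h))"
  unfolding is_weak_gradient_def
proof (intro allI impI)
  fix \<phi> :: "real^'a \<Rightarrow> real" and i assume t: "test_function \<phi>"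
  let ?\<psi> = "\<lambda>x. \<phi> (x + - h)"
  have t': "test_function ?\<psi>" by (rule test_function_shift[OF t])
  have d: "frechet_derivative ?\<psi> (at x) = frechet_derivative \<phi> (at (x + - h))" for x
    by (rule frechet_derivative_shift[OF test_function_Ck[OF t, of "Suc 0"]])
  have [measurable]: "u \<in> borel_measurable borel" "(\<lambda>x. G x $ i) \<in> borel_measurable borel"
    "\<phi> \<in> borel_measurable borel" "(\<lambda>x. frechet_derivative \<phi> (at x) (axis i 1)) \<in> borel_measurable borel"
    using u(1) square_integrable_nth[OF u(2), of i] test_function_measurable[OF t]
      test_function_measurable[OF test_function_partial[OF t, of i]]
    by (auto intro: square_integrable_measurable)
  have "(LINT x|lborel. frechet_derivative \<phi> (at x) (axis i 1) *\<^sub>R u (x + h)) =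
      (LINT x|lborel. frechet_derivative \<phi> (at (x + - h)) (axis i 1) *\<^sub>R u (x + - h + h))"
    by (rule integral_lborel_shift[symmetric]) measurable
  also have "\<dots> = (LINT x|lborel. frechet_derivative ?\<psi> (at x) (axis i 1) *\<^sub>R u x)"
    by (simp only: d add.assoc left_minus add_0_right)
  also have "\<dots> = - (LINT x|lborel. ?\<psi> x *\<^sub>R (G x $ i))"
    by (rule w[unfolded is_weak_gradient_def, rule_format, OF t'])
  also have "(LINT x|lborel. ?\<psi> x *\<^sub>R (G x $ i)) = (LINT x|lborel. \<phi> (x + - h) *\<^sub>R (G (x + - h + h) $ i))"
    by simp
  also have "\<dots> = (LINT x|lborel. \<phi> x *\<^sub>R (G (x + h) $ i))"
    by (rule integral_lborel_shift) measurable
  finally show "(LINT x|lborel. frechet_derivative \<phi> (at x) (axis i 1) *\<^sub>R u (x + h)) =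
     - (LINT x|lborel. \<phi> x *\<^sub>R (G (x + h) $ i))" .
qed

lemma sobolev_fun_shift:
  assumes "sobolev_fun u"
  shows "sobolev_fun (\<lambda>x. u (x + h))"
  by (rule sobolev_funI[OF square_integrable_shift[OF sobolev_fun_square_integrable[OF assms]]
        square_integrable_shift[OF weak_gradient(1)[OF assms]]
        is_weak_gradient_shift[OF weak_gradient(2)[OF assms] sobolev_fun_square_integrable[OF assms]
          weak_gradient(1)[OF assms]]])

lemma weak_gradient_shift_AE:
  assumes "sobolev_fun u"
  shows "AE x in lborel. weak_gradient (\<lambda>x. u (x + h)) x = weak_gradient u (x + h)"
  by (rule weak_gradient_AE_eq[OF sobolev_fun_shift[OF assms]
        square_integrable_shift[OF sobolev_fun_square_integrable[OF assms]] _
        square_integrable_shift[OF weak_gradient(1)[OF assms]]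
        is_weak_gradient_shift[OF weak_gradient(2)[OF assms] sobolev_fun_square_integrable[OF assms]
          weak_gradient(1)[OF assms]]]) simp

section \<open>Multiplication by smooth functions with bounded first derivatives\<close>

lemma Ck_derivative_measurable:
  assumes "Ck (Suc 0) \<eta>"
  shows "\<eta> \<in> borel_measurable borel" "(\<lambda>x. frechet_derivative \<eta> (at x) (axis i 1)) \<in> borel_measurable borel"
  using assms Ck_mono[OF assms] by (auto intro!: borel_measurable_continuous_onI)

lemma square_integrable_vec_lambda:
  fixes f :: "'m::finite \<Rightarrow> real^'n::finite \<Rightarrow> complex"
  assumes "\<And>i. square_integrable (f i)"
  shows "square_integrable (\<lambda>x. \<chi> i. f i x)"
proof -
  have [measurable]: "\<And>i. f i \<in> borel_measurable borel"
    using assms by (auto intro: square_integrable_measurable)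
  have [measurable]: "(\<lambda>x. \<chi> i. f i x) \<in> borel_measurable borel"
  proof (rule borel_measurable_euclidean_space[THEN iffD2], intro ballI)
    fix b :: "complex^'m" assume "b \<in> Basis"
    then obtain i c where b: "b = axis i c" by (auto simp: Basis_vec_def)
    show "(\<lambda>x. (\<chi> i. f i x) \<bullet> b) \<in> borel_measurable borel"
      unfolding b inner_axis by simp
  qed
  have "(norm (\<chi> i. f i x))\<^sup>2 = (\<Sum>i\<in>UNIV. (norm (f i x))\<^sup>2)" for x
    by (simp add: norm_vec_def L2_set_def sum_nonneg)
  then show ?thesis using assms by (auto simp: square_integrable_def)
qed

text \<open>The factor \<open>\<eta>\<close> can be absorbed into the test function, since
  \<open>\<phi> * \<eta>\<close> vanishes wherever \<open>\<phi>\<close> does. The product rule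
  leaves the term with the derivative of \<open>\<eta>\<close>, and the bound \<open>K\<close> keeps
  all products square integrable.\<close>

lemma is_weak_gradient_mult:
  fixes u :: "real^'n::finite \<Rightarrow> complex"
  assumes w: "is_weak_gradient u G" and u: "square_integrable u" "square_integrable G"
    and \<eta>: "\<And>k. Ck k \<eta>" and K: "\<And>x. \<bar>\<eta> x\<bar> \<le> K" "\<And>x i. \<bar>frechet_derivative \<eta> (at x) (axis i 1)\<bar> \<le> K"
  shows "is_weak_gradient (\<lambda>x. \<eta> x *\<^sub>R u x)
     (\<lambda>x. \<eta> x *\<^sub>R G x + (\<chi> i. frechet_derivative \<eta> (at x) (axis i 1) *\<^sub>R u x))"
  unfolding is_weak_gradient_def
proof (intro allI impI)
  fix \<phi> :: "real^'n \<Rightarrow> real" and i :: 'n assume t: "test_function \<phi>"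
  note m = Ck_derivative_measurable[OF \<eta>]
  let ?d = "\<lambda>f x. frechet_derivative f (at x) (axis i 1)"
  let ?\<psi> = "\<lambda>x. \<phi> x * \<eta> x"
  have t': "test_function ?\<psi>"
  proof -
    have "bounded (closure {x. \<phi> x \<noteq> 0})"
      using t unfolding test_function_def by (blast intro: compact_imp_bounded)
    then have "bounded {x. ?\<psi> x \<noteq> 0}"
      by (rule bounded_subset) (use closure_subset[of "{x. \<phi> x \<noteq> 0}"] in auto)
    then show ?thesis
      using Ck_mult[OF test_function_Ck[OF t] \<eta>] unfolding test_function_def compact_closure by blast
  qed
  have d: "?d ?\<psi> x = ?d \<phi> x * \<eta> x + \<phi> x * ?d \<eta> x" for x
    using frechet_derivative_at[OF has_derivative_mult[OF Ck_Suc_derivative[OF test_function_Ck[OF t, of "Suc 0"], of x]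
          Ck_Suc_derivative[OF \<eta>[of "Suc 0"], of x]], symmetric]
    by simp
  have s1: "square_integrable (\<lambda>x. \<eta> x *\<^sub>R u x)"
    by (rule square_integrable_bounded_mult[OF u(1) m(1) K(1)])
  have s2: "square_integrable (\<lambda>x. ?d \<eta> x *\<^sub>R u x)"
    by (rule square_integrable_bounded_mult[OF u(1) m(2) K(2)])
  have s3: "square_integrable (\<lambda>x. \<eta> x *\<^sub>R (G x $ i))"
    by (rule square_integrable_bounded_mult[OF square_integrable_nth[OF u(2)] m(1) K(1)])
  note t1 = test_function_scaleR_integrable[OF test_function_partial[OF t, of i] s1]
  note t2 = test_function_scaleR_integrable[OF t s2]
  note t3 = test_function_scaleR_integrable[OF t s3]
  have "(LINT x|lborel. ?d ?\<psi> x *\<^sub>R u x) = - (LINT x|lborel. ?\<psi> x *\<^sub>R (G x $ i))"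
    by (rule w[unfolded is_weak_gradient_def, rule_format, OF t'])
  moreover have "(LINT x|lborel. ?d ?\<psi> x *\<^sub>R u x) =
      (LINT x|lborel. ?d \<phi> x *\<^sub>R \<eta> x *\<^sub>R u x) + (LINT x|lborel. \<phi> x *\<^sub>R ?d \<eta> x *\<^sub>R u x)"
    by (subst Bochner_Integration.integral_add[symmetric, OF t1 t2]) (simp add: d scaleR_add_left)
  moreover have "(LINT x|lborel. \<phi> x *\<^sub>R (\<eta> x *\<^sub>R G x + (\<chi> i. frechet_derivative \<eta> (at x) (axis i 1) *\<^sub>R u x)) $ i) =
     (LINT x|lborel. ?\<psi> x *\<^sub>R (G x $ i)) + (LINT x|lborel. \<phi> x *\<^sub>R ?d \<eta> x *\<^sub>R u x)"
    using Bochner_Integration.integral_add[OF t3 t2] by (simp add: scaleR_add_right)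
  ultimately show "(LINT x|lborel. ?d \<phi> x *\<^sub>R \<eta> x *\<^sub>R u x) =
     - (LINT x|lborel. \<phi> x *\<^sub>R (\<eta> x *\<^sub>R G x + (\<chi> i. frechet_derivative \<eta> (at x) (axis i 1) *\<^sub>R u x)) $ i)"
    by (simp add: algebra_simps)
qed

lemma weak_gradient_mult:
  fixes u :: "real^'n::finite \<Rightarrow> complex"
  assumes u: "sobolev_fun u"
    and \<eta>: "\<And>k. Ck k \<eta>" and K: "\<And>x. \<bar>\<eta> x\<bar> \<le> K" "\<And>x i. \<bar>frechet_derivative \<eta> (at x) (axis i 1)\<bar> \<le> K"
  shows "sobolev_fun (\<lambda>x. \<eta> x *\<^sub>R u x)" (is ?A)
    and "AE x in lborel. weak_gradient (\<lambda>x. \<eta> x *\<^sub>R u x) x =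
      \<eta> x *\<^sub>R weak_gradient u x + (\<chi> i. frechet_derivative \<eta> (at x) (axis i 1) *\<^sub>R u x)" (is ?B)
proof -
  note m = Ck_derivative_measurable[OF \<eta>]
  note L = sobolev_fun_square_integrable[OF u] weak_gradient[OF u]
  have s1: "square_integrable (\<lambda>x. \<eta> x *\<^sub>R u x)"
    by (rule square_integrable_bounded_mult[OF L(1) m(1) K(1)])
  have s2: "square_integrable (\<lambda>x. \<eta> x *\<^sub>R weak_gradient u x + (\<chi> i. frechet_derivative \<eta> (at x) (axis i 1) *\<^sub>R u x))"
    by (intro square_integrable_add square_integrable_vec_lambda
        square_integrable_bounded_mult[OF L(1) m(2) K(2)] square_integrable_bounded_mult[OF L(2) m(1) K(1)])
  note w = is_weak_gradient_mult[OF L(3,1,2) \<eta> K]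
  show ?A by (rule sobolev_funI[OF s1 s2 w])
  then show ?B by (rule weak_gradient_AE_eq[OF _ s1 _ s2 w]) simp
qed

section \<open>Difference quotients\<close>

lemma le_one_plus_square: "x \<le> 1 + x\<^sup>2" for x :: real
proof -
  have "0 \<le> (x - 1 / 2)\<^sup>2" by simp
  then show ?thesis by (simp add: power2_eq_square algebra_simps)
qed

text \<open>Jensen's inequality for the square, from the nonnegative variance of
  \<open>norm (f s)\<close>. With a nonnegative integral on the right it holds for every measurable
  \<open>f\<close>: if \<open>f\<close> is not integrable, the left side is 0 by the default value
  of the integral, and if only the square fails to be integrable, the right side is
  infinite.\<close>

lemma norm_integral_square_le:
  fixes f :: "'a \<Rightarrow> 'b::{banach,second_countable_topology}"
  assumes M: "emeasure M (space M) = 1" and [measurable]: "f \<in> borel_measurable M"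
  shows "ennreal ((norm (integral\<^sup>L M f))\<^sup>2) \<le> (\<integral>\<^sup>+s. ennreal ((norm (f s))\<^sup>2) \<partial>M)"
proof (cases "integrable M f \<and> integrable M (\<lambda>s. (norm (f s))\<^sup>2)")
  case True
  interpret finite_measure M by standard (simp add: M)
  have one: "measure M (space M) = 1" using M by (simp add: measure_def)
  define m where "m = (LINT s|M. norm (f s))"
  have "0 \<le> (LINT s|M. (norm (f s) - m)\<^sup>2)" by (rule Bochner_Integration.integral_nonneg) simp
  also have "(LINT s|M. (norm (f s) - m)\<^sup>2) = (LINT s|M. (norm (f s))\<^sup>2 + m\<^sup>2 - 2 * m * norm (f s))"
    by (rule Bochner_Integration.integral_cong) (auto simp: power2_eq_square algebra_simps)
  also have "\<dots> = (LINT s|M. (norm (f s))\<^sup>2) - m\<^sup>2"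
    using True by (subst Bochner_Integration.integral_diff)
      (auto simp: one m_def[symmetric] power2_eq_square)
  finally have "m\<^sup>2 \<le> (LINT s|M. (norm (f s))\<^sup>2)" by simp
  moreover have "norm (integral\<^sup>L M f) \<le> m"
    unfolding m_def by (rule integral_norm_bound)
  then have "(norm (integral\<^sup>L M f))\<^sup>2 \<le> m\<^sup>2" by (intro power_mono) auto
  ultimately have "(norm (integral\<^sup>L M f))\<^sup>2 \<le> (LINT s|M. (norm (f s))\<^sup>2)" by linarith
  then show ?thesis
    using True by (subst nn_integral_eq_integral) (auto intro: ennreal_leI)
next
  case False
  interpret finite_measure M by standard (simp add: M)
  show ?thesis
  proof (cases "integrable M f")
    case True
    with False have "\<not> integrable M (\<lambda>s. (norm (f s))\<^sup>2)" by blast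
    then have "(\<integral>\<^sup>+s. ennreal (norm ((norm (f s))\<^sup>2)) \<partial>M) = \<infinity>"
      by (subst (asm) integrable_iff_bounded) (auto simp: less_top[symmetric])
    then show ?thesis by simp
  next
    case False
    then show ?thesis by (simp add: not_integrable_integral_eq)
  qed
qed

text \<open>Jensen's inequality at each point, then Tonelli: this is Minkowski's integral inequality
  for a probability measure.\<close>

lemma L2_average_le:
  fixes K :: "'a \<Rightarrow> real^'n::finite \<Rightarrow> 'b::{banach,second_countable_topology}"
  assumes M: "emeasure M (space M) = 1"
    and [measurable]: "(\<lambda>(s, x). K s x) \<in> borel_measurable (M \<Otimes>\<^sub>M lborel)"
    and le: "\<And>s. s \<in> space M \<Longrightarrow> (\<integral>\<^sup>+x. ennreal ((norm (K s x))\<^sup>2) \<partial>lborel) \<le> C"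
  shows "(\<integral>\<^sup>+x. ennreal ((norm (LINT s|M. K s x))\<^sup>2) \<partial>lborel) \<le> C"
proof -
  interpret finite_measure M by standard (simp add: M)
  interpret pair_sigma_finite M lborel ..
  have "(\<integral>\<^sup>+x. ennreal ((norm (LINT s|M. K s x))\<^sup>2) \<partial>lborel) \<le>
      (\<integral>\<^sup>+x. \<integral>\<^sup>+s. ennreal ((norm (K s x))\<^sup>2) \<partial>M \<partial>lborel)"
    by (intro nn_integral_mono norm_integral_square_le M) measurable
  also have "\<dots> = (\<integral>\<^sup>+s. \<integral>\<^sup>+x. ennreal ((norm (K s x))\<^sup>2) \<partial>lborel \<partial>M)"
    by (rule Fubini') measurable
  also have "\<dots> \<le> (\<integral>\<^sup>+s. C \<partial>M)" by (intro nn_integral_mono le)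
  also have "\<dots> = C" by (simp add: M)
  finally show ?thesis .
qed

text \<open>A probability measure on the whole line concentrated on the unit interval, rather than a
  measure on a subspace, so that measurability arguments need no domain conditions.\<close>

definition unit_interval_measure :: "real measure" where
  "unit_interval_measure = density lborel (indicator {0..1})"

lemma unit_interval_measure_simps [simp, measurable_cong]:
  "sets unit_interval_measure = sets borel"
  by (simp add: unit_interval_measure_def)

lemma space_unit_interval_measure [simp]: "space unit_interval_measure = UNIV"
  by (simp add: unit_interval_measure_def)

lemma emeasure_unit_interval_measure: "emeasure unit_interval_measure (space unit_interval_measure) = 1"
  by (simp add: unit_interval_measure_def emeasure_density)

interpretation unit_interval: finite_measure unit_interval_measure
  by standard (simp add: emeasure_unit_interval_measure del: space_unit_interval_measure)

interpretation unit_interval_pair: pair_sigma_finite unit_interval_measure "lborel :: ('a::euclidean_space) measure" ..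

definition dir_deriv :: "(real^'n::finite \<Rightarrow> complex^'n) \<Rightarrow> real^'n \<Rightarrow> real^'n \<Rightarrow> complex" where
  "dir_deriv G h x = (\<Sum>i\<in>UNIV. h $ i *\<^sub>R (G x $ i))"

lemma norm_dir_deriv_le: "norm (dir_deriv G h x) \<le> norm h * norm (G x)"
proof -
  have "norm (dir_deriv G h x) \<le> (\<Sum>i\<in>UNIV. \<bar>h $ i\<bar> * norm (G x $ i))"
    unfolding dir_deriv_def by (rule order_trans[OF norm_sum]) simp
  also have "\<dots> \<le> norm h * norm (G x)"
    using L2_set_mult_ineq[of "\<lambda>i. \<bar>h $ i\<bar>" "\<lambda>i. norm (G x $ i)" UNIV] by (simp add: norm_vec_def)
  finally show ?thesis .
qed

lemma dir_deriv_diff: "dir_deriv G h x - dir_deriv G h y = dir_deriv (\<lambda>_. G x - G y) h y"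
  by (simp add: dir_deriv_def sum_subtractf scaleR_diff_right)

lemma square_integrable_sum:
  assumes "finite A" "\<And>i. i \<in> A \<Longrightarrow> square_integrable (f i)"
  shows "square_integrable (\<lambda>x. \<Sum>i\<in>A. f i x)"
  using assms
proof (induction A rule: finite_induct)
  case empty
  then show ?case by (simp add: square_integrable_def)
next
  case (insert i A)
  then show ?case using square_integrable_add[of "f i" "\<lambda>x. \<Sum>i\<in>A. f i x"] by simp
qed

lemma square_integrable_dir_deriv: "square_integrable G \<Longrightarrow> square_integrable (dir_deriv G h)"
  unfolding dir_deriv_def[abs_def]
  by (intro square_integrable_sum square_integrable_scaleR square_integrable_nth) auto

lemma nn_integral_square_integrable:
  assumes "square_integrable f"
  shows "(\<integral>\<^sup>+x. ennreal ((norm (f x))\<^sup>2) \<partial>lborel) = ennreal (L2_square f)"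
  using assms by (intro nn_integral_eq_integral) (auto simp: square_integrable_def)

text \<open>This is the Fubini hypothesis for averages along a segment. Two independent shifts
  \<open>h\<close> and \<open>k\<close> are allowed because one exchange of integrals has the
  derivative of the test function moving and the other the gradient of \<open>u\<close>.\<close>

lemma integrable_shift_product:
  fixes f :: "real^'n::finite \<Rightarrow> real" and g :: "real^'n \<Rightarrow> 'b::euclidean_space"
  assumes f: "square_integrable f" and g: "square_integrable g"
  shows "integrable (unit_interval_measure \<Otimes>\<^sub>M lborel) (\<lambda>(s, x). f (x + s *\<^sub>R h) *\<^sub>R g (x + s *\<^sub>R k))"
proof (rule integrableI_bounded)
  have [measurable]: "f \<in> borel_measurable borel" "g \<in> borel_measurable borel"
    using f g by (auto simp: square_integrable_def)
  show "(\<lambda>(s, x). f (x + s *\<^sub>R h) *\<^sub>R g (x + s *\<^sub>R k)) \<in> borel_measurable (unit_interval_measure \<Otimes>\<^sub>M lborel)"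
    by measurable
  have le: "\<bar>a\<bar> * b \<le> a\<^sup>2 + b\<^sup>2" if "b \<ge> 0" for a b :: real
    using sum_squares_bound[of "\<bar>a\<bar>" b] mult_nonneg_nonneg[OF abs_ge_zero that, of a] by simp
  have "(\<integral>\<^sup>+ z. ennreal (norm (case z of (s, x) \<Rightarrow> f (x + s *\<^sub>R h) *\<^sub>R g (x + s *\<^sub>R k))) \<partial>(unit_interval_measure \<Otimes>\<^sub>M lborel)) =
      (\<integral>\<^sup>+ s. \<integral>\<^sup>+ x. ennreal (norm (f (x + s *\<^sub>R h) *\<^sub>R g (x + s *\<^sub>R k))) \<partial>lborel \<partial>unit_interval_measure)"
    by (subst lborel.nn_integral_fst[symmetric]) (auto simp: split_beta')
  also have "\<dots> \<le> (\<integral>\<^sup>+ s. ennreal (L2_square f) + ennreal (L2_square g) \<partial>unit_interval_measure)"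
  proof (rule nn_integral_mono)
    fix s :: real
    have "(\<integral>\<^sup>+ x. ennreal (norm (f (x + s *\<^sub>R h) *\<^sub>R g (x + s *\<^sub>R k))) \<partial>lborel) \<le>
       (\<integral>\<^sup>+ x. ennreal ((norm (f (x + s *\<^sub>R h)))\<^sup>2) + ennreal ((norm (g (x + s *\<^sub>R k)))\<^sup>2) \<partial>lborel)"
      using le by (intro nn_integral_mono) (simp add: ennreal_plus[symmetric] ennreal_leI del: ennreal_plus)
    also have "\<dots> = (\<integral>\<^sup>+ x. ennreal ((norm (f (x + s *\<^sub>R h)))\<^sup>2) \<partial>lborel) + (\<integral>\<^sup>+ x. ennreal ((norm (g (x + s *\<^sub>R k)))\<^sup>2) \<partial>lborel)"
      by (rule nn_integral_add) measurable
    also have "(\<integral>\<^sup>+ x. ennreal ((norm (f (x + s *\<^sub>R h)))\<^sup>2) \<partial>lborel) = (\<integral>\<^sup>+ x. ennreal ((norm (f x))\<^sup>2) \<partial>lborel)"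
      by (rule nn_integral_lborel_shift) measurable
    also have "(\<integral>\<^sup>+ x. ennreal ((norm (g (x + s *\<^sub>R k)))\<^sup>2) \<partial>lborel) = (\<integral>\<^sup>+ x. ennreal ((norm (g x))\<^sup>2) \<partial>lborel)"
      by (rule nn_integral_lborel_shift) measurable
    finally show "(\<integral>\<^sup>+ x. ennreal (norm (f (x + s *\<^sub>R h) *\<^sub>R g (x + s *\<^sub>R k))) \<partial>lborel) \<le>
      ennreal (L2_square f) + ennreal (L2_square g)"
      by (simp only: nn_integral_square_integrable f g)
  qed
  also have "\<dots> < \<infinity>"
    using emeasure_unit_interval_measure by (simp add: ennreal_plus[symmetric] del: ennreal_plus)
  finally show "(\<integral>\<^sup>+ z. ennreal (norm (case z of (s, x) \<Rightarrow> f (x + s *\<^sub>R h) *\<^sub>R g (x + s *\<^sub>R k))) \<partial>(unit_interval_measure \<Otimes>\<^sub>M lborel)) < \<infinity>" .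
qed

lemma test_function_dir:
  fixes \<phi> :: "real^'n::finite \<Rightarrow> real"
  assumes t: "test_function \<phi>"
  shows "frechet_derivative \<phi> (at x) h = (\<Sum>i\<in>UNIV. h $ i * frechet_derivative \<phi> (at x) (axis i 1))"
proof -
  interpret linear "frechet_derivative \<phi> (at x)"
    using Ck_Suc_derivative[OF test_function_Ck[OF t, of "Suc 0"]] by (rule has_derivative_linear)
  have "h = (\<Sum>i\<in>UNIV. h $ i *\<^sub>R axis i 1)"
    using basis_expansion[of h] by (simp add: scalar_mult_eq_scaleR)
  then have "frechet_derivative \<phi> (at x) h = frechet_derivative \<phi> (at x) (\<Sum>i\<in>UNIV. h $ i *\<^sub>R axis i 1)"
    by simp
  then show ?thesis by (simp add: sum scale)
qed

lemma is_weak_gradient_dir: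
  assumes w: "is_weak_gradient u G" and u: "square_integrable u" "square_integrable G" and t: "test_function \<phi>"
  shows "(LINT x|lborel. frechet_derivative \<phi> (at x) h *\<^sub>R u x) = - (LINT x|lborel. \<phi> x *\<^sub>R dir_deriv G h x)"
proof -
  have "(LINT x|lborel. frechet_derivative \<phi> (at x) h *\<^sub>R u x) =
      (LINT x|lborel. (\<Sum>i\<in>UNIV. h $ i *\<^sub>R (frechet_derivative \<phi> (at x) (axis i 1) *\<^sub>R u x)))"
    by (simp add: test_function_dir[OF t, of _ h] scaleR_sum_left)
  also have "\<dots> = (\<Sum>i\<in>UNIV. h $ i *\<^sub>R (LINT x|lborel. frechet_derivative \<phi> (at x) (axis i 1) *\<^sub>R u x))"
    by (subst Bochner_Integration.integral_sum)
       (auto intro!: integrable_scaleR_right test_function_scaleR_integrable test_function_partial t u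
         simp del: scaleR_scaleR)
  also have "\<dots> = (\<Sum>i\<in>UNIV. h $ i *\<^sub>R (- (LINT x|lborel. \<phi> x *\<^sub>R (G x $ i))))"
    by (simp only: w[unfolded is_weak_gradient_def, rule_format, OF t])
  also have "\<dots> = - (LINT x|lborel. (\<Sum>i\<in>UNIV. h $ i *\<^sub>R (\<phi> x *\<^sub>R (G x $ i))))"
    by (subst Bochner_Integration.integral_sum)
       (auto intro!: integrable_scaleR_right test_function_scaleR_integrable square_integrable_nth t u
         simp del: scaleR_scaleR simp: sum_negf)
  also have "\<dots> = - (LINT x|lborel. \<phi> x *\<^sub>R dir_deriv G h x)"
    by (simp add: dir_deriv_def scaleR_sum_right mult.commute)
  finally show ?thesis .
qed

lemma FTC_unit_interval:
  fixes \<phi> :: "real^'n::finite \<Rightarrow> real"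
  assumes t: "test_function \<phi>"
  shows "integrable unit_interval_measure (\<lambda>s. frechet_derivative \<phi> (at (x + s *\<^sub>R h)) h)" (is ?A)
    and "(LINT s|unit_interval_measure. frechet_derivative \<phi> (at (x + s *\<^sub>R h)) h) = \<phi> (x + h) - \<phi> x" (is ?B)
proof -
  note C = test_function_Ck[OF t, of "Suc 0"]
  let ?F = "\<lambda>s. \<phi> (x + s *\<^sub>R h)" and ?f = "\<lambda>s. frechet_derivative \<phi> (at (x + s *\<^sub>R h)) h"
  have "continuous_on UNIV (\<lambda>y. frechet_derivative \<phi> (at y) h)"
    unfolding test_function_dir[OF t, of _ h] using C by (intro continuous_intros) auto
  then have c: "continuous_on UNIV ?f"
    by (rule continuous_on_compose2) (auto intro!: continuous_intros)
  have d: "(?F has_real_derivative ?f s) (at s)" for s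
  proof -
    have "((\<lambda>s. x + s *\<^sub>R h) has_derivative (\<lambda>c. c *\<^sub>R h)) (at s)"
      by (auto intro!: derivative_eq_intros)
    from has_derivative_compose[OF this Ck_Suc_derivative[OF C]]
    have "(?F has_derivative (\<lambda>c. frechet_derivative \<phi> (at (x + s *\<^sub>R h)) (c *\<^sub>R h))) (at s)" .
    moreover have "frechet_derivative \<phi> (at (x + s *\<^sub>R h)) (c *\<^sub>R h) = ?f s * c" for c
      using linear_scale[OF has_derivative_linear[OF Ck_Suc_derivative[OF C]]] by simp
    ultimately show ?thesis by (simp add: has_field_derivative_def)
  qed
  have [measurable]: "?f \<in> borel_measurable borel" by (rule borel_measurable_continuous_onI[OF c])
  have M: "unit_interval_measure = density lborel (\<lambda>s. ennreal (indicator {0..1} s))"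
    by (simp add: unit_interval_measure_def ennreal_indicator)
  have "integrable lborel (\<lambda>s. indicator {0..1} s *\<^sub>R ?f s)"
    by (rule borel_integrable_compact) (auto intro: continuous_on_subset[OF c])
  then show ?A unfolding M by (subst integrable_density) auto
  have "(LINT s|unit_interval_measure. ?f s) = (LINT s|lborel. indicator {0..1} s *\<^sub>R ?f s)"
    unfolding M by (rule integral_density) auto
  also have "\<dots> = ?F 1 - ?F 0"
    using integral_FTC_Icc_real[of 0 1 ?F ?f] d c
    by (auto simp: set_lebesgue_integral_def mult.commute continuous_on_eq_continuous_at)
  finally show ?B by simp
qed

text \<open>The fundamental theorem of calculus along segments, for weak gradients. It is proved by
  duality: paired with a test function, the difference of \<open>u\<close> becomes a difference of
  the test function, to which the classical theorem applies, and the weak gradient brings the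
  derivative back to \<open>u\<close>.\<close>

theorem difference_eq_average_gradient:
  fixes u :: "real^'n::finite \<Rightarrow> complex"
  assumes S: "sobolev_fun u"
  shows "AE x in lborel. u (x + h) - u x =
    (LINT s|unit_interval_measure. dir_deriv (weak_gradient u) h (x + s *\<^sub>R h))"
    and "square_integrable (\<lambda>x. LINT s|unit_interval_measure. dir_deriv (weak_gradient u) h (x + s *\<^sub>R h))"
proof -
  let ?G = "weak_gradient u" and ?M = unit_interval_measure
  let ?D = "dir_deriv ?G h"
  let ?W = "\<lambda>x. LINT s|?M. ?D (x + s *\<^sub>R h)"
  note u = sobolev_fun_square_integrable[OF S] and G = weak_gradient[OF S]
  note D = square_integrable_dir_deriv[OF G(1), of h]
  have [measurable]: "u \<in> borel_measurable borel" "?D \<in> borel_measurable borel"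
    using u D by (auto intro: square_integrable_measurable)
  have Wm [measurable]: "?W \<in> borel_measurable borel" by measurable
  have "(\<integral>\<^sup>+x. ennreal ((norm (?W x))\<^sup>2) \<partial>lborel) \<le> ennreal (L2_square ?D)"
  proof (rule L2_average_le[OF emeasure_unit_interval_measure])
    fix s :: real
    have "(\<integral>\<^sup>+x. ennreal ((norm (?D (x + s *\<^sub>R h)))\<^sup>2) \<partial>lborel) = (\<integral>\<^sup>+x. ennreal ((norm (?D x))\<^sup>2) \<partial>lborel)"
      by (rule nn_integral_lborel_shift) measurable
    then show "(\<integral>\<^sup>+x. ennreal ((norm (?D (x + s *\<^sub>R h)))\<^sup>2) \<partial>lborel) \<le> ennreal (L2_square ?D)"
      by (simp add: nn_integral_square_integrable[OF D])
  qed measurable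
  also have "\<dots> < \<infinity>" by simp
  finally show W: "square_integrable ?W"
    unfolding square_integrable_def by (auto intro!: integrableI_bounded)
  have dq: "square_integrable (\<lambda>x. u (x + h) - u x)"
    using square_integrable_add[OF square_integrable_shift[OF u, of h] square_integrable_scaleR[OF u, of "-1"]] by simp
  have weak: "(LINT x|lborel. \<phi> x *\<^sub>R (u (x + h) - u x)) = (LINT x|lborel. \<phi> x *\<^sub>R ?W x)"
    if t: "test_function \<phi>" for \<phi>
  proof -
    let ?d = "\<lambda>x. frechet_derivative \<phi> (at x) h"
    have td: "square_integrable ?d"
      unfolding test_function_dir[OF t, of _ h]
      by (intro square_integrable_sum)
         (use square_integrable_scaleR[OF test_function_square_integrable[OF test_function_partial[OF t]]] in auto)
    have [measurable]: "?d \<in> borel_measurable borel" "\<phi> \<in> borel_measurable borel"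
      using td test_function_measurable[OF t] by (auto intro: square_integrable_measurable)
    have "(LINT x|lborel. \<phi> x *\<^sub>R (u (x + h) - u x)) =
        (LINT x|lborel. \<phi> x *\<^sub>R u (x + h)) - (LINT x|lborel. \<phi> x *\<^sub>R u x)"
      unfolding scaleR_diff_right
      by (intro Bochner_Integration.integral_diff test_function_scaleR_integrable t u square_integrable_shift)
    also have "(LINT x|lborel. \<phi> x *\<^sub>R u (x + h)) = (LINT x|lborel. \<phi> (x + - h) *\<^sub>R u (x + - h + h))"
      by (rule integral_lborel_shift[symmetric]) measurable
    also have "\<dots> = (LINT x|lborel. \<phi> (x + - h) *\<^sub>R u x)" by simp
    also have "\<dots> - (LINT x|lborel. \<phi> x *\<^sub>R u x) = (LINT x|lborel. (\<phi> (x + - h) - \<phi> x) *\<^sub>R u x)"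
      unfolding scaleR_diff_left
      by (intro Bochner_Integration.integral_diff[symmetric] test_function_scaleR_integrable t u test_function_shift)
    also have "\<dots> = (LINT x|lborel. LINT s|?M. (- ?d (x + s *\<^sub>R (- h))) *\<^sub>R u x)"
    proof (rule Bochner_Integration.integral_cong[OF refl])
      fix x
      have n: "frechet_derivative \<phi> (at y) (- h) = - ?d y" for y
        using linear_neg[OF has_derivative_linear[OF Ck_Suc_derivative[OF test_function_Ck[OF t, of "Suc 0"]]]] by simp
      have "(LINT s|?M. (- ?d (x + s *\<^sub>R (- h))) *\<^sub>R u x) = (LINT s|?M. - ?d (x + s *\<^sub>R (- h))) *\<^sub>R u x"
      proof (cases "u x = 0")
        case False
        have "integrable ?M (\<lambda>s. - ?d (x + s *\<^sub>R (- h)))"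
          using FTC_unit_interval(1)[OF t, of x "- h"] by (simp only: n)
        then show ?thesis by (rule integral_scaleR_left)
      qed simp
      then show "(\<phi> (x + - h) - \<phi> x) *\<^sub>R u x = (LINT s|?M. (- ?d (x + s *\<^sub>R (- h))) *\<^sub>R u x)"
        by (simp only: FTC_unit_interval(2)[OF t, of x "- h", unfolded n])
    qed
    \<comment> \<open>Exchanging the integrals lets each translate of the test function be paired
      with \<open>u\<close> separately, which is where the definition of the weak gradient
      enters.\<close>
    also have "\<dots> = (LINT s|?M. LINT x|lborel. (- ?d (x + s *\<^sub>R (- h))) *\<^sub>R u x)"
      by (rule unit_interval_pair.Fubini_integral)
         (use integrable_shift_product[OF square_integrable_scaleR[OF td, of "-1"] u, of "- h" 0] in simp)
    also have "\<dots> = (LINT s|?M. LINT x|lborel. \<phi> x *\<^sub>R ?D (x + s *\<^sub>R h))"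
    proof (rule Bochner_Integration.integral_cong[OF refl])
      fix s :: real
      let ?y = "s *\<^sub>R (- h)"
      have "(LINT x|lborel. (- ?d (x + ?y)) *\<^sub>R u x) = - (LINT x|lborel. ?d (x + ?y) *\<^sub>R u x)"
        by simp
      also have "(LINT x|lborel. ?d (x + ?y) *\<^sub>R u x) = - (LINT x|lborel. \<phi> (x + ?y) *\<^sub>R ?D x)"
        using is_weak_gradient_dir[OF G(2) u G(1) test_function_shift[OF t, of ?y], of h]
        by (simp only: frechet_derivative_shift[OF test_function_Ck[OF t, of "Suc 0"]])
      also have "(LINT x|lborel. \<phi> (x + ?y) *\<^sub>R ?D x) = (LINT x|lborel. \<phi> (x + ?y) *\<^sub>R ?D (x + ?y + s *\<^sub>R h))"
        by simp
      also have "\<dots> = (LINT x|lborel. \<phi> x *\<^sub>R ?D (x + s *\<^sub>R h))"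
        by (rule integral_lborel_shift) measurable
      finally show "(LINT x|lborel. (- ?d (x + ?y)) *\<^sub>R u x) = (LINT x|lborel. \<phi> x *\<^sub>R ?D (x + s *\<^sub>R h))" by simp
    qed
    also have "\<dots> = (LINT x|lborel. LINT s|?M. \<phi> x *\<^sub>R ?D (x + s *\<^sub>R h))"
      by (rule unit_interval_pair.Fubini_integral[symmetric])
         (use integrable_shift_product[OF test_function_square_integrable[OF t] D, of 0 h] in simp)
    also have "\<dots> = (LINT x|lborel. \<phi> x *\<^sub>R ?W x)" by simp
    finally show ?thesis .
  qed
  have diff: "square_integrable (\<lambda>x. u (x + h) - u x - ?W x)"
    using square_integrable_add[OF dq square_integrable_scaleR[OF W, of "-1"]] by simp
  have "AE x in lborel. (u (x + h) - u x - ?W x) \<bullet> b = 0" for b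
  proof (rule fundamental_lemma)
    from square_integrable_component[OF diff, of b]
    show "(\<lambda>x. (u (x + h) - u x - ?W x) \<bullet> b) \<in> borel_measurable lborel"
      "integrable lborel (\<lambda>x. (norm ((u (x + h) - u x - ?W x) \<bullet> b))\<^sup>2)"
      unfolding square_integrable_def by blast+
    fix \<phi> :: "real^'n \<Rightarrow> real" assume t: "test_function \<phi>"
    have "(LINT x|lborel. \<phi> x * ((u (x + h) - u x - ?W x) \<bullet> b)) =
        (LINT x|lborel. (\<phi> x *\<^sub>R (u (x + h) - u x) - \<phi> x *\<^sub>R ?W x) \<bullet> b)"
      by (rule Bochner_Integration.integral_cong) (auto simp: inner_diff_left algebra_simps)
    also have "\<dots> = (LINT x|lborel. \<phi> x *\<^sub>R (u (x + h) - u x) - \<phi> x *\<^sub>R ?W x) \<bullet> b"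
      by (rule integral_inner_left)
         (intro impI Bochner_Integration.integrable_diff test_function_scaleR_integrable t dq W)
    also have "\<dots> = 0"
      using weak[OF t] test_function_scaleR_integrable[OF t dq] test_function_scaleR_integrable[OF t W]
      by simp
    finally show "(LINT x|lborel. \<phi> x * ((u (x + h) - u x - ?W x) \<bullet> b)) = 0" .
  qed
  then have "AE x in lborel. \<forall>b\<in>Basis. (u (x + h) - u x - ?W x) \<bullet> b = 0"
    by (intro AE_finite_allI) auto
  then show "AE x in lborel. u (x + h) - u x = ?W x"
  proof (rule AE_mp, intro AE_I2 impI)
    fix x assume "\<forall>b\<in>Basis. (u (x + h) - u x - ?W x) \<bullet> b = 0"
    then have "u (x + h) - u x - ?W x = 0" by (simp only: euclidean_all_zero_iff)
    then show "u (x + h) - u x = ?W x" by simp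
  qed
qed

text \<open>The difference is an average of directional derivatives along the segment, all of which
  have the same \<open>L^2\<close> norm by translation invariance.\<close>

lemma difference_L2_le:
  fixes u :: "real^'n::finite \<Rightarrow> complex"
  assumes S: "sobolev_fun u"
  shows "(LINT x|lborel. (norm (u (x + h) - u x))\<^sup>2) \<le> (norm h)\<^sup>2 * (L2_square (weak_gradient u))"
proof -
  let ?G = "weak_gradient u" and ?M = unit_interval_measure
  let ?D = "dir_deriv ?G h"
  note u = sobolev_fun_square_integrable[OF S] and G = weak_gradient[OF S]
  note D = square_integrable_dir_deriv[OF G(1), of h]
  have [measurable]: "u \<in> borel_measurable borel" "?D \<in> borel_measurable borel"
    using u D by (auto intro: square_integrable_measurable)
  have dq: "square_integrable (\<lambda>x. u (x + h) - u x)"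
    using square_integrable_add[OF square_integrable_shift[OF u, of h] square_integrable_scaleR[OF u, of "-1"]] by simp
  have "ennreal (LINT x|lborel. (norm (u (x + h) - u x))\<^sup>2) = (\<integral>\<^sup>+x. ennreal ((norm (u (x + h) - u x))\<^sup>2) \<partial>lborel)"
    by (rule nn_integral_square_integrable[OF dq, symmetric])
  also have "\<dots> = (\<integral>\<^sup>+x. ennreal ((norm (LINT s|?M. ?D (x + s *\<^sub>R h)))\<^sup>2) \<partial>lborel)"
    by (rule nn_integral_cong_AE) (use difference_eq_average_gradient(1)[OF S, of h] in eventually_elim, simp)
  also have "\<dots> \<le> ennreal (L2_square ?D)"
  proof (rule L2_average_le[OF emeasure_unit_interval_measure])
    fix s :: real
    have "(\<integral>\<^sup>+x. ennreal ((norm (?D (x + s *\<^sub>R h)))\<^sup>2) \<partial>lborel) = (\<integral>\<^sup>+x. ennreal ((norm (?D x))\<^sup>2) \<partial>lborel)"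
      by (rule nn_integral_lborel_shift) measurable
    then show "(\<integral>\<^sup>+x. ennreal ((norm (?D (x + s *\<^sub>R h)))\<^sup>2) \<partial>lborel) \<le> ennreal (L2_square ?D)"
      by (simp add: nn_integral_square_integrable[OF D])
  qed measurable
  also have "(L2_square ?D) \<le> (LINT x|lborel. (norm h)\<^sup>2 * (norm (?G x))\<^sup>2)"
  proof (rule integral_mono)
    show "(norm (?D x))\<^sup>2 \<le> (norm h)\<^sup>2 * (norm (?G x))\<^sup>2" for x
      using power_mono[OF norm_dir_deriv_le[of ?G h x], of 2] by (simp add: power_mult_distrib)
  qed (use D G(1) in \<open>auto simp: square_integrable_def\<close>)
  finally show ?thesis by (simp add: Bochner_Integration.integral_nonneg ennreal_le_iff ennreal_leI)
qed

text \<open>The derivative at \<open>x\<close> does not depend on \<open>s\<close> and may be put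
  under the average, so only the \<open>L^2\<close> modulus of continuity of the gradient enters.
  With \<open>K\<close> of order \<open>(norm h)\<^sup>2\<close> the \<open>L^2\<close> error is
  quadratic in the step.\<close>

lemma difference_minus_derivative_L2_le:
  fixes u :: "real^'n::finite \<Rightarrow> complex"
  assumes S: "sobolev_fun u" and K: "\<And>s. s \<in> {0..1} \<Longrightarrow>
     (LINT x|lborel. (norm (weak_gradient u (x + s *\<^sub>R h) - weak_gradient u x))\<^sup>2) \<le> K"
  shows "(LINT x|lborel. (norm (u (x + h) - u x - dir_deriv (weak_gradient u) h x))\<^sup>2) \<le> (norm h)\<^sup>2 * K"
proof -
  let ?G = "weak_gradient u" and ?M = unit_interval_measure
  let ?D = "dir_deriv ?G h"
  note u = sobolev_fun_square_integrable[OF S] and G = weak_gradient[OF S]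
  note D = square_integrable_dir_deriv[OF G(1), of h]
  have [measurable]: "u \<in> borel_measurable borel" "?D \<in> borel_measurable borel"
    using u D by (auto intro: square_integrable_measurable)
  have K0: "0 \<le> K"
    using order_trans[OF Bochner_Integration.integral_nonneg K[of 0]] by simp
  have diffD: "square_integrable (\<lambda>x. ?D (x + k) - ?D x)" for k
    using square_integrable_add[OF square_integrable_shift[OF D, of k] square_integrable_scaleR[OF D, of "-1"]] by simp
  have diffG: "square_integrable (\<lambda>x. ?G (x + k) - ?G x)" for k
    using square_integrable_add[OF square_integrable_shift[OF G(1), of k] square_integrable_scaleR[OF G(1), of "-1"]] by simp
  have dq: "square_integrable (\<lambda>x. u (x + h) - u x - ?D x)"
    using square_integrable_add[OF square_integrable_add[OF square_integrable_shift[OF u, of h]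
        square_integrable_scaleR[OF u, of "-1"]] square_integrable_scaleR[OF D, of "-1"]] by simp
  \<comment> \<open>For almost every \<open>x\<close> the derivative is integrable in
    \<open>s\<close>; this justifies subtracting the constant \<open>?D x\<close> inside the Bochner
    integral.\<close>
  have "(\<integral>\<^sup>+x. \<integral>\<^sup>+s. ennreal ((norm (?D (x + s *\<^sub>R h)))\<^sup>2) \<partial>?M \<partial>lborel) =
      (\<integral>\<^sup>+s. \<integral>\<^sup>+x. ennreal ((norm (?D (x + s *\<^sub>R h)))\<^sup>2) \<partial>lborel \<partial>?M)"
    by (rule unit_interval_pair.Fubini') measurable
  also have "\<dots> = (\<integral>\<^sup>+s. \<integral>\<^sup>+x. ennreal ((norm (?D x))\<^sup>2) \<partial>lborel \<partial>?M)"
    by (intro nn_integral_cong nn_integral_lborel_shift) measurable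
  also have "\<dots> \<noteq> \<infinity>"
    using emeasure_unit_interval_measure by (simp add: nn_integral_square_integrable[OF D])
  finally have "AE x in lborel. (\<integral>\<^sup>+s. ennreal ((norm (?D (x + s *\<^sub>R h)))\<^sup>2) \<partial>?M) \<noteq> \<infinity>"
    by (intro nn_integral_PInf_AE) measurable
  then have int: "AE x in lborel. integrable ?M (\<lambda>s. ?D (x + s *\<^sub>R h))"
  proof eventually_elim
    case (elim x)
    then have "integrable ?M (\<lambda>s. (norm (?D (x + s *\<^sub>R h)))\<^sup>2)"
      by (intro integrableI_bounded) (auto simp: less_top)
    then have i: "integrable ?M (\<lambda>s. 1 + (norm (?D (x + s *\<^sub>R h)))\<^sup>2)" by simp
    then show ?case
      by (intro Bochner_Integration.integrable_bound[OF i]) (auto simp: le_one_plus_square)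
  qed
  have "ennreal (LINT x|lborel. (norm (u (x + h) - u x - ?D x))\<^sup>2) = (\<integral>\<^sup>+x. ennreal ((norm (u (x + h) - u x - ?D x))\<^sup>2) \<partial>lborel)"
    by (rule nn_integral_square_integrable[OF dq, symmetric])
  also have "\<dots> = (\<integral>\<^sup>+x. ennreal ((norm (LINT s|?M. ?D (x + s *\<^sub>R h) - ?D x))\<^sup>2) \<partial>lborel)"
  proof (rule nn_integral_cong_AE)
    have one: "measure ?M UNIV = 1" using emeasure_unit_interval_measure by (simp add: measure_def)
    show "AE x in lborel. ennreal ((norm (u (x + h) - u x - ?D x))\<^sup>2) = ennreal ((norm (LINT s|?M. ?D (x + s *\<^sub>R h) - ?D x))\<^sup>2)"
      using difference_eq_average_gradient(1)[OF S, of h] int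
      by eventually_elim (simp add: one)
  qed
  \<comment> \<open>The averaging lemma asks for a bound at every real \<open>s\<close>, but
    \<open>K\<close> controls only the unit interval; the indicator discards the other values
    without changing the integral.\<close>
  also have "\<dots> = (\<integral>\<^sup>+x. ennreal ((norm (LINT s|?M. indicator {0..1} s *\<^sub>R (?D (x + s *\<^sub>R h) - ?D x)))\<^sup>2) \<partial>lborel)"
  proof -
    have "AE s in ?M. s \<in> {0..1}"
      unfolding unit_interval_measure_def by (subst AE_density) (auto simp: indicator_def)
    then have eq: "(LINT s|?M. f s) = (LINT s|?M. indicator {0..1} s *\<^sub>R f s)"
      if [measurable]: "f \<in> borel_measurable borel" for f :: "real \<Rightarrow> complex"
      by (intro integral_cong_AE) (auto elim: eventually_mono)
    show ?thesis
      by (intro nn_integral_cong arg_cong[where f = "\<lambda>z. ennreal ((norm z)\<^sup>2)"] eq) measurable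
  qed
  also have "\<dots> \<le> ennreal ((norm h)\<^sup>2 * K)"
  proof (rule L2_average_le[OF emeasure_unit_interval_measure])
    fix s :: real
    show "(\<integral>\<^sup>+x. ennreal ((norm (indicator {0..1} s *\<^sub>R (?D (x + s *\<^sub>R h) - ?D x)))\<^sup>2) \<partial>lborel) \<le> ennreal ((norm h)\<^sup>2 * K)"
    proof (cases "s \<in> {0..1}")
      case True
      have "(LINT x|lborel. (norm (?D (x + s *\<^sub>R h) - ?D x))\<^sup>2) \<le> (LINT x|lborel. (norm h)\<^sup>2 * (norm (?G (x + s *\<^sub>R h) - ?G x))\<^sup>2)"
      proof (rule integral_mono)
        show "(norm (?D (x + s *\<^sub>R h) - ?D x))\<^sup>2 \<le> (norm h)\<^sup>2 * (norm (?G (x + s *\<^sub>R h) - ?G x))\<^sup>2" for x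
          using power_mono[OF norm_dir_deriv_le[of "\<lambda>_. ?G (x + s *\<^sub>R h) - ?G x" h x], of 2]
          by (simp add: power_mult_distrib dir_deriv_diff)
      qed (use diffD diffG in \<open>auto simp: square_integrable_def\<close>)
      also have "\<dots> \<le> (norm h)\<^sup>2 * K"
        using K[OF True] by (simp add: mult_left_mono)
      finally show ?thesis
        using True nn_integral_square_integrable[OF diffD, of "s *\<^sub>R h"] by (simp add: ennreal_leI)
    qed (simp add: K0)
  qed measurable
  finally show ?thesis by (simp add: K0)
qed

section \<open>The Gagliardo-Nirenberg inequality\<close>

text \<open>For positive \<open>\<rho>\<close> the floor functions encode a grid of half-open cubes
  of side \<open>\<rho>\<close> with a vertex at the origin, so that the cells partition the space
  and halving \<open>\<rho>\<close> refines the grid.\<close>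

definition same_cell :: "real \<Rightarrow> real^'n::finite \<Rightarrow> real^'n \<Rightarrow> bool" where
  "same_cell \<rho> x y \<longleftrightarrow> (\<forall>i. \<lfloor>x $ i / \<rho>\<rfloor> = \<lfloor>y $ i / \<rho>\<rfloor>)"

lemma borel_measurable_nth [measurable]: "(\<lambda>x::real^'n::finite. x $ i) \<in> borel_measurable borel"
  by (intro borel_measurable_continuous_onI continuous_intros)

lemma same_cell_measurable [measurable]:
  "Measurable.pred (borel \<Otimes>\<^sub>M borel) (\<lambda>(x, y). same_cell \<rho> x (y :: real^'n::finite))"
proof -
  have "Measurable.pred (borel \<Otimes>\<^sub>M borel) (\<lambda>z. \<forall>i\<in>UNIV. \<lfloor>fst z $ i / \<rho>\<rfloor> = \<lfloor>(snd z :: real^'n) $ i / \<rho>\<rfloor>)"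
    by (intro pred_intros_finite) (auto, measurable)
  then show ?thesis by (simp add: same_cell_def split_beta')
qed

lemma same_cell_pred [measurable]: "Measurable.pred borel (same_cell \<rho> x)"
  using measurable_compose[OF _ same_cell_measurable, of "\<lambda>y. (x, y)" borel \<rho>] by simp

lemma emeasure_cell:
  assumes \<rho>: "\<rho> > 0"
  shows "emeasure lborel {y. same_cell \<rho> (x :: real^'n::finite) y} = ennreal (\<rho> ^ CARD('n))"
proof -
  define l :: "real^'n" where "l = (\<chi> i. \<rho> * \<lfloor>x $ i / \<rho>\<rfloor>)"
  define u :: "real^'n" where "u = (\<chi> i. \<rho> * \<lfloor>x $ i / \<rho>\<rfloor> + \<rho>)"
  have ul: "(u - l) \<bullet> b = \<rho>" if "b \<in> Basis" for b
    using that by (auto simp: Basis_vec_def inner_axis u_def l_def)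
  have le: "l \<bullet> b \<le> u \<bullet> b" if "b \<in> Basis" for b
    using ul[OF that] \<rho> by (simp add: inner_diff_left)
  have c: "same_cell \<rho> x y \<longleftrightarrow> (\<forall>i. l $ i \<le> y $ i \<and> y $ i < u $ i)" for y
  proof -
    have "\<lfloor>x $ i / \<rho>\<rfloor> = \<lfloor>y $ i / \<rho>\<rfloor> \<longleftrightarrow> l $ i \<le> y $ i \<and> y $ i < u $ i" for i
    proof -
      have "\<lfloor>x $ i / \<rho>\<rfloor> = \<lfloor>y $ i / \<rho>\<rfloor> \<longleftrightarrow> \<lfloor>y $ i / \<rho>\<rfloor> = \<lfloor>x $ i / \<rho>\<rfloor>" by auto
      then show ?thesis using \<rho> by (simp add: floor_eq_iff l_def u_def field_simps)
    qed
    then show ?thesis by (simp add: same_cell_def)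
  qed
  \<comment> \<open>The half-open cell lies between an open and a closed box of the same
    volume.\<close>
  have sub: "box l u \<subseteq> {y. same_cell \<rho> x y}" "{y. same_cell \<rho> x y} \<subseteq> cbox l u"
    by (auto simp: c mem_box_cart less_imp_le)
  have m: "{y. same_cell \<rho> x y} \<in> sets lborel" by measurable
  have "(\<Prod>b\<in>Basis. (u - l) \<bullet> b) = \<rho> ^ CARD('n)" using ul by simp
  then have "emeasure lborel (box l u) = ennreal (\<rho> ^ CARD('n))"
    "emeasure lborel (cbox l u) = ennreal (\<rho> ^ CARD('n))"
    using le by (simp_all add: emeasure_lborel_box emeasure_lborel_cbox)
  with emeasure_mono[OF sub(1) m] emeasure_mono[OF sub(2), of lborel] show ?thesis
    by (intro antisym) auto
qed

text \<open>Normalised to total mass 1 for positive \<open>\<rho>\<close>, so that averages over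
  cells fall under Jensen's inequality above.\<close>

definition cell_measure :: "real \<Rightarrow> real^'n::finite \<Rightarrow> (real^'n) measure" where
  "cell_measure \<rho> x = density lborel (\<lambda>y. ennreal (indicator {y. same_cell \<rho> x y} y / \<rho> ^ CARD('n)))"

definition cell_average :: "real \<Rightarrow> (real^'n::finite \<Rightarrow> complex) \<Rightarrow> real^'n \<Rightarrow> complex" where
  "cell_average \<rho> u x = (LINT y|cell_measure \<rho> x. u y)"

lemma sets_cell_measure [simp, measurable_cong]: "sets (cell_measure \<rho> x) = sets borel"
  by (simp add: cell_measure_def)

lemma space_cell_measure [simp]: "space (cell_measure \<rho> x) = UNIV"
  by (simp add: cell_measure_def)

lemma nn_integral_cell_measure:
  assumes [measurable]: "f \<in> borel_measurable borel"
  shows "(\<integral>\<^sup>+y. f y \<partial>cell_measure \<rho> x) =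
    (\<integral>\<^sup>+y. ennreal (indicator {y. same_cell \<rho> (x::real^'n::finite) y} y / \<rho> ^ CARD('n)) * f y \<partial>lborel)"
  unfolding cell_measure_def by (rule nn_integral_density) measurable

lemma emeasure_cell_measure:
  assumes "\<rho> > 0"
  shows "emeasure (cell_measure \<rho> (x::real^'n::finite)) (space (cell_measure \<rho> x)) = 1"
proof -
  have "emeasure (cell_measure \<rho> x) UNIV =
      (\<integral>\<^sup>+y. ennreal (1 / \<rho> ^ CARD('n)) * indicator {y. same_cell \<rho> x y} y \<partial>lborel)"
    unfolding cell_measure_def using assms
    by (subst emeasure_density) (auto intro!: nn_integral_cong simp: indicator_def)
  also have "\<dots> = ennreal (1 / \<rho> ^ CARD('n)) * ennreal (\<rho> ^ CARD('n))"
    by (subst nn_integral_cmult_indicator) (simp_all add: emeasure_cell[OF assms])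
  also have "\<dots> = 1"
    using assms by (simp add: ennreal_mult[symmetric])
  finally show ?thesis by simp
qed

lemma cell_average_measurable:
  assumes [measurable]: "u \<in> borel_measurable borel" and \<rho>: "\<rho> > 0"
  shows "cell_average \<rho> u \<in> borel_measurable borel"
proof -
  have "cell_average \<rho> u = (\<lambda>x. LINT y|lborel. ((if same_cell \<rho> x y then 1 else 0) / \<rho> ^ CARD('a)) *\<^sub>R u y)"
  proof
    fix x
    have "cell_average \<rho> u x = (LINT y|lborel. (indicator {y. same_cell \<rho> x y} y / \<rho> ^ CARD('a)) *\<^sub>R u y)"
      unfolding cell_average_def cell_measure_def
      by (rule integral_density) (use \<rho> in auto)
    also have "\<dots> = (LINT y|lborel. ((if same_cell \<rho> x y then 1 else 0) / \<rho> ^ CARD('a)) *\<^sub>R u y)"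
      by (rule Bochner_Integration.integral_cong) (auto simp: indicator_def)
    finally show "cell_average \<rho> u x = \<dots>" .
  qed
  moreover have "(\<lambda>x. LINT y|lborel. ((if same_cell \<rho> x y then 1 else 0) / \<rho> ^ CARD('a)) *\<^sub>R u y) \<in> borel_measurable borel"
    by measurable
  ultimately show ?thesis by (simp only:)
qed

lemma cell_average_cong: "same_cell \<rho> x y \<Longrightarrow> cell_average \<rho> u x = cell_average \<rho> u y"
  by (simp add: cell_average_def cell_measure_def same_cell_def)

lemma floor_cong_half:
  fixes a b :: real
  assumes "\<lfloor>2 * a\<rfloor> = \<lfloor>2 * b\<rfloor>"
  shows "\<lfloor>a\<rfloor> = \<lfloor>b\<rfloor>"
proof -
  define m k where "m = \<lfloor>2 * a\<rfloor>" and "k = m div 2"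
  have mk: "m = 2 * k \<or> m = 2 * k + 1" unfolding k_def by presburger
  have "of_int m \<le> 2 * a" "2 * a < of_int m + 1" "of_int m \<le> 2 * b" "2 * b < of_int m + 1"
    using assms unfolding m_def by linarith+
  with mk have "\<lfloor>a\<rfloor> = k" "\<lfloor>b\<rfloor> = k" by (auto intro!: floor_unique)
  then show ?thesis by simp
qed

text \<open>Refinement makes averages over coarse cells constant on the finer cells too, so the
  increments between two consecutive levels are cellwise constant.\<close>

lemma same_cell_half:
  assumes "same_cell (\<rho> / 2) x y"
  shows "same_cell \<rho> x y"
  unfolding same_cell_def
proof
  fix i
  have h: "\<lfloor>2 * (x $ i / \<rho>)\<rfloor> = \<lfloor>2 * (y $ i / \<rho>)\<rfloor>"
    using assms by (simp add: same_cell_def mult.commute)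
  show "\<lfloor>x $ i / \<rho>\<rfloor> = \<lfloor>y $ i / \<rho>\<rfloor>"
    using h by (rule floor_cong_half)
qed

text \<open>The cell of \<open>x\<close> alone contributes the squared value at \<open>x\<close>
  times its volume to the integral. This inverse estimate turns \<open>L^2\<close> bounds into sup
  bounds at the price of a negative power of \<open>\<rho>\<close>.\<close>

lemma cellwise_constant_le:
  fixes v :: "real^'n::finite \<Rightarrow> complex"
  assumes \<rho>: "\<rho> > 0" and v: "square_integrable v" and c: "\<And>x y. same_cell \<rho> x y \<Longrightarrow> v x = v y"
  shows "(norm (v x))\<^sup>2 \<le> (LINT y|lborel. (norm (v y))\<^sup>2) / \<rho> ^ CARD('n)"
proof -
  have "ennreal ((norm (v x))\<^sup>2 * \<rho> ^ CARD('n)) = ennreal ((norm (v x))\<^sup>2) * emeasure lborel {y. same_cell \<rho> x y}"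
    using \<rho> by (simp add: emeasure_cell ennreal_mult)
  also have "\<dots> = (\<integral>\<^sup>+y. ennreal ((norm (v x))\<^sup>2) * indicator {y. same_cell \<rho> x y} y \<partial>lborel)"
    by (rule nn_integral_cmult_indicator[symmetric]) measurable
  also have "\<dots> \<le> (\<integral>\<^sup>+y. ennreal ((norm (v y))\<^sup>2) \<partial>lborel)"
    using c by (intro nn_integral_mono) (auto simp: indicator_def)
  also have "\<dots> = ennreal (LINT y|lborel. (norm (v y))\<^sup>2)"
    by (rule nn_integral_square_integrable[OF v])
  finally show ?thesis using \<rho> by (simp add: field_simps)
qed

lemma integrable_cell_measure:
  fixes u :: "real^'n::finite \<Rightarrow> complex" and \<rho> :: real
  assumes u: "square_integrable u" and \<rho>: "\<rho> > 0"
  shows "integrable (cell_measure \<rho> x) u"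
proof -
  have [measurable]: "u \<in> borel_measurable borel" using u by (auto intro: square_integrable_measurable)
  interpret finite_measure "cell_measure \<rho> x"
    by standard (simp only: emeasure_cell_measure[OF \<rho>], simp)
  have "(\<integral>\<^sup>+y. ennreal ((norm (u y))\<^sup>2) \<partial>cell_measure \<rho> x) \<le> ennreal (1 / \<rho> ^ CARD('n)) * (\<integral>\<^sup>+y. ennreal ((norm (u y))\<^sup>2) \<partial>lborel)"
    using \<rho> by (subst nn_integral_cell_measure, measurable, subst nn_integral_cmult[symmetric], measurable)
      (auto intro!: nn_integral_mono simp: indicator_def)
  also have "\<dots> < \<infinity>" by (simp add: nn_integral_square_integrable[OF u] ennreal_mult_less_top)
  finally have "integrable (cell_measure \<rho> x) (\<lambda>y. (norm (u y))\<^sup>2)"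
    by (intro integrableI_bounded) auto
  then have i: "integrable (cell_measure \<rho> x) (\<lambda>y. 1 + (norm (u y))\<^sup>2)" by simp
  then show ?thesis
    by (intro Bochner_Integration.integrable_bound[OF i]) (auto simp: le_one_plus_square)
qed

text \<open>A Poincare inequality on all cells at once. Two points of one cell differ by a vector
  \<open>h\<close> in the cube \<open>?Q\<close> of side \<open>2 * \<rho>\<close>; after Tonelli
  the translation estimate applies for each \<open>h\<close>. The factor \<open>2 ^ CARD('n)\<close>
  is the volume of \<open>?Q\<close> divided by that of a cell, and
  \<open>CARD('n) * \<rho>\<^sup>2\<close> bounds \<open>(norm h)\<^sup>2\<close> on
  \<open>?Q\<close>.\<close>

lemma cell_average_L2_error:
  fixes u :: "real^'n::finite \<Rightarrow> complex" and \<rho> :: real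
  assumes S: "sobolev_fun u" and \<rho>: "\<rho> > 0"
  shows "(\<integral>\<^sup>+x. ennreal ((norm (u x - cell_average \<rho> u x))\<^sup>2) \<partial>lborel) \<le>
     ennreal (2 ^ CARD('n) * CARD('n) * \<rho>\<^sup>2 * (L2_square (weak_gradient u)))"
proof -
  let ?T = "L2_square (weak_gradient u)" and ?N = "CARD('n)"
  let ?Q = "cbox (\<chi> i. - \<rho>) (\<chi> i. \<rho>) :: (real^'n) set"
  note u = sobolev_fun_square_integrable[OF S]
  have [measurable]: "u \<in> borel_measurable borel" using u by (auto intro: square_integrable_measurable)
  have T0: "0 \<le> ?T" by (intro Bochner_Integration.integral_nonneg) auto
  have dq: "square_integrable (\<lambda>x. u (x + h) - u x)" for h
    using square_integrable_add[OF square_integrable_shift[OF u, of h] square_integrable_scaleR[OF u, of "-1"]] by simp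
  have "ennreal ((norm (u x - cell_average \<rho> u x))\<^sup>2) \<le>
     (\<integral>\<^sup>+h. ennreal (indicator ?Q h / \<rho> ^ ?N) * ennreal ((norm (u (x + h) - u x))\<^sup>2) \<partial>lborel)" for x
  proof -
    let ?M = "cell_measure \<rho> x"
    interpret finite_measure ?M
      by standard (simp only: emeasure_cell_measure[OF \<rho>], simp)
    have one: "measure ?M UNIV = 1" using emeasure_cell_measure[OF \<rho>, of x] by (simp add: measure_def)
    have "u x - cell_average \<rho> u x = - (LINT y|?M. u y - u x)"
      using integrable_cell_measure[OF u \<rho>, of x] by (simp add: cell_average_def one)
    then have "ennreal ((norm (u x - cell_average \<rho> u x))\<^sup>2) = ennreal ((norm (LINT y|?M. u y - u x))\<^sup>2)"
      by (simp only: norm_minus_cancel)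
    also have "\<dots> \<le> (\<integral>\<^sup>+y. ennreal ((norm (u y - u x))\<^sup>2) \<partial>?M)"
      by (rule norm_integral_square_le[OF emeasure_cell_measure[OF \<rho>]]) measurable
    also have "\<dots> = (\<integral>\<^sup>+y. ennreal (indicator {y. same_cell \<rho> x y} y / \<rho> ^ ?N) * ennreal ((norm (u y - u x))\<^sup>2) \<partial>lborel)"
      by (rule nn_integral_cell_measure) measurable
    also have "\<dots> = (\<integral>\<^sup>+h. ennreal (indicator {y. same_cell \<rho> x y} (h + x) / \<rho> ^ ?N) * ennreal ((norm (u (h + x) - u x))\<^sup>2) \<partial>lborel)"
      by (rule nn_integral_lborel_shift[symmetric]) measurable
    also have "\<dots> \<le> (\<integral>\<^sup>+h. ennreal (indicator ?Q h / \<rho> ^ ?N) * ennreal ((norm (u (x + h) - u x))\<^sup>2) \<partial>lborel)"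
    proof (rule nn_integral_mono)
      fix h
      have "h \<in> ?Q" if "same_cell \<rho> x (h + x)"
      proof -
        have "\<bar>h $ i\<bar> \<le> \<rho>" for i
        proof -
          have "\<lfloor>x $ i / \<rho>\<rfloor> = \<lfloor>h $ i / \<rho> + x $ i / \<rho>\<rfloor>"
            using that by (simp add: same_cell_def add_divide_distrib)
          then have "\<bar>h $ i / \<rho>\<bar> \<le> 1" by linarith
          then show ?thesis using \<rho> by (simp add: field_simps)
        qed
        then show ?thesis by (auto simp: mem_box_cart abs_le_iff minus_le_iff)
      qed
      then show "ennreal (indicator {y. same_cell \<rho> x y} (h + x) / \<rho> ^ ?N) * ennreal ((norm (u (h + x) - u x))\<^sup>2)
        \<le> ennreal (indicator ?Q h / \<rho> ^ ?N) * ennreal ((norm (u (x + h) - u x))\<^sup>2)"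
        by (auto simp: indicator_def add.commute)
    qed
    finally show ?thesis .
  qed
  then have "(\<integral>\<^sup>+x. ennreal ((norm (u x - cell_average \<rho> u x))\<^sup>2) \<partial>lborel) \<le>
     (\<integral>\<^sup>+x. \<integral>\<^sup>+h. ennreal (indicator ?Q h / \<rho> ^ ?N) * ennreal ((norm (u (x + h) - u x))\<^sup>2) \<partial>lborel \<partial>lborel)"
    by (intro nn_integral_mono)
  also have "\<dots> = (\<integral>\<^sup>+h. \<integral>\<^sup>+x. ennreal (indicator ?Q h / \<rho> ^ ?N) * ennreal ((norm (u (x + h) - u x))\<^sup>2) \<partial>lborel \<partial>lborel)"
    by (rule lborel_pair.Fubini') measurable
  also have "\<dots> \<le> (\<integral>\<^sup>+h. ennreal (?N * \<rho>\<^sup>2 * ?T / \<rho> ^ ?N) * indicator ?Q h \<partial>lborel)"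
  proof (rule nn_integral_mono)
    fix h :: "real^'n"
    have "(\<integral>\<^sup>+x. ennreal (indicator ?Q h / \<rho> ^ ?N) * ennreal ((norm (u (x + h) - u x))\<^sup>2) \<partial>lborel) =
        ennreal (indicator ?Q h / \<rho> ^ ?N) * ennreal (LINT x|lborel. (norm (u (x + h) - u x))\<^sup>2)"
      by (subst nn_integral_cmult) (simp_all add: nn_integral_square_integrable[OF dq])
    also have "\<dots> = ennreal (indicator ?Q h / \<rho> ^ ?N * (LINT x|lborel. (norm (u (x + h) - u x))\<^sup>2))"
      using \<rho> by (subst ennreal_mult) auto
    also have "\<dots> \<le> ennreal (indicator ?Q h / \<rho> ^ ?N * (?N * \<rho>\<^sup>2 * ?T))"
    proof (cases "h \<in> ?Q")
      case True
      have "(norm h)\<^sup>2 = (\<Sum>i\<in>UNIV. (h $ i)\<^sup>2)"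
        by (simp add: norm_vec_def L2_set_def sum_nonneg)
      also have "\<dots> \<le> (\<Sum>i\<in>(UNIV::'n set). \<rho>\<^sup>2)"
      proof (rule sum_mono)
        fix i
        have "\<bar>h $ i\<bar> \<le> \<rho>"
          using True by (auto simp: mem_box_cart abs_le_iff minus_le_iff)
        then show "(h $ i)\<^sup>2 \<le> \<rho>\<^sup>2" using \<rho> by (simp add: abs_le_square_iff[symmetric])
      qed
      finally have "(norm h)\<^sup>2 \<le> ?N * \<rho>\<^sup>2" by simp
      then have "(LINT x|lborel. (norm (u (x + h) - u x))\<^sup>2) \<le> ?N * \<rho>\<^sup>2 * ?T"
        by (intro order_trans[OF difference_L2_le[OF S]] mult_right_mono T0)
      then show ?thesis using \<rho> by (intro ennreal_leI mult_left_mono) auto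
    qed simp
    also have "\<dots> = ennreal (?N * \<rho>\<^sup>2 * ?T / \<rho> ^ ?N) * indicator ?Q h"
      by (simp add: indicator_def)
    finally show "(\<integral>\<^sup>+x. ennreal (indicator ?Q h / \<rho> ^ ?N) * ennreal ((norm (u (x + h) - u x))\<^sup>2) \<partial>lborel) \<le>
       ennreal (?N * \<rho>\<^sup>2 * ?T / \<rho> ^ ?N) * indicator ?Q h" .
  qed
  also have "\<dots> = ennreal (?N * \<rho>\<^sup>2 * ?T / \<rho> ^ ?N) * emeasure lborel ?Q"
    by (rule nn_integral_cmult_indicator) simp
  also have "emeasure lborel ?Q = ennreal ((2 * \<rho>) ^ ?N)"
  proof -
    have "((\<chi> i. - \<rho>) :: real^'n) \<bullet> b \<le> (\<chi> i. \<rho>) \<bullet> b"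
      "((\<chi> i. \<rho>) - (\<chi> i. - \<rho>)) \<bullet> (b :: real^'n) = 2 * \<rho>" if "b \<in> Basis" for b
      using that \<rho> by (auto simp: Basis_vec_def inner_axis inner_diff_left)
    then show ?thesis by (simp add: emeasure_lborel_cbox)
  qed
  also have "ennreal (?N * \<rho>\<^sup>2 * ?T / \<rho> ^ ?N) * ennreal ((2 * \<rho>) ^ ?N) = ennreal (2 ^ ?N * ?N * \<rho>\<^sup>2 * ?T)"
    using \<rho> T0 by (subst ennreal_mult[symmetric]) (auto simp: power_mult_distrib field_simps)
  finally show ?thesis .
qed

text \<open>Pigeonhole in place of Hoelder: some summand must carry at least its share
  \<open>c k / S\<close> of the norm, and the sum over all \<open>k\<close> dominates that one term.
  With geometric weights any number of summands is handled with one constant.\<close>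

lemma sum_powr_weighted_le:
  fixes a :: "'i \<Rightarrow> 'b::real_normed_vector"
  assumes "finite I" and c: "\<And>k. k \<in> I \<Longrightarrow> c k > 0" and S: "sum c I \<le> S" and r: "r > 0"
  shows "norm (sum a I) powr r \<le> S powr r * (\<Sum>k\<in>I. (norm (a k) / c k) powr r)"
proof (cases "sum a I = 0")
  case True
  then show ?thesis by (auto intro!: mult_nonneg_nonneg sum_nonneg)
next
  case False
  let ?A = "norm (sum a I)"
  have A: "?A > 0" using False by simp
  have "I \<noteq> {}" using False by auto
  then have "sum c I > 0" using assms(1) c by (intro sum_pos) auto
  then have S0: "S > 0" using S by linarith
  have "\<exists>k\<in>I. c k * ?A / S \<le> norm (a k)"
  proof (rule ccontr)
    assume "\<not> ?thesis"
    then have "(\<Sum>k\<in>I. norm (a k)) < (\<Sum>k\<in>I. c k * ?A / S)"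
      using \<open>I \<noteq> {}\<close> assms(1) by (intro sum_strict_mono) auto
    also have "\<dots> = sum c I * ?A / S" by (simp add: sum_distrib_right sum_divide_distrib)
    also have "\<dots> \<le> ?A" using S S0 A by (simp add: field_simps)
    finally show False using norm_sum[of a I] by linarith
  qed
  then obtain k where k: "k \<in> I" "c k * ?A / S \<le> norm (a k)" by blast
  have "?A \<le> S * (norm (a k) / c k)"
    using k(2) S0 c[OF k(1)] by (simp add: field_simps)
  then have "?A powr r \<le> (S * (norm (a k) / c k)) powr r"
    using r by (intro powr_mono2) auto
  also have "\<dots> = S powr r * (norm (a k) / c k) powr r"
    using S0 c[OF k(1)] by (subst powr_mult) auto
  also have "\<dots> \<le> S powr r * (\<Sum>k\<in>I. (norm (a k) / c k) powr r)"
    using k(1) assms(1) by (intro mult_left_mono member_le_sum) auto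
  finally show ?thesis .
qed


section \<open>Summing the increments over dyadic scales\<close>

lemma integral_diff_square_le:
  fixes v w :: "real^'n::finite \<Rightarrow> 'b::euclidean_space"
  assumes v: "square_integrable v" and w: "square_integrable w"
  shows "square_integrable (\<lambda>x. v x - w x)"
    and "(LINT x|lborel. (norm (v x - w x))\<^sup>2) \<le>
      2 * (L2_square v) + 2 * (L2_square w)"
proof -
  show s: "square_integrable (\<lambda>x. v x - w x)"
    using square_integrable_add[OF v square_integrable_scaleR[OF w, of "-1"]] by simp
  have "(norm (a - b))\<^sup>2 \<le> 2 * (norm a)\<^sup>2 + 2 * (norm b)\<^sup>2" for a b :: 'b
  proof -
    have "0 \<le> (norm (a + b))\<^sup>2" by simp
    then show ?thesis
      by (simp add: power2_norm_eq_inner inner_add_left inner_add_right inner_diff_left inner_diff_right inner_commute)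
  qed
  then have "(LINT x|lborel. (norm (v x - w x))\<^sup>2) \<le> (LINT x|lborel. 2 * (norm (v x))\<^sup>2 + 2 * (norm (w x))\<^sup>2)"
    using s v w by (intro integral_mono) (auto simp: square_integrable_def)
  also have "\<dots> = 2 * (L2_square v) + 2 * (L2_square w)"
    using v w by (simp add: square_integrable_def)
  finally show "(LINT x|lborel. (norm (v x - w x))\<^sup>2) \<le>
      2 * (L2_square v) + 2 * (L2_square w)" .
qed

lemma cell_average_square_integrable:
  fixes u :: "real^'n::finite \<Rightarrow> complex" and \<rho> :: real
  assumes S: "sobolev_fun u" and \<rho>: "\<rho> > 0"
  shows "square_integrable (\<lambda>x. u x - cell_average \<rho> u x)"
    and "square_integrable (cell_average \<rho> u)"
    and "(LINT x|lborel. (norm (u x - cell_average \<rho> u x))\<^sup>2) \<le>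
      2 ^ CARD('n) * CARD('n) * \<rho>\<^sup>2 * (L2_square (weak_gradient u))"
proof -
  note u = sobolev_fun_square_integrable[OF S]
  have [measurable]: "u \<in> borel_measurable borel" "cell_average \<rho> u \<in> borel_measurable borel"
    using u \<rho> by (auto intro: square_integrable_measurable cell_average_measurable)
  note e = cell_average_L2_error[OF S \<rho>]
  also have "ennreal x < \<infinity>" for x by simp
  finally show s: "square_integrable (\<lambda>x. u x - cell_average \<rho> u x)"
    unfolding square_integrable_def by (auto intro!: integrableI_bounded)
  show "square_integrable (cell_average \<rho> u)"
    using integral_diff_square_le(1)[OF u s] by simp
  have "0 \<le> (L2_square (weak_gradient u))"
    by (intro Bochner_Integration.integral_nonneg) auto
  then show "(LINT x|lborel. (norm (u x - cell_average \<rho> u x))\<^sup>2) \<le>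
      2 ^ CARD('n) * CARD('n) * \<rho>\<^sup>2 * (L2_square (weak_gradient u))"
    using e unfolding nn_integral_square_integrable[OF s] by (subst (asm) ennreal_le_iff) auto
qed

text \<open>
  The increments of the averages over cells of side \<open>\<rho> / 2 ^ k\<close> are constant on cells, so their sup norm is
  controlled by their \<open>L\<^sup>2\<close> norm, which is at most a multiple of \<open>2 ^ - k\<close>. Interpolation gives decay of
  their \<open>L\<^sup>r\<close> norms like \<open>2 powr (- k * (1 - \<gamma>\<^sub>r))\<close>, which is summable precisely for subcritical \<open>r\<close>.
\<close>
lemma cell_average_Lr_le:
  fixes r :: real
  assumes r: "r > 2" and g: "gam CARD('n::finite) r < 1"
  shows "\<exists>C\<ge>0. \<forall>u :: real^'n \<Rightarrow> complex. \<forall>\<rho>>0. sobolev_fun u \<longrightarrow>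
    (\<integral>\<^sup>+x. ennreal (norm (u x) powr r) \<partial>lborel) \<le>
      ennreal (C * ((L2_square u) + \<rho>\<^sup>2 * (L2_square (weak_gradient u))) powr (r / 2)
        * \<rho> powr (- (r * gam CARD('n) r)))"
proof -
  let ?N = "CARD('n)" and ?g = "gam CARD('n) r"
  have rg: "r * ?g = real ?N * (r - 2) / 2" using r by (simp add: gam_def)
  define c1 :: real where "c1 = 2 ^ ?N * ?N"
  \<comment> \<open>For positive \<open>k\<close> the errors at the levels \<open>k - 1\<close> and
    \<open>k\<close> contribute \<open>8 * c1\<close> and \<open>2 * c1\<close>; at level 0 the
    bound is \<open>2 + 2 * c1\<close>.\<close>
  define c2 where "c2 = 10 * c1 + 2"
  have c1: "c1 \<ge> 0" by (simp add: c1_def)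
  \<comment> \<open>The \<open>r\<close>-th powers of the \<open>L^r\<close> norms of the increments
    decay like \<open>2 powr (- k * r * (1 - ?g))\<close>. The weights \<open>\<beta> ^ k\<close>
    spend half of this rate on the pointwise sum, and the other half is the summable
    \<open>\<beta>' ^ k\<close>.\<close>
  define \<beta> where "\<beta> = 2 powr (- ((1 - ?g) / 2))"
  define \<beta>' where "\<beta>' = 2 powr (- (r * (1 - ?g) / 2))"
  define S where "S = 1 / (1 - \<beta>)"
  have \<beta>: "0 < \<beta>" "\<beta> < 1" using g by (auto simp: \<beta>_def powr_less_one)
  have \<beta>': "0 < \<beta>'" "\<beta>' < 1" using g r by (auto simp: \<beta>'_def powr_less_one)
  have geo: "(\<Sum>k\<le>n. b ^ k) \<le> 1 / (1 - b)" if "0 < b" "b < 1" for b :: real and n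
  proof -
    have "(\<Sum>k\<le>n. b ^ k) \<le> (\<Sum>k. b ^ k)"
      using that by (intro sum_le_suminf summable_geometric) auto
    then show ?thesis using that by (simp add: suminf_geometric)
  qed
  define C where "C = S powr r * (c2 powr (r / 2) * (1 / (1 - \<beta>')))"
  have "(\<integral>\<^sup>+x. ennreal (norm (u x) powr r) \<partial>lborel) \<le>
      ennreal (C * ((L2_square u) + \<rho>\<^sup>2 * (L2_square (weak_gradient u))) powr (r / 2)
        * \<rho> powr (- (r * ?g)))"
    if \<rho>: "\<rho> > 0" and Su: "sobolev_fun u" for u :: "real^'n \<Rightarrow> complex" and \<rho>
  proof -
    let ?X = "L2_square u" and ?T = "L2_square (weak_gradient u)"
    define Y where "Y = ?X + \<rho>\<^sup>2 * ?T"
    have X: "0 \<le> ?X" and T: "0 \<le> ?T" by (intro Bochner_Integration.integral_nonneg; simp)+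
    have Y: "0 \<le> Y" "?X \<le> Y" "\<rho>\<^sup>2 * ?T \<le> Y" using X T by (auto simp: Y_def)
    note u = sobolev_fun_square_integrable[OF Su]
    define p where "p k = \<rho> / 2 ^ k" for k :: nat
    define f where "f k = cell_average (p k) u" for k
    \<comment> \<open>Telescoping increments between consecutive scales; the test for
      \<open>k = 0\<close> keeps the coarsest average, since \<open>k - 1\<close> would be 0 again
      there.\<close>
    define a where "a k x = f k x - (if k = 0 then 0 else f (k - 1) x)" for k x
    have p: "p k > 0" for k using \<rho> by (simp add: p_def)
    have f: "square_integrable (f k)" "square_integrable (\<lambda>x. u x - f k x)" for k
      unfolding f_def by (rule cell_average_square_integrable[OF Su p])+
    have e: "(LINT x|lborel. (norm (u x - f k x))\<^sup>2) \<le> c1 * Y / 4 ^ k" for k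
    proof -
      have "(LINT x|lborel. (norm (u x - f k x))\<^sup>2) \<le> c1 * (p k)\<^sup>2 * ?T"
        unfolding f_def c1_def by (rule cell_average_square_integrable(3)[OF Su p])
      also have "(p k)\<^sup>2 = \<rho>\<^sup>2 / 4 ^ k"
        by (simp add: p_def power_divide power2_eq_square power_mult_distrib[symmetric])
      also have "c1 * (\<rho>\<^sup>2 / 4 ^ k) * ?T = c1 / 4 ^ k * (\<rho>\<^sup>2 * ?T)" by simp
      also have "\<dots> \<le> c1 / 4 ^ k * Y" using Y c1 by (intro mult_left_mono) auto
      finally show ?thesis by simp
    qed
    have a: "square_integrable (a k)" "(L2_square (a k)) \<le> c2 * Y / 4 ^ k" for k
    proof -
      have "square_integrable (a k) \<and> (L2_square (a k)) \<le> c2 * Y / 4 ^ k"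
      proof (cases k)
        case 0
        have "(L2_square (f 0)) \<le> 2 * ?X + 2 * (LINT x|lborel. (norm (u x - f 0 x))\<^sup>2)"
          using integral_diff_square_le(2)[OF u f(2), of 0] by simp
        also have "\<dots> \<le> 2 * Y + 2 * (c1 * Y)" using e[of 0] Y by simp
        also have "\<dots> \<le> c2 * Y" using Y c1 by (simp add: c2_def algebra_simps)
        finally show ?thesis using 0 f(1)[of 0] by (simp add: a_def[abs_def])
      next
        case (Suc j)
        have eq: "a k = (\<lambda>x. (u x - f j x) - (u x - f k x))" by (simp add: a_def[abs_def] Suc)
        have "(L2_square (a k)) \<le> 2 * (LINT x|lborel. (norm (u x - f j x))\<^sup>2) + 2 * (LINT x|lborel. (norm (u x - f k x))\<^sup>2)"
          unfolding eq by (rule integral_diff_square_le(2)[OF f(2) f(2)])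
        also have "\<dots> \<le> 2 * (c1 * Y / 4 ^ j) + 2 * (c1 * Y / 4 ^ k)" using e[of j] e[of k] by linarith
        also have "\<dots> = 10 * c1 * Y / 4 ^ k" by (simp add: Suc field_simps)
        also have "\<dots> \<le> c2 * Y / 4 ^ k" using Y by (intro divide_right_mono mult_right_mono) (auto simp: c2_def)
        finally have "(L2_square (a k)) \<le> c2 * Y / 4 ^ k" .
        moreover have "square_integrable (a k)"
          unfolding eq by (rule integral_diff_square_le(1)[OF f(2) f(2)])
        ultimately show ?thesis by blast
      qed
      then show "square_integrable (a k)" "(L2_square (a k)) \<le> c2 * Y / 4 ^ k" by auto
    qed
    have fsum: "f n x = (\<Sum>k\<le>n. a k x)" for n x
      by (induction n) (auto simp: a_def)
    have const: "a k x = a k y" if "same_cell (p k) x y" for k x y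
    proof (cases k)
      case 0
      then show ?thesis using cell_average_cong[OF that] by (simp add: a_def f_def)
    next
      case (Suc j)
      have "p k = p j / 2" by (simp add: p_def Suc)
      then have "same_cell (p j) x y" using that same_cell_half[of "p j" x y] by (simp only:)
      then show ?thesis
        using cell_average_cong[OF that] cell_average_cong[of "p j" x y] by (simp add: a_def f_def Suc)
    qed
    have D: "0 \<le> c2 * Y" using Y c1 by (simp add: c2_def)
    have Lr: "(\<integral>\<^sup>+x. ennreal ((norm (a k x) / \<beta> ^ k) powr r) \<partial>lborel) \<le>
        ennreal ((c2 * Y) powr (r / 2) * \<rho> powr (- (r * ?g)) * \<beta>' ^ k)" for k
    proof -
      \<comment> \<open>A bound for the square of the \<open>k\<close>-th increment on cells of side
        \<open>p k\<close>. It interpolates with the \<open>L^2\<close> bound through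
        \<open>r = 2 * (r / 2 - 1) + 2\<close>.\<close>
      define B where "B = c2 * Y / 4 ^ k / p k ^ ?N"
      have B0: "0 \<le> B" using D p[of k] by (simp add: B_def)
      have sup: "(norm (a k x))\<^sup>2 \<le> B" for x
      proof -
        have "(norm (a k x))\<^sup>2 \<le> (LINT y|lborel. (norm (a k y))\<^sup>2) / p k ^ ?N"
          by (rule cellwise_constant_le[OF p a(1) const])
        also have "\<dots> \<le> B" unfolding B_def using a(2) p[of k] by (intro divide_right_mono) auto
        finally show ?thesis .
      qed
      have pt: "(norm (a k x) / \<beta> ^ k) powr r \<le> (B powr (r / 2 - 1) * (\<beta> ^ k) powr (- r)) * (norm (a k x))\<^sup>2" for x
      proof (cases "a k x = 0")
        case False
        let ?n = "norm (a k x)"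
        have n: "?n > 0" using False by simp
        have "?n powr r = ?n powr (2 * (r / 2 - 1) + 2)" by simp
        also have "\<dots> = (?n powr 2) powr (r / 2 - 1) * ?n powr 2" by (simp only: powr_add powr_powr)
        also have "?n powr 2 = ?n\<^sup>2" using n by (simp add: powr_numeral)
        also have "(?n\<^sup>2) powr (r / 2 - 1) * ?n\<^sup>2 \<le> B powr (r / 2 - 1) * ?n\<^sup>2"
          using sup r by (intro mult_right_mono powr_mono2) auto
        finally have "?n powr r \<le> B powr (r / 2 - 1) * ?n\<^sup>2" .
        then have "?n powr r * (\<beta> ^ k) powr (- r) \<le> (B powr (r / 2 - 1) * ?n\<^sup>2) * (\<beta> ^ k) powr (- r)"
          by (rule mult_right_mono) simp
        moreover have "(?n / \<beta> ^ k) powr r = ?n powr r * (\<beta> ^ k) powr (- r)"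
          using \<beta> by (simp add: powr_divide powr_minus field_simps)
        ultimately show ?thesis by (simp add: mult_ac)
      qed simp
      have "(\<integral>\<^sup>+x. ennreal ((norm (a k x) / \<beta> ^ k) powr r) \<partial>lborel) \<le>
         (\<integral>\<^sup>+x. ennreal (B powr (r / 2 - 1) * (\<beta> ^ k) powr (- r)) * ennreal ((norm (a k x))\<^sup>2) \<partial>lborel)"
        by (intro nn_integral_mono) (simp add: ennreal_mult[symmetric] ennreal_leI pt)
      also have "\<dots> = ennreal (B powr (r / 2 - 1) * (\<beta> ^ k) powr (- r)) * (\<integral>\<^sup>+x. ennreal ((norm (a k x))\<^sup>2) \<partial>lborel)"
        using square_integrable_measurable[OF a(1), of k] by (intro nn_integral_cmult) auto
      also have "\<dots> = ennreal (B powr (r / 2 - 1) * (\<beta> ^ k) powr (- r)) * ennreal (L2_square (a k))"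
        by (simp only: nn_integral_square_integrable[OF a(1)])
      also have "\<dots> \<le> ennreal (B powr (r / 2 - 1) * (\<beta> ^ k) powr (- r)) * ennreal (c2 * Y / 4 ^ k)"
        by (intro mult_left_mono ennreal_leI a(2)) auto
      also have "\<dots> = ennreal (B powr (r / 2 - 1) * (\<beta> ^ k) powr (- r) * (c2 * Y / 4 ^ k))"
        using D by (subst ennreal_mult) auto
      also have "B powr (r / 2 - 1) * (\<beta> ^ k) powr (- r) * (c2 * Y / 4 ^ k) =
          (c2 * Y) powr (r / 2) * \<rho> powr (- (r * ?g)) * \<beta>' ^ k"
      proof (cases "c2 * Y = 0")
        case False
        with D have D': "c2 * Y > 0" by linarith
        have B': "B = (c2 * Y) * (2 powr (real k * (real ?N - 2)) * \<rho> powr (- real ?N))"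
        proof -
          have 4: "(4::real) ^ k = 2 powr (2 * real k)"
            using powr_realpow[of 2 "2 * k"] by (simp add: power_mult)
          have 2: "((2::real) ^ k) ^ ?N = 2 powr (real k * real ?N)"
            using powr_realpow[of 2 "k * ?N"] by (simp add: power_mult)
          have 3: "\<rho> ^ ?N = \<rho> powr real ?N" using \<rho> by (simp add: powr_realpow)
          have "B = (c2 * Y) * (((2::real) ^ k) ^ ?N / 4 ^ k / \<rho> ^ ?N)"
            by (simp add: B_def p_def power_divide)
          also have "\<dots> = (c2 * Y) * (2 powr (real k * real ?N) / 2 powr (2 * real k) / \<rho> powr real ?N)"
            by (simp only: 4 2 3)
          also have "2 powr (real k * real ?N) / 2 powr (2 * real k) = 2 powr (real k * (real ?N - 2))"
            by (subst powr_diff[symmetric]) (simp add: algebra_simps)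
          finally show ?thesis by (simp add: powr_minus divide_inverse)
        qed
        have "B powr (r / 2 - 1) = (c2 * Y) powr (r / 2 - 1) * (2 powr (real k * (real ?N - 2) * (r / 2 - 1)) * \<rho> powr (- real ?N * (r / 2 - 1)))"
          unfolding B' using D' \<rho> by (simp add: powr_mult powr_powr)
        also have "- real ?N * (r / 2 - 1) = - (r * ?g)"
          unfolding rg by (simp add: field_simps)
        finally have 1: "B powr (r / 2 - 1) = (c2 * Y) powr (r / 2 - 1) * (2 powr (real k * (real ?N - 2) * (r / 2 - 1)) * \<rho> powr (- (r * ?g)))" .
        have 2: "(\<beta> ^ k) powr (- r) = 2 powr (real k * (r * (1 - ?g) / 2))"
        proof -
          have "\<beta> ^ k = 2 powr (- ((1 - ?g) / 2) * real k)"
            using powr_realpow[OF \<beta>(1), of k] by (simp only: \<beta>_def powr_powr)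
          then show ?thesis by (simp only: powr_powr) (rule arg_cong[where f = "\<lambda>e. 2 powr e"], simp add: field_simps)
        qed
        have 3: "c2 * Y / 4 ^ k = (c2 * Y) * 2 powr (- 2 * real k)"
          using powr_realpow[of 2 "2 * k"] by (simp add: power_mult powr_minus divide_inverse)
        have 4: "(c2 * Y) powr (r / 2 - 1) * (c2 * Y) = (c2 * Y) powr (r / 2)"
          using D' powr_mult_base[of "c2 * Y" "r / 2 - 1"] by (simp add: mult.commute)
        \<comment> \<open>Since \<open>N * (r / 2 - 1)\<close> equals \<open>r * ?g\<close>, the
          exponents add up to \<open>k\<close> times
          \<open>(r * ?g - r + 2) + r * (1 - ?g) / 2 - 2\<close>, that is, to
          \<open>- r * (1 - ?g) / 2\<close>. Here subcriticality makes the scale factors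
          decay.\<close>
        have 5: "2 powr (real k * (real ?N - 2) * (r / 2 - 1)) * 2 powr (real k * (r * (1 - ?g) / 2)) * 2 powr (- 2 * real k) = \<beta>' ^ k"
        proof -
          have "real ?N * (r / 2 - 1) = r * ?g" unfolding rg by (simp add: field_simps)
          then have "real k * (real ?N * (r / 2 - 1)) = real k * (r * ?g)" by simp
          then have eq: "real k * (real ?N - 2) * (r / 2 - 1) + real k * (r * (1 - ?g) / 2) + - 2 * real k = - (r * (1 - ?g) / 2) * real k"
            by (simp add: field_simps)
          have "\<beta>' ^ k = 2 powr (- (r * (1 - ?g) / 2) * real k)"
            using powr_realpow[OF \<beta>'(1), of k] by (simp only: \<beta>'_def powr_powr)
          then show ?thesis by (simp only: powr_add[symmetric] eq)
        qed
        have "B powr (r / 2 - 1) * (\<beta> ^ k) powr (- r) * (c2 * Y / 4 ^ k) =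
            ((c2 * Y) powr (r / 2 - 1) * (c2 * Y)) * \<rho> powr (- (r * ?g)) *
            (2 powr (real k * (real ?N - 2) * (r / 2 - 1)) * 2 powr (real k * (r * (1 - ?g) / 2)) * 2 powr (- 2 * real k))"
          unfolding 1 2 3 by (simp only: mult_ac)
        then show ?thesis by (simp only: 4 5)
      qed (use r in auto)
      finally show ?thesis .
    qed
    define Z where "Z = (c2 * Y) powr (r / 2) * \<rho> powr (- (r * ?g))"
    have Z: "Z \<ge> 0" by (simp add: Z_def)
    have fn: "(\<integral>\<^sup>+x. ennreal (norm (f n x) powr r) \<partial>lborel) \<le> ennreal (S powr r * (Z * (1 / (1 - \<beta>'))))" for n
    proof -
      have [measurable]: "a k \<in> borel_measurable borel" for k using a(1) by (rule square_integrable_measurable)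
      have "(\<integral>\<^sup>+x. ennreal (norm (f n x) powr r) \<partial>lborel) \<le>
        (\<integral>\<^sup>+x. ennreal (S powr r) * (\<Sum>k\<le>n. ennreal ((norm (a k x) / \<beta> ^ k) powr r)) \<partial>lborel)"
      proof (rule nn_integral_mono)
        fix x
        have "norm (f n x) powr r \<le> S powr r * (\<Sum>k\<le>n. (norm (a k x) / \<beta> ^ k) powr r)"
          unfolding fsum by (rule sum_powr_weighted_le) (use \<beta> r geo[OF \<beta>] in \<open>auto simp: S_def\<close>)
        then show "ennreal (norm (f n x) powr r) \<le> ennreal (S powr r) * (\<Sum>k\<le>n. ennreal ((norm (a k x) / \<beta> ^ k) powr r))"
          by (subst sum_ennreal) (auto simp: ennreal_mult[symmetric] sum_nonneg ennreal_leI)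
      qed
      also have "\<dots> = ennreal (S powr r) * (\<Sum>k\<le>n. \<integral>\<^sup>+x. ennreal ((norm (a k x) / \<beta> ^ k) powr r) \<partial>lborel)"
        by (subst nn_integral_cmult, measurable, subst nn_integral_sum) auto
      also have "\<dots> \<le> ennreal (S powr r) * (\<Sum>k\<le>n. ennreal (Z * \<beta>' ^ k))"
        unfolding Z_def by (intro mult_left_mono sum_mono Lr) auto
      also have "(\<Sum>k\<le>n. ennreal (Z * \<beta>' ^ k)) = ennreal (Z * (\<Sum>k\<le>n. \<beta>' ^ k))"
        using Z \<beta>' by (subst sum_ennreal) (auto simp: sum_distrib_left)
      also have "ennreal (S powr r) * \<dots> \<le> ennreal (S powr r) * ennreal (Z * (1 / (1 - \<beta>')))"
        using Z geo[OF \<beta>'] by (intro mult_left_mono ennreal_leI) auto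
      also have "\<dots> = ennreal (S powr r * (Z * (1 / (1 - \<beta>'))))"
        using Z \<beta>' by (subst ennreal_mult) auto
      finally show ?thesis .
    qed
    have [measurable]: "u \<in> borel_measurable borel" "f k \<in> borel_measurable borel" for k
      using u f(1) by (auto intro: square_integrable_measurable)
    \<comment> \<open>The \<open>L^2\<close> errors are summable over the scales, so the averages
      converge almost everywhere along the full sequence.\<close>
    have lim: "AE x in lborel. (\<lambda>n. f n x) \<longlonglongrightarrow> u x"
    proof -
      have "(\<integral>\<^sup>+x. (\<Sum>n. ennreal ((norm (u x - f n x))\<^sup>2)) \<partial>lborel) = (\<Sum>n. \<integral>\<^sup>+x. ennreal ((norm (u x - f n x))\<^sup>2) \<partial>lborel)"
        by (rule nn_integral_suminf) measurable
      also have "\<dots> \<le> (\<Sum>n. ennreal (c1 * Y * (1 / 4) ^ n))"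
        using e by (intro suminf_le) (auto simp: nn_integral_square_integrable[OF f(2)] power_divide intro!: ennreal_leI)
      also have "\<dots> < \<infinity>"
      proof -
        have "summable (\<lambda>n. c1 * Y * (1 / 4) ^ n)" by (intro summable_mult summable_geometric) auto
        then show ?thesis using c1 Y by (simp add: ennreal_suminf_neq_top less_top[symmetric])
      qed
      finally have "(\<integral>\<^sup>+x. (\<Sum>n. ennreal ((norm (u x - f n x))\<^sup>2)) \<partial>lborel) \<noteq> \<infinity>"
        by simp
      then have "AE x in lborel. (\<Sum>n. ennreal ((norm (u x - f n x))\<^sup>2)) \<noteq> \<infinity>"
        by (intro nn_integral_PInf_AE) measurable
      then show ?thesis
      proof eventually_elim
        case (elim x)
        then have "summable (\<lambda>n. (norm (u x - f n x))\<^sup>2)"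
          by (intro summable_suminf_not_top) auto
        then have "(\<lambda>n. sqrt ((norm (u x - f n x))\<^sup>2)) \<longlonglongrightarrow> sqrt 0"
          by (intro tendsto_real_sqrt summable_LIMSEQ_zero)
        then have "(\<lambda>n. norm (f n x - u x)) \<longlonglongrightarrow> 0"
          by (simp only: norm_minus_commute[of "u x"] real_sqrt_abs real_sqrt_zero abs_norm_cancel)
        then show ?case by (rule LIM_zero_cancel[OF tendsto_norm_zero_cancel])
      qed
    qed
    \<comment> \<open>The bound is uniform in \<open>n\<close> and the convergence is only
      pointwise, so it passes to \<open>u\<close> by Fatou's lemma.\<close>
    have "(\<integral>\<^sup>+x. ennreal (norm (u x) powr r) \<partial>lborel) = (\<integral>\<^sup>+x. liminf (\<lambda>n. ennreal (norm (f n x) powr r)) \<partial>lborel)"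
    proof (rule nn_integral_cong_AE)
      show "AE x in lborel. ennreal (norm (u x) powr r) = liminf (\<lambda>n. ennreal (norm (f n x) powr r))"
        using lim
      proof eventually_elim
        case (elim x)
        have "(\<lambda>n. ennreal (norm (f n x) powr r)) \<longlonglongrightarrow> ennreal (norm (u x) powr r)"
          by (intro tendsto_ennrealI tendsto_powr' tendsto_norm elim tendsto_const) (use r in auto)
        then show ?case by (intro lim_imp_Liminf[symmetric]) simp_all
      qed
    qed
    also have "\<dots> \<le> liminf (\<lambda>n. \<integral>\<^sup>+x. ennreal (norm (f n x) powr r) \<partial>lborel)"
      by (rule nn_integral_liminf) measurable
    also have "\<dots> \<le> limsup (\<lambda>n. \<integral>\<^sup>+x. ennreal (norm (f n x) powr r) \<partial>lborel)"
      by (rule Liminf_le_Limsup) simp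
    also have "\<dots> \<le> ennreal (S powr r * (Z * (1 / (1 - \<beta>'))))"
      by (intro Limsup_bounded always_eventually allI fn)
    also have "S powr r * (Z * (1 / (1 - \<beta>'))) = C * Y powr (r / 2) * \<rho> powr (- (r * ?g))"
    proof -
      have pw: "(c2 * Y) powr (r / 2) = c2 powr (r / 2) * Y powr (r / 2)"
        using Y c1 by (subst powr_mult) (auto simp: c2_def)
      show ?thesis unfolding C_def Z_def pw by (simp only: mult_ac)
    qed
    finally show ?thesis by (simp only: Y_def)
  qed
  moreover have "C \<ge> 0" using \<beta>' by (simp add: C_def)
  ultimately show ?thesis by blast
qed

text \<open>Scale invariance is recovered by optimising the cell size:
  \<open>\<rho>\<^sup>2 = ?X / ?T\<close> balances the two terms. The left side is a nonnegative
  integral, so membership in \<open>L^r\<close> is part of the conclusion.\<close>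

theorem gagliardo_nirenberg_nn:
  fixes r :: real
  assumes r: "r > 2" and g: "gam CARD('n::finite) r < 1"
  shows "\<exists>C\<ge>0. \<forall>u :: real^'n \<Rightarrow> complex. sobolev_fun u \<longrightarrow>
    (\<integral>\<^sup>+x. ennreal (norm (u x) powr r) \<partial>lborel) \<le>
      ennreal (C * (L2_square (weak_gradient u)) powr (r * gam CARD('n) r / 2)
        * (L2_square u) powr (r * (1 - gam CARD('n) r) / 2))"
proof -
  let ?g = "gam CARD('n) r"
  have g0: "?g > 0" using r by (simp add: gam_def)
  obtain C where C: "C \<ge> 0" and le: "\<And>u :: real^'n \<Rightarrow> complex. \<And>\<rho>. \<rho> > 0 \<Longrightarrow> sobolev_fun u \<Longrightarrow>
    (\<integral>\<^sup>+x. ennreal (norm (u x) powr r) \<partial>lborel) \<le>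
      ennreal (C * ((L2_square u) + \<rho>\<^sup>2 * (L2_square (weak_gradient u))) powr (r / 2)
        * \<rho> powr (- (r * ?g)))"
    using cell_average_Lr_le[OF r g] by blast
  have "(\<integral>\<^sup>+x. ennreal (norm (u x) powr r) \<partial>lborel) \<le>
      ennreal (C * 2 powr (r / 2) * (L2_square (weak_gradient u)) powr (r * ?g / 2)
        * (L2_square u) powr (r * (1 - ?g) / 2))"
    if S: "sobolev_fun u" for u :: "real^'n \<Rightarrow> complex"
  proof -
    let ?X = "L2_square u" and ?T = "L2_square (weak_gradient u)"
    have X: "0 \<le> ?X" and T: "0 \<le> ?T" by (intro Bochner_Integration.integral_nonneg; simp)+
    note u = sobolev_fun_square_integrable[OF S]
    consider "?X = 0" | "?T = 0" "?X > 0" | "?X > 0" "?T > 0" using X T by linarith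
    then show ?thesis
    proof cases
      case 1
      have "AE x in lborel. u x = 0"
        using 1 u by (subst (asm) integral_nonneg_eq_0_iff_AE) (auto simp: square_integrable_def)
      then have "(\<integral>\<^sup>+x. ennreal (norm (u x) powr r) \<partial>lborel) = (\<integral>\<^sup>+x. 0 \<partial>(lborel :: (real^'n) measure))"
        by (intro nn_integral_cong_AE) (auto elim!: eventually_mono)
      then show ?thesis by simp
    next
      \<comment> \<open>A vanishing gradient norm admits arbitrarily large cells, and the negative
        power of \<open>\<rho>\<close> forces the left side to be 0. The right side is 0 too, since
        \<open>powr\<close> with base 0 is 0.\<close>
      case 2
      have lim: "((\<lambda>\<rho>. C * ?X powr (r / 2) * \<rho> powr (- (r * ?g))) \<longlongrightarrow> C * ?X powr (r / 2) * 0) at_top"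
        using g0 r by (intro tendsto_mult tendsto_const tendsto_neg_powr filterlim_ident) auto
      have "eventually (\<lambda>\<rho>. (\<integral>\<^sup>+x. ennreal (norm (u x) powr r) \<partial>lborel) \<le> ennreal (C * ?X powr (r / 2) * \<rho> powr (- (r * ?g)))) at_top"
        using eventually_gt_at_top[of 0]
        by eventually_elim (use le[OF _ S] 2 in simp)
      from tendsto_le[OF _ tendsto_ennrealI[OF lim] tendsto_const this]
      show ?thesis by simp
    next
      case 3
      define \<rho> where "\<rho> = sqrt (?X / ?T)"
      have \<rho>: "\<rho> > 0" "\<rho>\<^sup>2 = ?X / ?T" using 3 by (auto simp: \<rho>_def)
      have "?X + \<rho>\<^sup>2 * ?T = 2 * ?X" using 3 by (simp add: \<rho>)
      moreover have "(2 * ?X) powr (r / 2) = 2 powr (r / 2) * ?X powr (r / 2)" using 3 by (simp add: powr_mult)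
      moreover have "\<rho> powr (- (r * ?g)) = ?X powr (- (r * ?g) / 2) * ?T powr (r * ?g / 2)"
      proof -
        have "\<rho> = (?X / ?T) powr (1 / 2)" using 3 by (simp add: \<rho>_def powr_half_sqrt)
        then have "\<rho> powr (- (r * ?g)) = (?X / ?T) powr (- (r * ?g) / 2)" by (simp add: powr_powr)
        also have "\<dots> = ?X powr (- (r * ?g) / 2) / ?T powr (- (r * ?g / 2))"
          using X T by (subst powr_divide) simp_all
        also have "\<dots> = ?X powr (- (r * ?g) / 2) * ?T powr (r * ?g / 2)"
          by (simp only: powr_minus divide_inverse inverse_inverse_eq)
        finally show ?thesis .
      qed
      ultimately have "C * (?X + \<rho>\<^sup>2 * ?T) powr (r / 2) * \<rho> powr (- (r * ?g)) =
        C * (2 powr (r / 2) * ?X powr (r / 2)) * (?X powr (- (r * ?g) / 2) * ?T powr (r * ?g / 2))"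
        by (simp only:)
      also have "\<dots> = C * 2 powr (r / 2) * ?T powr (r * ?g / 2) * (?X powr (r / 2) * ?X powr (- (r * ?g) / 2))"
        by (simp only: mult_ac)
      also have "?X powr (r / 2) * ?X powr (- (r * ?g) / 2) = ?X powr (r * (1 - ?g) / 2)"
        by (subst powr_add[symmetric]) (rule arg_cong[where f = "\<lambda>e. ?X powr e"], simp add: field_simps)
      finally have "C * (?X + \<rho>\<^sup>2 * ?T) powr (r / 2) * \<rho> powr (- (r * ?g)) =
        C * 2 powr (r / 2) * ?T powr (r * ?g / 2) * ?X powr (r * (1 - ?g) / 2)" .
      then show ?thesis using le[OF \<rho>(1) S] by (simp only:)
    qed
  qed
  moreover have "C * 2 powr (r / 2) \<ge> 0" using C by simp
  ultimately show ?thesis by blast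
qed

section \<open>Powers in the Sobolev space\<close>

lemma powr_diff_mult_le:
  fixes A B s :: real
  assumes "0 \<le> B" "B \<le> A" and s: "s > 0"
  shows "(A powr s - B powr s) * B \<le> s * A powr s * (A - B)"
proof (cases "B = 0 \<or> A = B")
  case True
  then show ?thesis using assms by auto
next
  case False
  then have "0 < B" "B < A" using assms by auto
  have d: "((\<lambda>x. x powr s) has_real_derivative s * x powr (s - 1)) (at x)" if "B \<le> x" for x
    using that \<open>0 < B\<close> by (intro has_real_derivative_powr) auto
  obtain z where z: "B < z" "z < A" "A powr s - B powr s = (A - B) * (s * z powr (s - 1))"
    using MVT2[OF \<open>B < A\<close> d] by blast
  \<comment> \<open>For \<open>s < 1\<close> the factor \<open>z powr (s - 1)\<close> is unbounded
    near 0; the extra factor \<open>B\<close>, which is below \<open>z\<close>, compensates for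
    this.\<close>
  have "z powr (s - 1) * B \<le> z powr (s - 1) * z" using z by (intro mult_left_mono) auto
  also have "\<dots> = z powr s" using z \<open>0 < B\<close> powr_mult_base[of z "s - 1"] by (simp add: mult.commute)
  also have "\<dots> \<le> A powr s" using z \<open>0 < B\<close> s by (intro powr_mono2) auto
  finally have "(A - B) * s * (z powr (s - 1) * B) \<le> (A - B) * s * A powr s"
    using \<open>B < A\<close> s by (intro mult_left_mono) auto
  then show ?thesis using z by (simp add: mult_ac)
qed

text \<open>With \<open>a\<close> the longer vector, the difference splits as
  \<open>|a|^s (a - b)\<close> plus \<open>(|a|^s - |b|^s) b\<close>; thus the difference of the
  powers is multiplied by the shorter vector, as the preceding estimate requires.\<close>

lemma norm_powr_scaleR_diff_le:
  fixes a b :: "'a::real_inner"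
  assumes s: "s > 0"
  shows "norm (norm a powr s *\<^sub>R a - norm b powr s *\<^sub>R b) \<le> (1 + s) * (norm a powr s + norm b powr s) * norm (a - b)"
proof -
  have *: "norm (norm a powr s *\<^sub>R a - norm b powr s *\<^sub>R b) \<le> (1 + s) * norm a powr s * norm (a - b)"
    if "norm b \<le> norm a" for a b :: 'a
  proof -
    have m: "norm b powr s \<le> norm a powr s" using that s by (intro powr_mono2) auto
    have "norm a powr s *\<^sub>R a - norm b powr s *\<^sub>R b = norm a powr s *\<^sub>R (a - b) + (norm a powr s - norm b powr s) *\<^sub>R b"
      by (simp add: algebra_simps)
    also have "norm \<dots> \<le> norm a powr s * norm (a - b) + (norm a powr s - norm b powr s) * norm b"
      using m by (intro order_trans[OF norm_triangle_ineq]) auto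
    also have "(norm a powr s - norm b powr s) * norm b \<le> s * norm a powr s * (norm a - norm b)"
      by (rule powr_diff_mult_le) (use that s in auto)
    also have "\<dots> \<le> s * norm a powr s * norm (a - b)"
      using s by (intro mult_left_mono norm_triangle_ineq2) auto
    finally show ?thesis by (simp add: algebra_simps)
  qed
  have mono: "(1 + s) * c * norm (a - b) \<le> (1 + s) * (norm a powr s + norm b powr s) * norm (a - b)"
    if "c \<le> norm a powr s + norm b powr s" for c
    using that s by (intro mult_right_mono mult_left_mono) auto
  show ?thesis
  proof (cases "norm b \<le> norm a")
    case True
    then show ?thesis using *[OF True] mono[of "norm a powr s"] by simp
  next
    case False
    then show ?thesis
      using *[of a b] mono[of "norm b powr s"] by (simp add: norm_minus_commute)
  qed
qed

text \<open>Convexity of the \<open>r\<close>-th power of the norm: the tangent at \<open>a\<close>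
  stays below the graph. It is read off from Young's inequality with the exponents
  \<open>r / (r - 1)\<close> and \<open>r\<close>.\<close>

lemma young_powr_inner:
  fixes a b :: "'a::real_inner"
  assumes r: "r > 2"
  shows "r * (norm a powr (r - 2) * (a \<bullet> (b - a))) \<le> norm b powr r - norm a powr r"
proof (cases "a = 0")
  case True
  then show ?thesis by simp
next
  case False
  have aa: "norm a powr (r - 2) * norm a * norm a = norm a powr r"
    using False powr_mult_base[of "norm a" "r - 2"] powr_mult_base[of "norm a" "r - 1"]
    by (simp add: mult_ac)
  have a1: "norm a powr (r - 2) * norm a = norm a powr (r - 1)"
    using False powr_mult_base[of "norm a" "r - 2"] by (simp add: mult_ac)
  have "norm a powr (r - 1) * norm b \<le> (norm a powr (r - 1)) powr (r / (r - 1)) / (r / (r - 1)) + norm b powr r / r"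
    by (rule Youngs_inequality) (use r in \<open>auto simp: field_simps\<close>)
  also have "(norm a powr (r - 1)) powr (r / (r - 1)) = norm a powr r" using r by (simp add: powr_powr)
  finally have "r * (norm a powr (r - 1) * norm b) \<le> r * (norm a powr r / (r / (r - 1)) + norm b powr r / r)"
    using r by (intro mult_left_mono) auto
  also have "\<dots> = (r - 1) * norm a powr r + norm b powr r" using r by (simp add: field_simps)
  finally have y: "r * (norm a powr (r - 1) * norm b) \<le> (r - 1) * norm a powr r + norm b powr r" .
  have "norm a powr (r - 2) * (a \<bullet> b) \<le> norm a powr (r - 2) * (norm a * norm b)"
    by (intro mult_left_mono norm_cauchy_schwarz) auto
  also have "\<dots> = norm a powr (r - 1) * norm b" by (simp add: a1[symmetric] mult_ac)
  finally have "r * (norm a powr (r - 2) * (a \<bullet> b)) \<le> r * (norm a powr (r - 1) * norm b)"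
    using r by (intro mult_left_mono) auto
  with y have "r * (norm a powr (r - 2) * (a \<bullet> b)) \<le> (r - 1) * norm a powr r + norm b powr r"
    by linarith
  moreover have "norm a powr (r - 2) * (a \<bullet> a) = norm a powr r"
    using aa by (simp add: power2_norm_eq_inner[symmetric] power2_eq_square mult_ac)
  ultimately show ?thesis by (simp add: inner_diff_right algebra_simps)
qed

text \<open>Convexity at \<open>a\<close> makes the remainder nonnegative, and convexity at
  \<open>b\<close> bounds it by the pairing of the increment of the gradient with
  \<open>b - a\<close>. The Lipschitz estimate for the gradient makes this quadratic.\<close>

lemma norm_powr_taylor:
  fixes a b :: "'a::real_inner"
  assumes r: "r > 2"
  shows "\<bar>norm b powr r - norm a powr r - r * (norm a powr (r - 2) * (a \<bullet> (b - a)))\<bar>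
    \<le> r * (r - 1) * (norm a powr (r - 2) + norm b powr (r - 2)) * (norm (b - a))\<^sup>2"
proof -
  let ?W = "norm a powr (r - 2) + norm b powr (r - 2)"
  have 1: "0 \<le> norm b powr r - norm a powr r - r * (norm a powr (r - 2) * (a \<bullet> (b - a)))"
    using young_powr_inner[OF r, of a b] by simp
  have "norm b powr r - norm a powr r - r * (norm a powr (r - 2) * (a \<bullet> (b - a))) \<le>
      r * ((norm b powr (r - 2) *\<^sub>R b - norm a powr (r - 2) *\<^sub>R a) \<bullet> (b - a))"
    using young_powr_inner[OF r, of b a] by (simp add: inner_diff_left inner_diff_right algebra_simps)
  also have "\<dots> \<le> r * (norm (norm b powr (r - 2) *\<^sub>R b - norm a powr (r - 2) *\<^sub>R a) * norm (b - a))"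
    using r by (intro mult_left_mono norm_cauchy_schwarz) auto
  also have "\<dots> \<le> r * ((1 + (r - 2)) * (norm b powr (r - 2) + norm a powr (r - 2)) * norm (b - a) * norm (b - a))"
    using r by (intro mult_left_mono mult_right_mono norm_powr_scaleR_diff_le) auto
  finally show ?thesis using 1 by (simp add: power2_eq_square algebra_simps)
qed

text \<open>Twice the right side equals \<open>(?A + ?B) * (norm (a - b))\<^sup>2\<close> plus
  \<open>(?A - ?B) * ((norm a)\<^sup>2 - (norm b)\<^sup>2)\<close>, and the last product is
  nonnegative because powers are increasing.\<close>

lemma norm_powr_monotone:
  fixes a b :: "'a::real_inner"
  assumes s: "s > 0"
  shows "(norm a powr s + norm b powr s) / 2 * (norm (a - b))\<^sup>2 \<le>
     (norm a powr s *\<^sub>R a - norm b powr s *\<^sub>R b) \<bullet> (a - b)"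
proof -
  let ?A = "norm a powr s" and ?B = "norm b powr s"
  have "0 \<le> (?A - ?B) * ((norm a)\<^sup>2 - (norm b)\<^sup>2)"
  proof (cases "norm a \<le> norm b")
    case True
    then show ?thesis using s by (intro mult_nonpos_nonpos) (auto intro!: powr_mono2 power_mono)
  next
    case False
    then show ?thesis using s by (intro mult_nonneg_nonneg) (auto intro!: powr_mono2 power_mono)
  qed
  moreover have "2 * ((?A *\<^sub>R a - ?B *\<^sub>R b) \<bullet> (a - b)) = (?A + ?B) * (norm (a - b))\<^sup>2 + (?A - ?B) * ((norm a)\<^sup>2 - (norm b)\<^sup>2)"
    by (simp add: power2_norm_eq_inner inner_diff_left inner_diff_right inner_commute[of b a] algebra_simps)
  moreover have "(?A + ?B) / 2 * (norm (a - b))\<^sup>2 = ((?A + ?B) * (norm (a - b))\<^sup>2) / 2" by simp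
  ultimately show ?thesis by linarith
qed

section \<open>Integrals of three factors in \<open>L^r\<close>\<close>

lemma powr_mult_le_sum:
  fixes x y z r :: real
  assumes "0 \<le> x" "0 \<le> y" "0 \<le> z" "r > 2"
  shows "x powr (r - 2) * y * z \<le> x powr r + y powr r + z powr r"
proof -
  define m where "m = max x (max y z)"
  have m: "x \<le> m" "y \<le> m" "z \<le> m" "0 \<le> m" using assms by (auto simp: m_def)
  have "x powr (r - 2) * y * z \<le> m powr (r - 2) * m * m"
    using m assms by (intro mult_mono powr_mono2) auto
  also have "\<dots> = m powr r"
  proof (cases "m = 0")
    case False
    then show ?thesis
      using m powr_mult_base[of m "r - 2"] powr_mult_base[of m "r - 1"] by (simp add: mult_ac)
  qed (use assms in simp)
  also have "\<dots> \<le> x powr r + y powr r + z powr r"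
    unfolding m_def max_def by auto
  finally show ?thesis .
qed

lemma Lnorm_nonneg [simp]: "0 \<le> Lnorm r f"
  by (simp add: Lnorm_def)

lemma Lnorm_powr:
  assumes "r \<noteq> 0"
  shows "Lnorm r f powr r = (LINT x|lborel. norm (f x) powr r)"
proof -
  have "0 \<le> (LINT x|lborel. norm (f x) powr r)" by (intro Bochner_Integration.integral_nonneg) auto
  then show ?thesis using assms by (simp add: Lnorm_def powr_powr)
qed

lemma trilinear_integrable:
  fixes u :: "real^'n::finite \<Rightarrow> 'a::euclidean_space" and v :: "real^'n \<Rightarrow> 'b::euclidean_space" and w :: "real^'n \<Rightarrow> 'c::euclidean_space"
  assumes r: "r > 2"
    and [measurable]: "u \<in> borel_measurable borel" "v \<in> borel_measurable borel" "w \<in> borel_measurable borel"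
    and int: "integrable lborel (\<lambda>x. norm (u x) powr r)" "integrable lborel (\<lambda>x. norm (v x) powr r)"
      "integrable lborel (\<lambda>x. norm (w x) powr r)"
  shows "integrable lborel (\<lambda>x. norm (u x) powr (r - 2) * norm (v x) * norm (w x))"
proof (rule Bochner_Integration.integrable_bound)
  show "integrable lborel (\<lambda>x. norm (u x) powr r + norm (v x) powr r + norm (w x) powr r)"
    using int by auto
  show "AE x in lborel. norm (norm (u x) powr (r - 2) * norm (v x) * norm (w x)) \<le> norm (norm (u x) powr r + norm (v x) powr r + norm (w x) powr r)"
    using powr_mult_le_sum[OF _ _ _ r] by (intro AE_I2) simp
qed measurable

lemma Lnorm_eq_0:
  assumes "Lnorm r f = 0" "integrable lborel (\<lambda>x. norm (f x) powr r)"
  shows "AE x in lborel. f x = 0"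
proof -
  have "(LINT x|lborel. norm (f x) powr r) = 0" using assms(1) by (simp add: Lnorm_def)
  then show ?thesis
    using assms(2) by (subst (asm) integral_nonneg_eq_0_iff_AE) auto
qed

text \<open>Hoelder's inequality with exponents \<open>r / (r - 2)\<close>, \<open>r\<close>,
  \<open>r\<close> up to the factor 3: once each function is normalised, the pointwise bound by the
  sum of three powers integrates to 3.\<close>

lemma trilinear_le:
  fixes u :: "real^'n::finite \<Rightarrow> 'a::euclidean_space" and v :: "real^'n \<Rightarrow> 'b::euclidean_space" and w :: "real^'n \<Rightarrow> 'c::euclidean_space"
  assumes r: "r > 2"
    and m [measurable]: "u \<in> borel_measurable borel" "v \<in> borel_measurable borel" "w \<in> borel_measurable borel"
    and int: "integrable lborel (\<lambda>x. norm (u x) powr r)" "integrable lborel (\<lambda>x. norm (v x) powr r)"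
      "integrable lborel (\<lambda>x. norm (w x) powr r)"
  shows "(LINT x|lborel. norm (u x) powr (r - 2) * norm (v x) * norm (w x)) \<le>
    3 * Lnorm r u powr (r - 2) * Lnorm r v * Lnorm r w"
proof (cases "Lnorm r u = 0 \<or> Lnorm r v = 0 \<or> Lnorm r w = 0")
  case True
  then have "AE x in lborel. norm (u x) powr (r - 2) * norm (v x) * norm (w x) = 0"
    using Lnorm_eq_0[OF _ int(1)] Lnorm_eq_0[OF _ int(2)] Lnorm_eq_0[OF _ int(3)]
    by (elim disjE) (auto elim!: eventually_mono)
  then have "(LINT x|lborel. norm (u x) powr (r - 2) * norm (v x) * norm (w x)) = 0"
    by (simp add: integral_eq_zero_AE)
  then show ?thesis by simp
next
  case False
  let ?U = "Lnorm r u" and ?V = "Lnorm r v" and ?W = "Lnorm r w"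
  have pos: "?U > 0" "?V > 0" "?W > 0"
    using False Lnorm_nonneg[of r u] Lnorm_nonneg[of r v] Lnorm_nonneg[of r w] by linarith+
  have r0: "r \<noteq> 0" using r by simp
  have "(LINT x|lborel. norm (u x) powr (r - 2) * norm (v x) * norm (w x)) / (?U powr (r - 2) * ?V * ?W) =
     (LINT x|lborel. (norm (u x) powr (r - 2) * norm (v x) * norm (w x)) / (?U powr (r - 2) * ?V * ?W))"
    by simp
  also have "\<dots> \<le> (LINT x|lborel. norm (u x) powr r / ?U powr r + norm (v x) powr r / ?V powr r + norm (w x) powr r / ?W powr r)"
  proof (rule integral_mono)
    show "integrable lborel (\<lambda>x. (norm (u x) powr (r - 2) * norm (v x) * norm (w x)) / (?U powr (r - 2) * ?V * ?W))"
      using trilinear_integrable[OF r m int] by simp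
    show "integrable lborel (\<lambda>x. norm (u x) powr r / ?U powr r + norm (v x) powr r / ?V powr r + norm (w x) powr r / ?W powr r)"
      using int by simp
    fix x
    have "(norm (u x) powr (r - 2) * norm (v x) * norm (w x)) / (?U powr (r - 2) * ?V * ?W) =
       (norm (u x) / ?U) powr (r - 2) * (norm (v x) / ?V) * (norm (w x) / ?W)"
      using pos by (simp add: powr_divide)
    also have "\<dots> \<le> (norm (u x) / ?U) powr r + (norm (v x) / ?V) powr r + (norm (w x) / ?W) powr r"
      by (rule powr_mult_le_sum) (use r in auto)
    finally show "(norm (u x) powr (r - 2) * norm (v x) * norm (w x)) / (?U powr (r - 2) * ?V * ?W) \<le>
      norm (u x) powr r / ?U powr r + norm (v x) powr r / ?V powr r + norm (w x) powr r / ?W powr r"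
      using pos by (simp add: powr_divide)
  qed
  also have "\<dots> = ?U powr r / ?U powr r + ?V powr r / ?V powr r + ?W powr r / ?W powr r"
    using int by (simp add: Lnorm_powr[OF r0])
  also have "\<dots> = 3" using pos by simp
  finally show ?thesis using pos by (simp add: field_simps)
qed

section \<open>Representatives of Sobolev classes\<close>

lemma h1_sobolev: "sobolev_fun (rep_h1 u)"
  using Quotient_rep_reflp[OF Quotient_h1, of u] by simp

lemma h1_square_integrable: "square_integrable (rep_h1 u)" "square_integrable (h1_grad u)"
  unfolding h1_grad_def
  by (rule sobolev_fun_square_integrable weak_gradient(1), rule h1_sobolev)+

lemma h1_measurable [measurable]: "rep_h1 u \<in> borel_measurable borel" "h1_grad u \<in> borel_measurable borel"
  by (rule square_integrable_measurable h1_square_integrable)+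

text \<open>The representative chosen by \<open>rep_h1\<close> is arbitrary in its class, which is
  why the pointwise identities below hold only almost everywhere.\<close>

lemma abs_h1_AE:
  assumes "sobolev_fun v"
  shows "AE x in lborel. rep_h1 (abs_h1 v) x = v x"
    and "AE x in lborel. h1_grad (abs_h1 v) x = weak_gradient v x"
proof -
  have "sobolev_fun (rep_h1 (abs_h1 v)) \<and> sobolev_fun v \<and> (AE x in lborel. rep_h1 (abs_h1 v) x = v x)"
    using Quotient_rep_abs[OF Quotient_h1, of v] assms by simp
  then show *: "AE x in lborel. rep_h1 (abs_h1 v) x = v x" by blast
  show "AE x in lborel. h1_grad (abs_h1 v) x = weak_gradient v x"
    unfolding h1_grad_def by (rule weak_gradient_cong[OF h1_sobolev assms *])
qed

lemma h1_add_AE: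
  shows "AE x in lborel. rep_h1 (u + v) x = rep_h1 u x + rep_h1 v x"
    and "AE x in lborel. h1_grad (u + v) x = h1_grad u x + h1_grad v x"
proof -
  have eq: "u + v = abs_h1 (\<lambda>x. rep_h1 u x + rep_h1 v x)" by (simp add: plus_h1_def map_fun_def)
  note * = abs_h1_AE[OF sobolev_fun_add[OF h1_sobolev h1_sobolev], of u v]
  show "AE x in lborel. rep_h1 (u + v) x = rep_h1 u x + rep_h1 v x" unfolding eq by (rule *)
  show "AE x in lborel. h1_grad (u + v) x = h1_grad u x + h1_grad v x"
    using *(2) weak_gradient_add_AE[OF h1_sobolev h1_sobolev, of u v]
    unfolding eq by eventually_elim (simp add: h1_grad_def)
qed

lemma h1_scaleR_AE:
  shows "AE x in lborel. rep_h1 (c *\<^sub>R u) x = c *\<^sub>R rep_h1 u x"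
    and "AE x in lborel. h1_grad (c *\<^sub>R u) x = c *\<^sub>R h1_grad u x"
proof -
  have eq: "c *\<^sub>R u = abs_h1 (\<lambda>x. c *\<^sub>R rep_h1 u x)" by (simp add: scaleR_h1_def map_fun_def)
  note * = abs_h1_AE[OF sobolev_fun_scaleR[OF h1_sobolev], of c u]
  show "AE x in lborel. rep_h1 (c *\<^sub>R u) x = c *\<^sub>R rep_h1 u x" unfolding eq by (rule *)
  show "AE x in lborel. h1_grad (c *\<^sub>R u) x = c *\<^sub>R h1_grad u x"
    using *(2) weak_gradient_scaleR_AE[OF h1_sobolev, of c u]
    unfolding eq by eventually_elim (simp add: h1_grad_def)
qed

lemma h1_diff_AE:
  shows "AE x in lborel. rep_h1 (u - v) x = rep_h1 u x - rep_h1 v x"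
    and "AE x in lborel. h1_grad (u - v) x = h1_grad u x - h1_grad v x"
proof -
  have eq: "u - v = u + (- 1) *\<^sub>R v" by simp
  show "AE x in lborel. rep_h1 (u - v) x = rep_h1 u x - rep_h1 v x"
    using h1_add_AE(1)[of u "(- 1) *\<^sub>R v"] h1_scaleR_AE(1)[of "- 1" v]
    unfolding eq by eventually_elim simp
  show "AE x in lborel. h1_grad (u - v) x = h1_grad u x - h1_grad v x"
    using h1_add_AE(2)[of u "(- 1) *\<^sub>R v"] h1_scaleR_AE(2)[of "- 1" v]
    unfolding eq by eventually_elim simp
qed

lemma h1_norm_square:
  "(norm u)\<^sup>2 = (L2_square (rep_h1 u)) + (L2_square (h1_grad u))"
  unfolding power2_norm_eq_inner by (simp add: inner_h1_def map_fun_def h1_grad_def)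

lemma h1_mass_le: "(L2_square (rep_h1 u)) \<le> (norm u)\<^sup>2"
  and h1_gradient_le: "(L2_square (h1_grad u)) \<le> (norm u)\<^sup>2"
  unfolding h1_norm_square by (simp_all add: Bochner_Integration.integral_nonneg)

lemma h1_Lr_integrable:
  assumes r: "r > 2" and g: "gam CARD('n::finite) r < 1"
  shows "integrable lborel (\<lambda>x. norm (rep_h1 (u :: 'n h1) x) powr r)"
proof (rule integrableI_bounded)
  obtain C where le: "\<And>u :: real^'n \<Rightarrow> complex. sobolev_fun u \<Longrightarrow>
    (\<integral>\<^sup>+x. ennreal (norm (u x) powr r) \<partial>lborel) \<le>
      ennreal (C * (L2_square (weak_gradient u)) powr (r * gam CARD('n) r / 2)
        * (L2_square u) powr (r * (1 - gam CARD('n) r) / 2))"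
    using gagliardo_nirenberg_nn[OF r g] by blast
  have "(\<integral>\<^sup>+x. ennreal (norm (rep_h1 u x) powr r) \<partial>lborel) < \<infinity>"
    by (rule le_less_trans[OF le[OF h1_sobolev]]) simp
  then show "(\<integral>\<^sup>+x. ennreal (norm (norm (rep_h1 u x) powr r)) \<partial>lborel) < \<infinity>" by simp
qed measurable

lemma Lnorm_2: "Lnorm 2 f = sqrt (L2_square f)"
  by (simp add: Lnorm_def powr_half_sqrt Bochner_Integration.integral_nonneg powr_numeral)

text \<open>Besides the inequality itself, this shows that the set whose infimum is
  \<open>gn_const\<close> is nonempty.\<close>

theorem gagliardo_nirenberg_h1:
  assumes r: "r > 2" and g: "gam CARD('n::finite) r < 1"
  shows "\<exists>C\<ge>0. \<forall>u :: 'n h1. Lnorm r (rep_h1 u) \<le>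
     C * Lnorm 2 (h1_grad u) powr gam CARD('n) r * Lnorm 2 (rep_h1 u) powr (1 - gam CARD('n) r)"
proof -
  let ?g = "gam CARD('n) r"
  obtain C where C: "C \<ge> 0" and le: "\<And>u :: real^'n \<Rightarrow> complex. sobolev_fun u \<Longrightarrow>
    (\<integral>\<^sup>+x. ennreal (norm (u x) powr r) \<partial>lborel) \<le>
      ennreal (C * (L2_square (weak_gradient u)) powr (r * ?g / 2)
        * (L2_square u) powr (r * (1 - ?g) / 2))"
    using gagliardo_nirenberg_nn[OF r g] by blast
  have "Lnorm r (rep_h1 u) \<le> C powr (1 / r) * Lnorm 2 (h1_grad u) powr ?g * Lnorm 2 (rep_h1 u) powr (1 - ?g)"
    for u :: "'n h1"
  proof -
    let ?X = "L2_square (rep_h1 u)" and ?T = "L2_square (h1_grad u)"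
    have XT: "0 \<le> ?X" "0 \<le> ?T" by (intro Bochner_Integration.integral_nonneg; simp)+
    have "ennreal (LINT x|lborel. norm (rep_h1 u x) powr r) = (\<integral>\<^sup>+x. ennreal (norm (rep_h1 u x) powr r) \<partial>lborel)"
      by (rule nn_integral_eq_integral[symmetric]) (simp_all add: h1_Lr_integrable[OF r g])
    also have "\<dots> \<le> ennreal (C * ?T powr (r * ?g / 2) * ?X powr (r * (1 - ?g) / 2))"
      unfolding h1_grad_def by (rule le[OF h1_sobolev])
    finally have "(LINT x|lborel. norm (rep_h1 u x) powr r) \<le> C * ?T powr (r * ?g / 2) * ?X powr (r * (1 - ?g) / 2)"
      using C by (simp add: ennreal_le_iff)
    then have "Lnorm r (rep_h1 u) \<le> (C * ?T powr (r * ?g / 2) * ?X powr (r * (1 - ?g) / 2)) powr (1 / r)"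
      unfolding Lnorm_def using r by (intro powr_mono2 Bochner_Integration.integral_nonneg) auto
    also have "\<dots> = C powr (1 / r) * ?T powr (?g / 2) * ?X powr ((1 - ?g) / 2)"
      using C r by (simp add: powr_mult powr_powr)
    also have "?T powr (?g / 2) = Lnorm 2 (h1_grad u) powr ?g"
      unfolding Lnorm_2 using XT by (simp add: powr_half_sqrt[symmetric] powr_powr)
    also have "?X powr ((1 - ?g) / 2) = Lnorm 2 (rep_h1 u) powr (1 - ?g)"
      unfolding Lnorm_2 using XT by (simp add: powr_half_sqrt[symmetric] powr_powr)
    finally show ?thesis .
  qed
  moreover have "C powr (1 / r) \<ge> 0" by simp
  ultimately show ?thesis by blast
qed

lemma h1_Lnorm_le:
  assumes r: "r > 2" and g: "gam CARD('n::finite) r < 1"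
  shows "\<exists>K\<ge>0. \<forall>u :: 'n h1. Lnorm r (rep_h1 u) \<le> K * norm u"
proof -
  let ?g = "gam CARD('n) r"
  have g0: "?g > 0" using r by (simp add: gam_def)
  obtain C where C: "C \<ge> 0" and le: "\<And>u :: 'n h1. Lnorm r (rep_h1 u) \<le>
     C * Lnorm 2 (h1_grad u) powr ?g * Lnorm 2 (rep_h1 u) powr (1 - ?g)"
    using gagliardo_nirenberg_h1[OF r g] by blast
  have "Lnorm r (rep_h1 u) \<le> C * norm u" for u :: "'n h1"
  proof -
    have *: "Lnorm 2 (h1_grad u) \<le> norm u" "Lnorm 2 (rep_h1 u) \<le> norm u"
      unfolding Lnorm_2 by (rule real_le_lsqrt; simp add: h1_mass_le h1_gradient_le)+
    have "Lnorm r (rep_h1 u) \<le> C * norm u powr ?g * norm u powr (1 - ?g)"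
      by (rule order_trans[OF le]) (intro mult_mono powr_mono2 *; use C g g0 in auto)
    also have "\<dots> = C * norm u powr 1" by (simp add: powr_add[symmetric])
    finally show ?thesis by simp
  qed
  with C show ?thesis by blast
qed

section \<open>Continuously differentiable functionals\<close>

text \<open>The derivatives met here satisfy a Lipschitz bound around each point, with a constant
  depending on the point, so continuity in the operator norm reduces to this one estimate.\<close>

lemma C1_functionalI:
  fixes f :: "'a::real_normed_vector \<Rightarrow> real"
  assumes bl: "\<And>u. bounded_linear (F u)" and d: "\<And>u. (f has_derivative F u) (at u)"
    and lip: "\<And>u. \<exists>M. \<forall>v h. norm (v - u) \<le> 1 \<longrightarrow> \<bar>F v h - F u h\<bar> \<le> M * norm (v - u) * norm h"
  shows "C1_functional f"
  unfolding C1_functional_def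
proof (intro exI conjI allI)
  have ap: "blinfun_apply (Blinfun (F u)) = F u" for u by (rule bounded_linear_Blinfun_apply[OF bl])
  show "(f has_derivative blinfun_apply (Blinfun (F u))) (at u)" for u
    unfolding ap by (rule d)
  show "continuous_on UNIV (\<lambda>u. Blinfun (F u))"
    unfolding continuous_on_eq_continuous_at[OF open_UNIV]
  proof
    fix u
    obtain M where M: "\<And>v h. norm (v - u) \<le> 1 \<Longrightarrow> \<bar>F v h - F u h\<bar> \<le> M * norm (v - u) * norm h"
      using lip[of u] by blast
    show "isCont (\<lambda>u. Blinfun (F u)) u"
      unfolding isCont_def
    proof (rule LIM_zero_cancel, rule Lim_null_comparison)
      have "((\<lambda>v. \<bar>M\<bar> * norm (v - u)) \<longlongrightarrow> \<bar>M\<bar> * norm (u - u)) (at u)"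
        by (intro tendsto_intros)
      then show "((\<lambda>v. \<bar>M\<bar> * norm (v - u)) \<longlongrightarrow> 0) (at u)" by simp
      have "\<forall>\<^sub>F v in at u. dist v u < 1" by (rule eventually_at_ball[of 1, unfolded mem_ball dist_commute[of u], OF zero_less_one, THEN eventually_mono]) (simp add: dist_commute)
      then show "\<forall>\<^sub>F v in at u. norm (Blinfun (F v) - Blinfun (F u)) \<le> \<bar>M\<bar> * norm (v - u)"
      proof eventually_elim
        case (elim v)
        show ?case
        proof (rule norm_blinfun_bound)
          fix h
          have "norm (blinfun_apply (Blinfun (F v) - Blinfun (F u)) h) = \<bar>F v h - F u h\<bar>"
            by (simp add: blinfun.diff_left ap)
          also have "\<dots> \<le> M * norm (v - u) * norm h" by (rule M) (use elim in \<open>simp add: dist_norm\<close>)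
          also have "\<dots> \<le> \<bar>M\<bar> * norm (v - u) * norm h" by (intro mult_right_mono) auto
          finally show "norm (blinfun_apply (Blinfun (F v) - Blinfun (F u)) h) \<le> \<bar>M\<bar> * norm (v - u) * norm h" .
        qed simp
      qed
    qed
  qed
qed

lemma C1_functional_add:
  assumes "C1_functional f" "C1_functional g"
  shows "C1_functional (\<lambda>u. f u + g u)"
proof -
  from assms obtain f' g' where
    *: "\<And>u. (f has_derivative blinfun_apply (f' u)) (at u)" "continuous_on UNIV f'"
       "\<And>u. (g has_derivative blinfun_apply (g' u)) (at u)" "continuous_on UNIV g'"
    unfolding C1_functional_def by blast
  have "((\<lambda>u. f u + g u) has_derivative blinfun_apply (f' u + g' u)) (at u)" for u
    using has_derivative_add[OF *(1,3)] by (simp add: plus_blinfun.rep_eq)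
  moreover have "continuous_on UNIV (\<lambda>u. f' u + g' u)" by (intro continuous_on_add *)
  ultimately show ?thesis
    unfolding C1_functional_def by (intro exI[of _ "\<lambda>u. f' u + g' u"] conjI allI)
qed

lemma C1_functional_cmult:
  assumes "C1_functional f"
  shows "C1_functional (\<lambda>u. c * f u)"
proof -
  from assms obtain f' where
    *: "\<And>u. (f has_derivative blinfun_apply (f' u)) (at u)" "continuous_on UNIV f'"
    unfolding C1_functional_def by blast
  have "((\<lambda>u. c * f u) has_derivative blinfun_apply (c *\<^sub>R f' u)) (at u)" for u
    using has_derivative_mult_right[OF *(1), of c] by (simp add: scaleR_blinfun.rep_eq)
  moreover have "continuous_on UNIV (\<lambda>u. c *\<^sub>R f' u)" by (intro continuous_on_scaleR continuous_on_const *)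
  ultimately show ?thesis
    unfolding C1_functional_def by (intro exI[of _ "\<lambda>u. c *\<^sub>R f' u"] conjI allI)
qed

lemma C1_functional_const: "C1_functional (\<lambda>u. c)"
  unfolding C1_functional_def by (intro exI[of _ "\<lambda>_. 0"]) (auto simp: zero_blinfun.rep_eq)

section \<open>The bilinear forms of mass and gradient\<close>

lemma L2_cauchy_schwarz:
  fixes f g :: "real^'n::finite \<Rightarrow> 'b::euclidean_space"
  assumes f: "square_integrable f" and g: "square_integrable g"
  shows "\<bar>LINT x|lborel. f x \<bullet> g x\<bar> \<le> Lnorm 2 f * Lnorm 2 g"
proof -
  have z: "\<bar>LINT x|lborel. f x \<bullet> g x\<bar> \<le> Lnorm 2 f * Lnorm 2 g"
    if "Lnorm 2 f = 0 \<or> Lnorm 2 g = 0"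
  proof -
    have "AE x in lborel. f x \<bullet> g x = 0"
      using that Lnorm_eq_0[of 2 f] Lnorm_eq_0[of 2 g] f g
      by (elim disjE) (auto elim!: eventually_mono simp: square_integrable_def powr_numeral)
    then have "(LINT x|lborel. f x \<bullet> g x) = 0" by (simp add: integral_eq_zero_AE)
    then show ?thesis by simp
  qed
  show ?thesis
  proof (cases "Lnorm 2 f = 0 \<or> Lnorm 2 g = 0")
    case True
    then show ?thesis by (rule z)
  next
    case False
    let ?F = "Lnorm 2 f" and ?G = "Lnorm 2 g"
    have pos: "?F > 0" "?G > 0"
      using False Lnorm_nonneg[of 2 f] Lnorm_nonneg[of 2 g] by linarith+
    have sq: "(L2_square h) = (Lnorm 2 h)\<^sup>2" for h :: "real^'n \<Rightarrow> 'b"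
      by (simp add: Lnorm_2 Bochner_Integration.integral_nonneg)
    have pt: "\<bar>a \<bullet> b\<bar> \<le> ?F * ?G * ((norm a)\<^sup>2 / (2 * ?F\<^sup>2) + (norm b)\<^sup>2 / (2 * ?G\<^sup>2))" for a b :: 'b
    proof -
      have "0 \<le> (norm a / ?F - norm b / ?G)\<^sup>2" by simp
      then have "2 * (norm a / ?F) * (norm b / ?G) \<le> (norm a)\<^sup>2 / ?F\<^sup>2 + (norm b)\<^sup>2 / ?G\<^sup>2"
        by (simp add: power2_diff power_divide)
      then have "norm a * norm b \<le> ?F * ?G * (((norm a)\<^sup>2 / ?F\<^sup>2 + (norm b)\<^sup>2 / ?G\<^sup>2) / 2)"
        using pos by (simp add: field_simps)
      also have "((norm a)\<^sup>2 / ?F\<^sup>2 + (norm b)\<^sup>2 / ?G\<^sup>2) / 2 = (norm a)\<^sup>2 / (2 * ?F\<^sup>2) + (norm b)\<^sup>2 / (2 * ?G\<^sup>2)"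
        by (simp add: add_divide_distrib mult.commute)
      finally show ?thesis using Cauchy_Schwarz_ineq2[of a b] by linarith
    qed
    have "\<bar>LINT x|lborel. f x \<bullet> g x\<bar> \<le> (LINT x|lborel. \<bar>f x \<bullet> g x\<bar>)"
      by (rule integral_abs_bound)
    also have "\<dots> \<le> (LINT x|lborel. ?F * ?G * ((norm (f x))\<^sup>2 / (2 * ?F\<^sup>2) + (norm (g x))\<^sup>2 / (2 * ?G\<^sup>2)))"
      by (rule integral_mono)
         (use f g square_integrable_inner[OF f g] pt in \<open>auto simp: square_integrable_def\<close>)
    also have "\<dots> = ?F * ?G * (?F\<^sup>2 / (2 * ?F\<^sup>2) + ?G\<^sup>2 / (2 * ?G\<^sup>2))"
      using f g by (simp add: square_integrable_def sq)
    also have "\<dots> = ?F * ?G" using pos by simp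
    finally show ?thesis .
  qed
qed

definition mass_form :: "'n::finite h1 \<Rightarrow> 'n h1 \<Rightarrow> real" where
  "mass_form u v = (LINT x|lborel. rep_h1 u x \<bullet> rep_h1 v x)"

definition grad_form :: "'n::finite h1 \<Rightarrow> 'n h1 \<Rightarrow> real" where
  "grad_form u v = (LINT x|lborel. h1_grad u x \<bullet> h1_grad v x)"

text \<open>Up to the factor \<open>r\<close> this is the derivative of the \<open>r\<close>-th
  power of the \<open>L^r\<close> norm at \<open>u\<close> in direction \<open>h\<close>. Where
  \<open>u\<close> vanishes the weight is \<open>0 powr (r - 2)\<close>, which is 0.\<close>

definition power_form :: "real \<Rightarrow> 'n::finite h1 \<Rightarrow> 'n h1 \<Rightarrow> real" where
  "power_form r u h = (LINT x|lborel. norm (rep_h1 u x) powr (r - 2) * (rep_h1 u x \<bullet> rep_h1 h x))"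

lemma form_add:
  shows "mass_form u (v + w) = mass_form u v + mass_form u w"
    and "grad_form u (v + w) = grad_form u v + grad_form u w"
proof -
  have "mass_form u (v + w) = (LINT x|lborel. rep_h1 u x \<bullet> rep_h1 v x + rep_h1 u x \<bullet> rep_h1 w x)"
    unfolding mass_form_def
    by (rule integral_cong_AE, measurable) (use h1_add_AE(1)[of v w] in eventually_elim, simp add: inner_add_right)
  then show "mass_form u (v + w) = mass_form u v + mass_form u w"
    unfolding mass_form_def
    by (simp add: square_integrable_inner[OF h1_square_integrable(1) h1_square_integrable(1)])
  have "grad_form u (v + w) = (LINT x|lborel. h1_grad u x \<bullet> h1_grad v x + h1_grad u x \<bullet> h1_grad w x)"
    unfolding grad_form_def
    by (rule integral_cong_AE, measurable) (use h1_add_AE(2)[of v w] in eventually_elim, simp add: inner_add_right)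
  then show "grad_form u (v + w) = grad_form u v + grad_form u w"
    unfolding grad_form_def
    by (simp add: square_integrable_inner[OF h1_square_integrable(2) h1_square_integrable(2)])
qed

lemma form_scaleR:
  shows "mass_form u (c *\<^sub>R v) = c * mass_form u v"
    and "grad_form u (c *\<^sub>R v) = c * grad_form u v"
proof -
  have "mass_form u (c *\<^sub>R v) = (LINT x|lborel. c * (rep_h1 u x \<bullet> rep_h1 v x))"
    unfolding mass_form_def
    by (rule integral_cong_AE, measurable) (use h1_scaleR_AE(1)[of c v] in eventually_elim, simp)
  then show "mass_form u (c *\<^sub>R v) = c * mass_form u v" unfolding mass_form_def by simp
  have "grad_form u (c *\<^sub>R v) = (LINT x|lborel. c * (h1_grad u x \<bullet> h1_grad v x))"
    unfolding grad_form_def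
    by (rule integral_cong_AE, measurable) (use h1_scaleR_AE(2)[of c v] in eventually_elim, simp)
  then show "grad_form u (c *\<^sub>R v) = c * grad_form u v" unfolding grad_form_def by simp
qed

lemma form_commute: "mass_form u v = mass_form v u" "grad_form u v = grad_form v u"
  by (simp_all add: mass_form_def grad_form_def inner_commute)

lemma form_left:
  "mass_form (v + w) u = mass_form v u + mass_form w u" "grad_form (v + w) u = grad_form v u + grad_form w u"
  "mass_form (c *\<^sub>R v) u = c * mass_form v u" "grad_form (c *\<^sub>R v) u = c * grad_form v u"
  by (simp_all only: form_commute[of _ u] form_add form_scaleR)

lemma Lnorm_2_le_h1:
  "Lnorm 2 (rep_h1 u) \<le> norm u" "Lnorm 2 (h1_grad u) \<le> norm u"
  unfolding Lnorm_2 by (rule real_le_lsqrt; simp add: h1_mass_le h1_gradient_le)+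

lemma bounded_bilinear_forms: "bounded_bilinear mass_form" "bounded_bilinear grad_form"
proof -
  have "\<bar>mass_form u v\<bar> \<le> norm u * norm v * 1" for u v :: "'a h1"
    using order_trans[OF L2_cauchy_schwarz[OF h1_square_integrable(1) h1_square_integrable(1)]
        mult_mono[OF Lnorm_2_le_h1(1) Lnorm_2_le_h1(1)], of u v]
    by (simp add: mass_form_def)
  then show "bounded_bilinear (mass_form :: 'a h1 \<Rightarrow> _)"
    by unfold_locales (auto simp: form_add form_scaleR form_left intro!: exI[of _ 1])
  have "\<bar>grad_form u v\<bar> \<le> norm u * norm v * 1" for u v :: "'b h1"
    using order_trans[OF L2_cauchy_schwarz[OF h1_square_integrable(2) h1_square_integrable(2)]
        mult_mono[OF Lnorm_2_le_h1(2) Lnorm_2_le_h1(2)], of u v]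
    by (simp add: grad_form_def)
  then show "bounded_bilinear (grad_form :: 'b h1 \<Rightarrow> _)"
    by unfold_locales (auto simp: form_add form_scaleR form_left intro!: exI[of _ 1])
qed

lemma quadratic_C1:
  fixes B :: "'a::real_normed_vector \<Rightarrow> 'a \<Rightarrow> real"
  assumes B: "bounded_bilinear B" and sym: "\<And>u v. B u v = B v u"
  shows "((\<lambda>u. B u u) has_derivative (\<lambda>h. 2 * B u h)) (at u)"
    and "C1_functional (\<lambda>u. B u u)"
proof -
  show d: "((\<lambda>u. B u u) has_derivative (\<lambda>h. 2 * B u h)) (at u)" for u
    using bounded_bilinear.FDERIV[OF B has_derivative_ident has_derivative_ident, of u UNIV]
    by (simp add: sym[of _ u])
  obtain K where K: "\<And>u v. norm (B u v) \<le> norm u * norm v * K" and K0: "0 \<le> K"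
    using bounded_bilinear.nonneg_bounded[OF B] by blast
  show "C1_functional (\<lambda>u. B u u)"
  proof (rule C1_functionalI[OF _ d])
    show "bounded_linear (\<lambda>h. 2 * B u h)" for u
      by (intro bounded_linear_const_mult bounded_bilinear.bounded_linear_right[OF B])
    have "\<bar>2 * B v h - 2 * B u h\<bar> \<le> (2 * K) * norm (v - u) * norm h" for u v h
    proof -
      have "2 * B v h - 2 * B u h = 2 * B (v - u) h" by (simp add: bounded_bilinear.diff_left[OF B])
      then show ?thesis using K[of "v - u" h] by (simp add: abs_mult mult_ac)
    qed
    then show "\<exists>M. \<forall>v h. norm (v - u) \<le> 1 \<longrightarrow> \<bar>2 * B v h - 2 * B u h\<bar> \<le> M * norm (v - u) * norm h" for u
      by blast
  qed
qed

lemmas mass_C1 = quadratic_C1[OF bounded_bilinear_forms(1) form_commute(1)]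
lemmas gradient_C1 = quadratic_C1[OF bounded_bilinear_forms(2) form_commute(2)]

lemma form_self:
  "mass_form u u = (Lnorm 2 (rep_h1 u))\<^sup>2" "grad_form u u = (Lnorm 2 (h1_grad u))\<^sup>2"
  by (simp_all add: mass_form_def grad_form_def Lnorm_2 Bochner_Integration.integral_nonneg power2_norm_eq_inner)

section \<open>Differentiability of powers of the \<open>L^r\<close> norm\<close>

context
  fixes r :: real and n :: "'n::finite itself"
  assumes r: "r > 2" and g: "gam CARD('n) r < 1"
begin

lemma Lnorm_h1_powr: "Lnorm r (rep_h1 (u :: 'n h1)) powr r = (LINT x|lborel. norm (rep_h1 u x) powr r)"
  using r by (intro Lnorm_powr) auto

lemma trilinear_h1:
  fixes u v w :: "'n h1"
  shows "integrable lborel (\<lambda>x. norm (rep_h1 u x) powr (r - 2) * norm (rep_h1 v x) * norm (rep_h1 w x))"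
    and "(LINT x|lborel. norm (rep_h1 u x) powr (r - 2) * norm (rep_h1 v x) * norm (rep_h1 w x)) \<le>
      3 * Lnorm r (rep_h1 u) powr (r - 2) * Lnorm r (rep_h1 v) * Lnorm r (rep_h1 w)"
  by (rule trilinear_integrable trilinear_le; (rule r h1_measurable h1_Lr_integrable g)+)+

lemma weighted_h1:
  fixes u v w z :: "'n h1"
  shows "integrable lborel (\<lambda>x. (norm (rep_h1 u x) powr (r - 2) + norm (rep_h1 v x) powr (r - 2)) * (norm (rep_h1 w x) * norm (rep_h1 z x)))"
    and "(LINT x|lborel. (norm (rep_h1 u x) powr (r - 2) + norm (rep_h1 v x) powr (r - 2)) * (norm (rep_h1 w x) * norm (rep_h1 z x))) \<le>
      3 * (Lnorm r (rep_h1 u) powr (r - 2) + Lnorm r (rep_h1 v) powr (r - 2)) * (Lnorm r (rep_h1 w) * Lnorm r (rep_h1 z))"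
proof -
  have eq: "(norm (rep_h1 u x) powr (r - 2) + norm (rep_h1 v x) powr (r - 2)) * (norm (rep_h1 w x) * norm (rep_h1 z x)) =
     norm (rep_h1 u x) powr (r - 2) * norm (rep_h1 w x) * norm (rep_h1 z x) +
     norm (rep_h1 v x) powr (r - 2) * norm (rep_h1 w x) * norm (rep_h1 z x)" for x
    by (simp add: algebra_simps)
  show "integrable lborel (\<lambda>x. (norm (rep_h1 u x) powr (r - 2) + norm (rep_h1 v x) powr (r - 2)) * (norm (rep_h1 w x) * norm (rep_h1 z x)))"
    unfolding eq by (intro Bochner_Integration.integrable_add trilinear_h1)
  show "(LINT x|lborel. (norm (rep_h1 u x) powr (r - 2) + norm (rep_h1 v x) powr (r - 2)) * (norm (rep_h1 w x) * norm (rep_h1 z x))) \<le>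
      3 * (Lnorm r (rep_h1 u) powr (r - 2) + Lnorm r (rep_h1 v) powr (r - 2)) * (Lnorm r (rep_h1 w) * Lnorm r (rep_h1 z))"
    unfolding eq using trilinear_h1(2)[of u w z] trilinear_h1(2)[of v w z]
    by (subst Bochner_Integration.integral_add[OF trilinear_h1(1) trilinear_h1(1)]) (simp add: algebra_simps)
qed

lemma power_form_integrable:
  "integrable lborel (\<lambda>x. norm (rep_h1 (u :: 'n h1) x) powr (r - 2) * (rep_h1 u x \<bullet> rep_h1 h x))"
proof (rule Bochner_Integration.integrable_bound[OF trilinear_h1(1)[of u u h]])
  show "AE x in lborel. norm (norm (rep_h1 u x) powr (r - 2) * (rep_h1 u x \<bullet> rep_h1 h x)) \<le>
     norm (norm (rep_h1 u x) powr (r - 2) * norm (rep_h1 u x) * norm (rep_h1 h x))"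
    by (intro AE_I2) (simp add: abs_mult mult.assoc mult_left_mono Cauchy_Schwarz_ineq2)
qed measurable

lemma power_form_abs_le:
  "\<bar>power_form r u h\<bar> \<le> 3 * Lnorm r (rep_h1 (u :: 'n h1)) powr (r - 2) * Lnorm r (rep_h1 u) * Lnorm r (rep_h1 h)"
proof -
  have "\<bar>power_form r u h\<bar> \<le> (LINT x|lborel. \<bar>norm (rep_h1 u x) powr (r - 2) * (rep_h1 u x \<bullet> rep_h1 h x)\<bar>)"
    unfolding power_form_def by (rule integral_abs_bound)
  also have "\<dots> \<le> (LINT x|lborel. norm (rep_h1 u x) powr (r - 2) * norm (rep_h1 u x) * norm (rep_h1 h x))"
    by (intro integral_mono integrable_abs power_form_integrable trilinear_h1(1))
       (simp add: abs_mult mult.assoc mult_left_mono Cauchy_Schwarz_ineq2)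
  finally show ?thesis using trilinear_h1(2)[of u u h] by linarith
qed

lemma power_form_add: "power_form r u (v + w) = power_form r u v + power_form r (u :: 'n h1) w"
proof -
  have "power_form r u (v + w) = (LINT x|lborel. norm (rep_h1 u x) powr (r - 2) * (rep_h1 u x \<bullet> rep_h1 v x) +
      norm (rep_h1 u x) powr (r - 2) * (rep_h1 u x \<bullet> rep_h1 w x))"
    unfolding power_form_def
    by (rule integral_cong_AE, measurable)
       (use h1_add_AE(1)[of v w] in eventually_elim, simp add: inner_add_right distrib_left)
  then show ?thesis unfolding power_form_def
    by (simp add: Bochner_Integration.integral_add[OF power_form_integrable power_form_integrable])
qed

lemma power_form_scaleR: "power_form r u (c *\<^sub>R v) = c * power_form r (u :: 'n h1) v"
proof -
  have "power_form r u (c *\<^sub>R v) = (LINT x|lborel. c * (norm (rep_h1 u x) powr (r - 2) * (rep_h1 u x \<bullet> rep_h1 v x)))"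
    unfolding power_form_def
    by (rule integral_cong_AE, measurable)
       (use h1_scaleR_AE(1)[of c v] in eventually_elim, simp)
  then show ?thesis unfolding power_form_def by simp
qed

lemma power_form_self: "power_form r u u = Lnorm r (rep_h1 (u :: 'n h1)) powr r"
proof -
  have "norm a powr (r - 2) * (a \<bullet> a) = norm a powr r" for a :: complex
  proof (cases "a = 0")
    case False
    then have "norm a powr r = norm a powr (r - 2) * norm a powr 2"
      by (simp only: powr_add[symmetric]) simp
    then show ?thesis using False by (simp add: power2_norm_eq_inner powr_numeral)
  qed simp
  then show ?thesis unfolding power_form_def by (simp add: Lnorm_h1_powr)
qed

lemma power_form_diff_le:
  fixes u v h :: "'n h1"
  shows "\<bar>power_form r v h - power_form r u h\<bar> \<le>
    3 * (r - 1) * (Lnorm r (rep_h1 v) powr (r - 2) + Lnorm r (rep_h1 u) powr (r - 2)) * Lnorm r (rep_h1 (v - u)) * Lnorm r (rep_h1 h)"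
proof -
  let ?U = "rep_h1 u" and ?V = "rep_h1 v" and ?H = "rep_h1 h"
  let ?w = "\<lambda>x. norm (?V x) powr (r - 2) + norm (?U x) powr (r - 2)"
  have "\<bar>power_form r v h - power_form r u h\<bar> =
      \<bar>LINT x|lborel. norm (?V x) powr (r - 2) * (?V x \<bullet> ?H x) - norm (?U x) powr (r - 2) * (?U x \<bullet> ?H x)\<bar>"
    unfolding power_form_def
    by (subst Bochner_Integration.integral_diff[OF power_form_integrable power_form_integrable]) simp
  also have "\<dots> \<le> (LINT x|lborel. \<bar>norm (?V x) powr (r - 2) * (?V x \<bullet> ?H x) - norm (?U x) powr (r - 2) * (?U x \<bullet> ?H x)\<bar>)"
    by (rule integral_abs_bound)
  also have "\<dots> \<le> (LINT x|lborel. (r - 1) * (?w x * (norm (rep_h1 (v - u) x) * norm (?H x))))"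
  proof (rule integral_mono_AE)
    show "integrable lborel (\<lambda>x. \<bar>norm (?V x) powr (r - 2) * (?V x \<bullet> ?H x) - norm (?U x) powr (r - 2) * (?U x \<bullet> ?H x)\<bar>)"
      by (intro integrable_abs Bochner_Integration.integrable_diff power_form_integrable)
    show "integrable lborel (\<lambda>x. (r - 1) * (?w x * (norm (rep_h1 (v - u) x) * norm (?H x))))"
      by (intro integrable_mult_right weighted_h1(1))
    show "AE x in lborel. \<bar>norm (?V x) powr (r - 2) * (?V x \<bullet> ?H x) - norm (?U x) powr (r - 2) * (?U x \<bullet> ?H x)\<bar> \<le>
        (r - 1) * (?w x * (norm (rep_h1 (v - u) x) * norm (?H x)))"
      using h1_diff_AE(1)[of v u]
    proof eventually_elim
      case (elim x)
      have "\<bar>norm (?V x) powr (r - 2) * (?V x \<bullet> ?H x) - norm (?U x) powr (r - 2) * (?U x \<bullet> ?H x)\<bar> =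
          \<bar>(norm (?V x) powr (r - 2) *\<^sub>R ?V x - norm (?U x) powr (r - 2) *\<^sub>R ?U x) \<bullet> ?H x\<bar>"
        by (simp add: inner_diff_left)
      also have "\<dots> \<le> norm (norm (?V x) powr (r - 2) *\<^sub>R ?V x - norm (?U x) powr (r - 2) *\<^sub>R ?U x) * norm (?H x)"
        by (rule Cauchy_Schwarz_ineq2)
      also have "\<dots> \<le> ((1 + (r - 2)) * ?w x * norm (?V x - ?U x)) * norm (?H x)"
        using r by (intro mult_right_mono norm_powr_scaleR_diff_le) auto
      finally show ?case by (simp add: elim mult_ac)
    qed
  qed
  also have "\<dots> = (r - 1) * (LINT x|lborel. ?w x * (norm (rep_h1 (v - u) x) * norm (?H x)))" by simp
  also have "\<dots> \<le> (r - 1) * (3 * (Lnorm r ?V powr (r - 2) + Lnorm r ?U powr (r - 2)) * (Lnorm r (rep_h1 (v - u)) * Lnorm r ?H))"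
    using r by (intro mult_left_mono weighted_h1(2)) auto
  finally show ?thesis by (simp only: mult_ac)
qed

lemma power_taylor:
  fixes u v :: "'n h1"
  shows "\<bar>Lnorm r (rep_h1 v) powr r - Lnorm r (rep_h1 u) powr r - r * power_form r u (v - u)\<bar> \<le>
    3 * r * (r - 1) * (Lnorm r (rep_h1 u) powr (r - 2) + Lnorm r (rep_h1 v) powr (r - 2)) * (Lnorm r (rep_h1 (v - u)))\<^sup>2"
proof -
  let ?U = "rep_h1 u" and ?V = "rep_h1 v" and ?D = "rep_h1 (v - u)"
  let ?w = "\<lambda>x. norm (?U x) powr (r - 2) + norm (?V x) powr (r - 2)"
  let ?f = "\<lambda>x. norm (?V x) powr r - norm (?U x) powr r - r * (norm (?U x) powr (r - 2) * (?U x \<bullet> ?D x))"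
  have i: "integrable lborel ?f"
    by (intro Bochner_Integration.integrable_diff integrable_mult_right power_form_integrable h1_Lr_integrable r g)
  have "Lnorm r ?V powr r - Lnorm r ?U powr r - r * power_form r u (v - u) = (LINT x|lborel. ?f x)"
    unfolding Lnorm_h1_powr power_form_def
    by (subst Bochner_Integration.integral_diff, (intro Bochner_Integration.integrable_diff integrable_mult_right power_form_integrable h1_Lr_integrable r g)+)+ simp
  also have "\<bar>\<dots>\<bar> \<le> (LINT x|lborel. \<bar>?f x\<bar>)" by (rule integral_abs_bound)
  also have "\<dots> \<le> (LINT x|lborel. r * (r - 1) * (?w x * (norm (?D x) * norm (?D x))))"
  proof (rule integral_mono_AE)
    show "integrable lborel (\<lambda>x. \<bar>?f x\<bar>)" by (rule integrable_abs[OF i])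
    show "integrable lborel (\<lambda>x. r * (r - 1) * (?w x * (norm (?D x) * norm (?D x))))"
      by (intro integrable_mult_right weighted_h1(1))
    show "AE x in lborel. \<bar>?f x\<bar> \<le> r * (r - 1) * (?w x * (norm (?D x) * norm (?D x)))"
      using h1_diff_AE(1)[of v u]
    proof eventually_elim
      case (elim x)
      show ?case
        using norm_powr_taylor[OF r, where a = "?U x" and b = "?V x"]
        by (simp only: elim power2_eq_square mult.assoc)
    qed
  qed
  also have "\<dots> = r * (r - 1) * (LINT x|lborel. ?w x * (norm (?D x) * norm (?D x)))" by simp
  also have "\<dots> \<le> r * (r - 1) * (3 * (Lnorm r ?U powr (r - 2) + Lnorm r ?V powr (r - 2)) * (Lnorm r ?D * Lnorm r ?D))"
    using r by (intro mult_left_mono weighted_h1(2)) auto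
  finally show ?thesis by (simp only: mult_ac power2_eq_square)
qed

text \<open>The Taylor remainder and the increment of the derivative carry weights depending on
  \<open>u\<close> and \<open>v\<close>. On the unit ball around \<open>u\<close> the embedding into
  \<open>L^r\<close> bounds these weights by \<open>?M u\<close>, and both estimates become uniform
  there.\<close>

lemma power_C1:
  shows "((\<lambda>u. Lnorm r (rep_h1 u) powr r) has_derivative (\<lambda>h. r * power_form r u h)) (at (u :: 'n h1))"
    and "C1_functional (\<lambda>u :: 'n h1. Lnorm r (rep_h1 u) powr r)"
proof -
  obtain K where K: "0 \<le> K" and le: "\<And>u :: 'n h1. Lnorm r (rep_h1 u) \<le> K * norm u"
    using h1_Lnorm_le[OF r g] by blast
  have bl: "bounded_linear (\<lambda>h. r * power_form r u h)" for u :: "'n h1"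
  proof (intro bounded_linear_const_mult bounded_linear_intro)
    let ?C = "3 * Lnorm r (rep_h1 u) powr (r - 2) * Lnorm r (rep_h1 u)"
    have "\<bar>power_form r u h\<bar> \<le> ?C * (K * norm h)" for h
      by (rule order_trans[OF power_form_abs_le]) (intro mult_left_mono le; simp)
    then show "norm (power_form r u h) \<le> norm h * (?C * K)" for h by (simp add: mult_ac)
  qed (simp_all add: power_form_add power_form_scaleR)
  have near: "Lnorm r (rep_h1 v) powr (r - 2) \<le> (K * (norm u + 1)) powr (r - 2)"
    if "norm (v - u) \<le> 1" for u v :: "'n h1"
  proof -
    have "norm v \<le> norm u + 1" using norm_triangle_sub[of v u] that by linarith
    then have "Lnorm r (rep_h1 v) \<le> K * (norm u + 1)"
      using K by (intro order_trans[OF le] mult_left_mono)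
    then show ?thesis using r by (intro powr_mono2) auto
  qed
  let ?M = "\<lambda>u :: 'n h1. 2 * (K * (norm u + 1)) powr (r - 2)"
  have M: "Lnorm r (rep_h1 u) powr (r - 2) + Lnorm r (rep_h1 v) powr (r - 2) \<le> ?M u"
    if "norm (v - u) \<le> 1" for u v :: "'n h1"
    using near[OF that] near[of u u] by simp
  show d: "((\<lambda>u. Lnorm r (rep_h1 u) powr r) has_derivative (\<lambda>h. r * power_form r u h)) (at u)" for u :: "'n h1"
  proof (rule has_derivativeI_sandwich[of 1])
    let ?C = "3 * r * (r - 1) * ?M u * K\<^sup>2"
    show "((\<lambda>v. ?C * norm (v - u)) \<longlongrightarrow> 0) (at u)"
    proof -
      have "((\<lambda>v. ?C * norm (v - u)) \<longlongrightarrow> ?C * norm (u - u)) (at u)" by (intro tendsto_intros)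
      then show ?thesis by simp
    qed
    fix v :: "'n h1" assume v: "v \<noteq> u" "dist v u < 1"
    have "norm (Lnorm r (rep_h1 v) powr r - Lnorm r (rep_h1 u) powr r - r * power_form r u (v - u)) \<le>
       3 * r * (r - 1) * (Lnorm r (rep_h1 u) powr (r - 2) + Lnorm r (rep_h1 v) powr (r - 2)) * (Lnorm r (rep_h1 (v - u)))\<^sup>2"
      using power_taylor[of v u] by simp
    also have "\<dots> \<le> 3 * r * (r - 1) * ?M u * (K * norm (v - u))\<^sup>2"
      using v r by (intro mult_mono mult_left_mono M power_mono le) (auto simp: dist_norm)
    also have "\<dots> = (?C * norm (v - u)) * norm (v - u)" by (simp add: power2_eq_square mult_ac)
    finally show "norm (Lnorm r (rep_h1 v) powr r - Lnorm r (rep_h1 u) powr r - r * power_form r u (v - u)) / norm (v - u) \<le> ?C * norm (v - u)"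
      using v by (subst pos_divide_le_eq) auto
  qed (use bl in auto)
  show "C1_functional (\<lambda>u :: 'n h1. Lnorm r (rep_h1 u) powr r)"
  proof (rule C1_functionalI[OF bl d])
    fix u :: "'n h1"
    have "\<bar>r * power_form r v h - r * power_form r u h\<bar> \<le> (r * (3 * (r - 1) * ?M u * K * K)) * norm (v - u) * norm h"
      if "norm (v - u) \<le> 1" for v h
    proof -
      have "\<bar>power_form r v h - power_form r u h\<bar> \<le>
        3 * (r - 1) * (Lnorm r (rep_h1 v) powr (r - 2) + Lnorm r (rep_h1 u) powr (r - 2)) * Lnorm r (rep_h1 (v - u)) * Lnorm r (rep_h1 h)"
        by (rule power_form_diff_le)
      also have "\<dots> \<le> 3 * (r - 1) * ?M u * (K * norm (v - u)) * (K * norm h)"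
        using M[OF that] r K by (intro mult_mono mult_left_mono le) (auto simp: add.commute)
      finally have "\<bar>power_form r v h - power_form r u h\<bar> \<le> (3 * (r - 1) * ?M u * K * K) * norm (v - u) * norm h"
        by (simp add: mult_ac)
      then have "r * \<bar>power_form r v h - power_form r u h\<bar> \<le> r * ((3 * (r - 1) * ?M u * K * K) * norm (v - u) * norm h)"
        using r by (intro mult_left_mono) auto
      moreover have "\<bar>r * power_form r v h - r * power_form r u h\<bar> = r * \<bar>power_form r v h - power_form r u h\<bar>"
        using r by (simp add: abs_mult right_diff_distrib[symmetric])
      ultimately show ?thesis by (simp only: mult.assoc)
    qed
    then show "\<exists>M. \<forall>v h. norm (v - u) \<le> 1 \<longrightarrow> \<bar>r * power_form r v h - r * power_form r u h\<bar> \<le> M * norm (v - u) * norm h"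
      by blast
  qed
qed

end

section \<open>Translates of weak solutions\<close>

definition shift_h1 :: "real^'n::finite \<Rightarrow> 'n h1 \<Rightarrow> 'n h1" where
  "shift_h1 k u = abs_h1 (\<lambda>x. rep_h1 u (x + k))"

lemma shift_h1_AE:
  shows "AE x in lborel. rep_h1 (shift_h1 k u) x = rep_h1 u (x + k)"
    and "AE x in lborel. h1_grad (shift_h1 k u) x = h1_grad u (x + k)"
proof -
  note * = abs_h1_AE[OF sobolev_fun_shift[OF h1_sobolev], of u k]
  show "AE x in lborel. rep_h1 (shift_h1 k u) x = rep_h1 u (x + k)" unfolding shift_h1_def by (rule *)
  show "AE x in lborel. h1_grad (shift_h1 k u) x = h1_grad u (x + k)"
    using *(2) weak_gradient_shift_AE[OF h1_sobolev, of u k]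
    unfolding shift_h1_def by eventually_elim (simp add: h1_grad_def)
qed

lemma shift_h1_diff_AE:
  shows "AE x in lborel. rep_h1 (shift_h1 k u - u) x = rep_h1 u (x + k) - rep_h1 u x"
    and "AE x in lborel. h1_grad (shift_h1 k u - u) x = h1_grad u (x + k) - h1_grad u x"
  using h1_diff_AE[of "shift_h1 k u" u] shift_h1_AE[of k u]
  by (eventually_elim, simp)+

lemma Lnorm_cong_AE:
  assumes [measurable]: "f \<in> borel_measurable borel" "g \<in> borel_measurable borel"
    and "AE x in lborel. f x = g x"
  shows "Lnorm r f = Lnorm r g"
proof -
  have "(LINT x|lborel. norm (f x) powr r) = (LINT x|lborel. norm (g x) powr r)"
    by (rule integral_cong_AE, measurable) (use assms(3) in eventually_elim, simp)
  then show ?thesis by (simp add: Lnorm_def)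
qed

lemma Lnorm_shift:
  fixes f :: "real^'n::finite \<Rightarrow> 'b::euclidean_space"
  assumes [measurable]: "f \<in> borel_measurable borel"
  shows "Lnorm r (\<lambda>x. f (x + k)) = Lnorm r f"
  unfolding Lnorm_def
  by (subst integral_lborel_shift[of "\<lambda>x. norm (f x) powr r"]) simp_all

lemma Lnorm_shift_h1: "Lnorm r (rep_h1 (shift_h1 k u)) = Lnorm r (rep_h1 u)"
  by (subst Lnorm_cong_AE[OF _ _ shift_h1_AE(1)]) (simp_all add: Lnorm_shift)

lemma Lnorm_shift_diff_le: "Lnorm 2 (rep_h1 (shift_h1 k u - u)) \<le> norm k * Lnorm 2 (h1_grad u)"
proof -
  have "Lnorm 2 (rep_h1 (shift_h1 k u - u)) = Lnorm 2 (\<lambda>x. rep_h1 u (x + k) - rep_h1 u x)"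
    by (rule Lnorm_cong_AE[OF _ _ shift_h1_diff_AE(1)]) measurable
  also have "\<dots> \<le> sqrt ((norm k)\<^sup>2 * (L2_square (h1_grad u)))"
    unfolding Lnorm_2 h1_grad_def by (intro real_sqrt_le_mono difference_L2_le h1_sobolev)
  finally show ?thesis by (simp add: real_sqrt_mult Lnorm_2)
qed

text \<open>A substitution turns the translation of the left argument into the opposite translation
  of the right one. The latter is again an admissible test function, so translates of weak solutions
  are weak solutions.\<close>

lemma shift_forms:
  shows "mass_form (shift_h1 k u) h = mass_form u (shift_h1 (- k) h)"
    and "grad_form (shift_h1 k u) h = grad_form u (shift_h1 (- k) h)"
    and "power_form r (shift_h1 k u) h = power_form r u (shift_h1 (- k) h)"
proof -
  have "mass_form (shift_h1 k u) h = (LINT x|lborel. rep_h1 u (x + k) \<bullet> rep_h1 h x)"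
    unfolding mass_form_def by (rule integral_cong_AE, measurable) (use shift_h1_AE(1)[of k u] in eventually_elim, simp)
  also have "\<dots> = (LINT x|lborel. rep_h1 u (x + - k + k) \<bullet> rep_h1 h (x + - k))"
    by (rule integral_lborel_shift[symmetric]) measurable
  also have "\<dots> = (LINT x|lborel. rep_h1 u x \<bullet> rep_h1 (shift_h1 (- k) h) x)"
    by (rule integral_cong_AE, measurable) (use shift_h1_AE(1)[of "- k" h] in eventually_elim, simp)
  finally show "mass_form (shift_h1 k u) h = mass_form u (shift_h1 (- k) h)" unfolding mass_form_def .
  have "grad_form (shift_h1 k u) h = (LINT x|lborel. h1_grad u (x + k) \<bullet> h1_grad h x)"
    unfolding grad_form_def by (rule integral_cong_AE, measurable) (use shift_h1_AE(2)[of k u] in eventually_elim, simp)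
  also have "\<dots> = (LINT x|lborel. h1_grad u (x + - k + k) \<bullet> h1_grad h (x + - k))"
    by (rule integral_lborel_shift[symmetric]) measurable
  also have "\<dots> = (LINT x|lborel. h1_grad u x \<bullet> h1_grad (shift_h1 (- k) h) x)"
    by (rule integral_cong_AE, measurable) (use shift_h1_AE(2)[of "- k" h] in eventually_elim, simp)
  finally show "grad_form (shift_h1 k u) h = grad_form u (shift_h1 (- k) h)" unfolding grad_form_def .
  have "power_form r (shift_h1 k u) h = (LINT x|lborel. norm (rep_h1 u (x + k)) powr (r - 2) * (rep_h1 u (x + k) \<bullet> rep_h1 h x))"
    unfolding power_form_def by (rule integral_cong_AE, measurable) (use shift_h1_AE(1)[of k u] in eventually_elim, simp)
  also have "\<dots> = (LINT x|lborel. norm (rep_h1 u (x + - k + k)) powr (r - 2) * (rep_h1 u (x + - k + k) \<bullet> rep_h1 h (x + - k)))"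
    by (rule integral_lborel_shift[symmetric]) measurable
  also have "\<dots> = (LINT x|lborel. norm (rep_h1 u x) powr (r - 2) * (rep_h1 u x \<bullet> rep_h1 (shift_h1 (- k) h) x))"
    by (rule integral_cong_AE, measurable) (use shift_h1_AE(1)[of "- k" h] in eventually_elim, simp)
  finally show "power_form r (shift_h1 k u) h = power_form r u (shift_h1 (- k) h)" unfolding power_form_def .
qed

text \<open>The weak form of \<open>- c \<Delta>u = \<alpha> |u|^(p-2) u + \<beta> |u|^(q-2) u +
  \<nu> u\<close>. Here \<open>\<nu>\<close> is the coefficient of the linear term. The value
  \<open>c = 0\<close> occurs for a constrained critical point whose Pohozaev multiplier is
  1/2.\<close>

definition weak_solution :: "real \<Rightarrow> real \<Rightarrow> real \<Rightarrow> real \<Rightarrow> real \<Rightarrow> real \<Rightarrow> 'n::finite h1 \<Rightarrow> bool" where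
  "weak_solution c \<alpha> \<beta> \<nu> p q u \<longleftrightarrow>
     (\<forall>h. c * grad_form u h = \<alpha> * power_form p u h + \<beta> * power_form q u h + \<nu> * mass_form u h)"

lemma weak_solution_shift: "weak_solution c \<alpha> \<beta> \<nu> p q u \<Longrightarrow> weak_solution c \<alpha> \<beta> \<nu> p q (shift_h1 k u)"
  unfolding weak_solution_def shift_forms by blast

text \<open>The quantity that links both halves of the argument: monotonicity bounds it by the
  pairing of the nonlinear increment with \<open>v - u\<close>, and the Taylor remainder of the
  \<open>r\<close>-th power is at most a multiple of it.\<close>

definition weighted_difference :: "real \<Rightarrow> 'n::finite h1 \<Rightarrow> 'n h1 \<Rightarrow> real" where
  "weighted_difference r u v = (LINT x|lborel. (norm (rep_h1 u x) powr (r - 2) + norm (rep_h1 v x) powr (r - 2)) *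
     (norm (rep_h1 (v - u) x))\<^sup>2)"

lemma weighted_difference_nonneg: "0 \<le> weighted_difference r u v"
  unfolding weighted_difference_def by (intro Bochner_Integration.integral_nonneg) auto

context
  fixes r :: real and n :: "'n::finite itself"
  assumes r: "r > 2" and g: "gam CARD('n) r < 1"
begin

lemma weighted_difference_integrable:
  "integrable lborel (\<lambda>x. (norm (rep_h1 (u :: 'n h1) x) powr (r - 2) + norm (rep_h1 v x) powr (r - 2)) *
     (norm (rep_h1 (v - u) x))\<^sup>2)"
  using weighted_h1(1)[OF r g, of u v "v - u" "v - u"] by (simp add: power2_eq_square)

lemma weighted_difference_le:
  "weighted_difference r (u :: 'n h1) v \<le>
    3 * (Lnorm r (rep_h1 u) powr (r - 2) + Lnorm r (rep_h1 v) powr (r - 2)) * (Lnorm r (rep_h1 (v - u)))\<^sup>2"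
  using weighted_h1(2)[OF r g, of u v "v - u" "v - u"] by (simp add: weighted_difference_def power2_eq_square)

lemma power_form_monotone:
  "weighted_difference r u v / 2 \<le> power_form r v (v - u) - power_form r (u :: 'n h1) (v - u)"
  and power_form_diff_le_weighted:
  "\<bar>power_form r v (v - u) - power_form r u (v - u)\<bar> \<le> (r - 1) * weighted_difference r u v"
proof -
  let ?U = "rep_h1 u" and ?V = "rep_h1 v" and ?D = "rep_h1 (v - u)"
  let ?w = "\<lambda>x. norm (?U x) powr (r - 2) + norm (?V x) powr (r - 2)"
  let ?f = "\<lambda>x. norm (?V x) powr (r - 2) * (?V x \<bullet> ?D x) - norm (?U x) powr (r - 2) * (?U x \<bullet> ?D x)"
  have i: "integrable lborel ?f"
    by (intro Bochner_Integration.integrable_diff power_form_integrable r g)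
  have eq: "power_form r v (v - u) - power_form r u (v - u) = (LINT x|lborel. ?f x)"
    unfolding power_form_def
    by (rule Bochner_Integration.integral_diff[symmetric, OF power_form_integrable[OF r g] power_form_integrable[OF r g]])
  have "weighted_difference r u v / 2 = (LINT x|lborel. ?w x / 2 * (norm (?D x))\<^sup>2)"
    unfolding weighted_difference_def by simp
  also have "\<dots> \<le> (LINT x|lborel. ?f x)"
  proof (rule integral_mono_AE[OF _ i])
    show "integrable lborel (\<lambda>x. ?w x / 2 * (norm (?D x))\<^sup>2)"
      using weighted_difference_integrable[of u v] by simp
    show "AE x in lborel. ?w x / 2 * (norm (?D x))\<^sup>2 \<le> ?f x"
      using h1_diff_AE(1)[of v u]
    proof eventually_elim
      case (elim x)
      show ?case
        using norm_powr_monotone[of "r - 2" "?V x" "?U x"] r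
        by (simp add: elim inner_diff_left add.commute)
    qed
  qed
  finally show "weighted_difference r u v / 2 \<le> power_form r v (v - u) - power_form r u (v - u)"
    unfolding eq .
  have "\<bar>LINT x|lborel. ?f x\<bar> \<le> (LINT x|lborel. \<bar>?f x\<bar>)" by (rule integral_abs_bound)
  also have "\<dots> \<le> (LINT x|lborel. (r - 1) * (?w x * (norm (?D x))\<^sup>2))"
  proof (rule integral_mono_AE)
    show "integrable lborel (\<lambda>x. (r - 1) * (?w x * (norm (?D x))\<^sup>2))"
      by (intro integrable_mult_right weighted_difference_integrable)
    show "AE x in lborel. \<bar>?f x\<bar> \<le> (r - 1) * (?w x * (norm (?D x))\<^sup>2)"
      using h1_diff_AE(1)[of v u]
    proof eventually_elim
      case (elim x)
      have "\<bar>?f x\<bar> = \<bar>(norm (?V x) powr (r - 2) *\<^sub>R ?V x - norm (?U x) powr (r - 2) *\<^sub>R ?U x) \<bullet> ?D x\<bar>"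
        by (simp add: inner_diff_left)
      also have "\<dots> \<le> norm (norm (?V x) powr (r - 2) *\<^sub>R ?V x - norm (?U x) powr (r - 2) *\<^sub>R ?U x) * norm (?D x)"
        by (rule Cauchy_Schwarz_ineq2)
      also have "\<dots> \<le> ((1 + (r - 2)) * (norm (?V x) powr (r - 2) + norm (?U x) powr (r - 2)) * norm (?V x - ?U x)) * norm (?D x)"
        using r by (intro mult_right_mono norm_powr_scaleR_diff_le) auto
      also have "\<dots> = (r - 1) * (?w x * (norm (?D x))\<^sup>2)" by (simp add: elim power2_eq_square algebra_simps)
      finally show ?case .
    qed
  qed (rule integrable_abs[OF i])
  also have "\<dots> = (r - 1) * weighted_difference r u v" unfolding weighted_difference_def by simp
  finally show "\<bar>power_form r v (v - u) - power_form r u (v - u)\<bar> \<le> (r - 1) * weighted_difference r u v"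
    unfolding eq .
qed

end

text \<open>Pointwise, \<open>a powr (q - 2)\<close> is at most
  \<open>\<epsilon> * a powr (p - 2)\<close> for large \<open>a\<close> and bounded otherwise; the
  threshold \<open>R\<close> solves \<open>R powr (q - p) = \<epsilon>\<close>, which is possible
  since \<open>q < p\<close>.\<close>

lemma weighted_difference_interpolate:
  assumes p: "p > 2" "gam CARD('n::finite) p < 1" and q: "q > 2" "gam CARD('n) q < 1" and qp: "q < p" and \<epsilon>: "\<epsilon> > 0"
  shows "\<exists>C\<ge>0. \<forall>u v :: 'n h1. weighted_difference q u v \<le> \<epsilon> * weighted_difference p u v + C * mass_form (v - u) (v - u)"
proof -
  define R where "R = \<epsilon> powr (1 / (q - p))"
  have R: "R > 0" "R powr (q - p) = \<epsilon>" using \<epsilon> qp by (auto simp: R_def powr_powr)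
  have pt: "a powr (q - 2) \<le> \<epsilon> * a powr (p - 2) + R powr (q - 2)" if "a \<ge> 0" for a :: real
  proof (cases "a \<le> R")
    case True
    have "0 \<le> \<epsilon> * a powr (p - 2)" using \<epsilon> by simp
    moreover have "a powr (q - 2) \<le> R powr (q - 2)" using True that q by (intro powr_mono2) auto
    ultimately show ?thesis by linarith
  next
    case False
    have "a powr (q - 2) = a powr (q - p) * a powr (p - 2)" by (simp add: powr_add[symmetric])
    also have "\<dots> \<le> R powr (q - p) * a powr (p - 2)"
      using False R qp by (intro mult_right_mono powr_mono2') auto
    finally have "a powr (q - 2) \<le> \<epsilon> * a powr (p - 2)" by (simp add: R)
    moreover have "0 \<le> R powr (q - 2)" by simp
    ultimately show ?thesis by linarith
  qed
  let ?C = "2 * R powr (q - 2)"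
  have "weighted_difference q u v \<le> \<epsilon> * weighted_difference p u v + ?C * mass_form (v - u) (v - u)" for u v :: "'n h1"
  proof -
    let ?U = "rep_h1 u" and ?V = "rep_h1 v" and ?D = "rep_h1 (v - u)"
    have D: "integrable lborel (\<lambda>x. (norm (?D x))\<^sup>2)"
      using h1_square_integrable(1)[of "v - u"] by (simp add: square_integrable_def)
    note W = weighted_difference_integrable[OF p, of u v]
    have "weighted_difference q u v \<le> (LINT x|lborel. \<epsilon> * ((norm (?U x) powr (p - 2) + norm (?V x) powr (p - 2)) * (norm (?D x))\<^sup>2) + ?C * (norm (?D x))\<^sup>2)"
      unfolding weighted_difference_def
    proof (rule integral_mono)
      fix x
      have "norm (?U x) powr (q - 2) + norm (?V x) powr (q - 2) \<le> \<epsilon> * (norm (?U x) powr (p - 2) + norm (?V x) powr (p - 2)) + ?C"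
        using pt[of "norm (?U x)"] pt[of "norm (?V x)"] by (simp add: distrib_left)
      then have "(norm (?U x) powr (q - 2) + norm (?V x) powr (q - 2)) * (norm (?D x))\<^sup>2 \<le>
         (\<epsilon> * (norm (?U x) powr (p - 2) + norm (?V x) powr (p - 2)) + ?C) * (norm (?D x))\<^sup>2"
        by (rule mult_right_mono) simp
      then show "(norm (?U x) powr (q - 2) + norm (?V x) powr (q - 2)) * (norm (?D x))\<^sup>2 \<le>
         \<epsilon> * ((norm (?U x) powr (p - 2) + norm (?V x) powr (p - 2)) * (norm (?D x))\<^sup>2) + ?C * (norm (?D x))\<^sup>2"
        by (simp only: distrib_right mult.assoc)
    qed (use W D weighted_difference_integrable[OF q, of u v] in auto)
    also have "\<dots> = \<epsilon> * weighted_difference p u v + ?C * (L2_square ?D)"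
      unfolding weighted_difference_def
      by (subst Bochner_Integration.integral_add) (use W D in auto)
    finally show ?thesis by (simp add: mass_form_def power2_norm_eq_inner)
  qed
  then show ?thesis by (intro exI[of _ ?C]) auto
qed

text \<open>Both powers on the right have degree less than 2, so the square absorbs them. For
  \<open>z > 1\<close> all three terms are replaced by the largest power.\<close>

lemma powr_self_bound:
  fixes z M \<gamma> \<delta> :: real
  assumes z: "0 \<le> z" and M: "0 \<le> M" and g: "0 \<le> \<gamma>" "\<gamma> < 1" "0 \<le> \<delta>" "\<delta> < 1"
    and le: "z\<^sup>2 \<le> M * (z powr (2 * \<gamma>) + z powr (2 * \<delta>) + 1)"
  shows "z \<le> max 1 ((3 * M) powr (1 / (2 * (1 - max \<gamma> \<delta>))))"
proof (cases "z \<le> 1")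
  case False
  let ?m = "max \<gamma> \<delta>"
  have m: "0 \<le> ?m" "?m < 1" using g by auto
  have "z powr (2 * \<gamma>) \<le> z powr (2 * ?m)" "z powr (2 * \<delta>) \<le> z powr (2 * ?m)" "1 \<le> z powr (2 * ?m)"
    using False m by (auto intro!: powr_mono ge_one_powr_ge_zero)
  then have "M * (z powr (2 * \<gamma>) + z powr (2 * \<delta>) + 1) \<le> M * (3 * z powr (2 * ?m))"
    using M by (intro mult_left_mono) auto
  with le have "z\<^sup>2 \<le> 3 * M * z powr (2 * ?m)" by simp
  moreover have "z\<^sup>2 = z powr (2 * (1 - ?m)) * z powr (2 * ?m)"
    using False by (simp add: powr_add[symmetric] powr_numeral algebra_simps)
  ultimately have "z powr (2 * (1 - ?m)) \<le> 3 * M" using False by simp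
  then have "(z powr (2 * (1 - ?m))) powr (1 / (2 * (1 - ?m))) \<le> (3 * M) powr (1 / (2 * (1 - ?m)))"
    using m by (intro powr_mono2) auto
  then show ?thesis using False m by (simp add: powr_powr)
qed simp

text \<open>The mass of the increment is of order \<open>|k|^2\<close> for every Sobolev function.
  In the elliptic case the Gagliardo-Nirenberg inequality puts the exponent
  \<open>2 \<gamma>\<close> on the gradient of the increment and \<open>2 - 2 \<gamma>\<close> on
  its \<open>L^2\<close> norm, so the tested difference equation becomes a self-bound for the ratio
  \<open>z\<close> with powers below 2.\<close>

theorem translation_bounds:
  fixes u :: "'n::finite h1"
  assumes p: "p > 2" "gam CARD('n) p < 1" and q: "q > 2" "gam CARD('n) q < 1" and qp: "q < p"
    and sol: "weak_solution c \<alpha> \<beta> \<nu> p q u" and nz: "c \<noteq> 0 \<or> \<alpha> \<noteq> 0"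
  shows "\<exists>M. \<forall>k. weighted_difference p u (shift_h1 k u) \<le> M * (norm k)\<^sup>2 \<and>
     weighted_difference q u (shift_h1 k u) \<le> M * (norm k)\<^sup>2 \<and>
     (c \<noteq> 0 \<longrightarrow> grad_form (shift_h1 k u - u) (shift_h1 k u - u) \<le> M * (norm k)\<^sup>2)"
proof -
  define D where "D r k = power_form r (shift_h1 k u) (shift_h1 k u - u) - power_form r u (shift_h1 k u - u)" for r k
  let ?w = "\<lambda>k. shift_h1 k u - u"
  have eq: "c * grad_form (?w k) (?w k) = \<alpha> * D p k + \<beta> * D q k + \<nu> * mass_form (?w k) (?w k)" for k
  proof -
    have *: "B (v - u) h = B v h - B u h" if "bounded_bilinear B" for B :: "'n h1 \<Rightarrow> 'n h1 \<Rightarrow> real" and v h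
      using bounded_bilinear.diff_left[OF that] .
    show ?thesis
      using sol[unfolded weak_solution_def, rule_format, of "?w k"]
        weak_solution_shift[OF sol, unfolded weak_solution_def, rule_format, of k "?w k"]
      unfolding D_def *[OF bounded_bilinear_forms(1)] *[OF bounded_bilinear_forms(2)]
      by (simp add: algebra_simps)
  qed
  let ?S = "Lnorm 2 (h1_grad u)"
  have mass: "mass_form (?w k) (?w k) \<le> ?S\<^sup>2 * (norm k)\<^sup>2" for k
    using power_mono[OF Lnorm_shift_diff_le[of k u], of 2] by (simp add: form_self power_mult_distrib mult.commute)
  have mass0: "0 \<le> mass_form (?w k) (?w k)" for k by (simp add: form_self)
  show ?thesis
  proof (cases "c = 0")
    case True \<comment> \<open>without a gradient term, monotonicity of the \<open>p\<close>-th power nonlinearity gives the control\<close>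
    then have \<alpha>: "\<alpha> \<noteq> 0" using nz by simp
    \<comment> \<open>Monotonicity supplies half of \<open>\<bar>\<alpha>\<bar>\<close> times the
      weighted difference; with this choice the \<open>q\<close>-term consumes at most a quarter,
      and a quarter remains. The summand 1 avoids division by 0 when
      \<open>\<beta> = 0\<close>.\<close>
    define \<epsilon> where "\<epsilon> = \<bar>\<alpha>\<bar> / (4 * (\<bar>\<beta>\<bar> * (q - 1) + 1))"
    have \<beta>0: "0 \<le> \<bar>\<beta>\<bar> * (q - 1)" using q by simp
    have \<epsilon>: "\<epsilon> > 0" unfolding \<epsilon>_def using \<alpha> \<beta>0 by simp
    have \<epsilon>2: "\<bar>\<beta>\<bar> * (q - 1) * \<epsilon> \<le> \<bar>\<alpha>\<bar> / 4" unfolding \<epsilon>_def using \<beta>0 by (simp add: field_simps)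
    obtain C where C: "C \<ge> 0" and int: "\<And>u v :: 'n h1. weighted_difference q u v \<le> \<epsilon> * weighted_difference p u v + C * mass_form (v - u) (v - u)"
      using weighted_difference_interpolate[OF p q qp \<epsilon>] by blast
    define M1 where "M1 = (\<bar>\<beta>\<bar> * (q - 1) * C + \<bar>\<nu>\<bar>) * ?S\<^sup>2 * (4 / \<bar>\<alpha>\<bar>)"
    have M1: "weighted_difference p u (shift_h1 k u) \<le> M1 * (norm k)\<^sup>2" for k
    proof -
      let ?v = "shift_h1 k u" and ?m = "mass_form (?w k) (?w k)"
      have "\<bar>\<alpha>\<bar> * (weighted_difference p u ?v / 2) \<le> \<bar>\<alpha>\<bar> * D p k"
        unfolding D_def by (intro mult_left_mono power_form_monotone p) auto
      also have "\<dots> \<le> \<bar>\<alpha> * D p k\<bar>" by (simp add: abs_mult mult_left_mono)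
      also have "\<alpha> * D p k = - (\<beta> * D q k + \<nu> * ?m)" using eq[of k] True by simp
      also have "\<bar>\<dots>\<bar> \<le> \<bar>\<beta>\<bar> * \<bar>D q k\<bar> + \<bar>\<nu>\<bar> * ?m"
        using mass0[of k] abs_triangle_ineq[of "\<beta> * D q k" "\<nu> * ?m"] by (simp add: abs_mult)
      also have "\<dots> \<le> \<bar>\<beta>\<bar> * ((q - 1) * weighted_difference q u ?v) + \<bar>\<nu>\<bar> * ?m"
        unfolding D_def by (intro add_mono mult_left_mono power_form_diff_le_weighted q) auto
      also have "\<dots> \<le> \<bar>\<beta>\<bar> * ((q - 1) * (\<epsilon> * weighted_difference p u ?v + C * ?m)) + \<bar>\<nu>\<bar> * ?m"
        using q by (intro add_mono mult_left_mono int) auto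
      also have "\<dots> = (\<bar>\<beta>\<bar> * (q - 1) * \<epsilon>) * weighted_difference p u ?v + (\<bar>\<beta>\<bar> * (q - 1) * C + \<bar>\<nu>\<bar>) * ?m"
        by (simp add: algebra_simps)
      also have "\<dots> \<le> (\<bar>\<alpha>\<bar> / 4) * weighted_difference p u ?v + (\<bar>\<beta>\<bar> * (q - 1) * C + \<bar>\<nu>\<bar>) * (?S\<^sup>2 * (norm k)\<^sup>2)"
        using \<beta>0 C by (intro add_mono mult_right_mono mult_left_mono \<epsilon>2 mass weighted_difference_nonneg) auto
      finally have "(\<bar>\<alpha>\<bar> / 4) * weighted_difference p u ?v \<le> (\<bar>\<beta>\<bar> * (q - 1) * C + \<bar>\<nu>\<bar>) * (?S\<^sup>2 * (norm k)\<^sup>2)"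
        by simp
      then show ?thesis unfolding M1_def using \<alpha> by (simp add: field_simps)
    qed
    have M2: "weighted_difference q u (shift_h1 k u) \<le> (\<epsilon> * M1 + C * ?S\<^sup>2) * (norm k)\<^sup>2" for k
    proof -
      have "weighted_difference q u (shift_h1 k u) \<le> \<epsilon> * (M1 * (norm k)\<^sup>2) + C * (?S\<^sup>2 * (norm k)\<^sup>2)"
        using \<epsilon> C by (intro order_trans[OF int] add_mono mult_left_mono M1 mass) auto
      then show ?thesis by (simp add: algebra_simps)
    qed
    have "weighted_difference p u (shift_h1 k u) \<le> max M1 (\<epsilon> * M1 + C * ?S\<^sup>2) * (norm k)\<^sup>2 \<and>
       weighted_difference q u (shift_h1 k u) \<le> max M1 (\<epsilon> * M1 + C * ?S\<^sup>2) * (norm k)\<^sup>2" for k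
      by (intro conjI order_trans[OF M1] order_trans[OF M2] mult_right_mono) auto
    with True show ?thesis by blast
  next
    case False
    let ?gp = "gam CARD('n) p" and ?gq = "gam CARD('n) q"
    have g: "0 \<le> ?gp" "0 \<le> ?gq" using p q by (auto simp: gam_def)
    obtain Cp where Cp: "Cp \<ge> 0" and gnp: "\<And>u :: 'n h1. Lnorm p (rep_h1 u) \<le>
       Cp * Lnorm 2 (h1_grad u) powr ?gp * Lnorm 2 (rep_h1 u) powr (1 - ?gp)"
      using gagliardo_nirenberg_h1[OF p] by blast
    obtain Cq where Cq: "Cq \<ge> 0" and gnq: "\<And>u :: 'n h1. Lnorm q (rep_h1 u) \<le>
       Cq * Lnorm 2 (h1_grad u) powr ?gq * Lnorm 2 (rep_h1 u) powr (1 - ?gq)"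
      using gagliardo_nirenberg_h1[OF q] by blast
    \<comment> \<open>The gradient norm of the increment per unit of translation. For
      \<open>k = 0\<close> it has the default value 0, and that case is treated apart.\<close>
    define z where "z k = Lnorm 2 (h1_grad (?w k)) / norm k" for k
    have L: "(Lnorm r (rep_h1 (?w k)))\<^sup>2 \<le> (C\<^sup>2 * ?S powr (2 * (1 - gam CARD('n) r))) * z k powr (2 * gam CARD('n) r) * (norm k)\<^sup>2"
      if C: "C \<ge> 0" and gn: "\<And>u :: 'n h1. Lnorm r (rep_h1 u) \<le>
       C * Lnorm 2 (h1_grad u) powr gam CARD('n) r * Lnorm 2 (rep_h1 u) powr (1 - gam CARD('n) r)"
       and g1: "gam CARD('n) r < 1" "0 \<le> gam CARD('n) r" and k: "k \<noteq> 0" for C r k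
    proof -
      let ?g = "gam CARD('n) r"
      have "Lnorm r (rep_h1 (?w k)) \<le> C * Lnorm 2 (h1_grad (?w k)) powr ?g * Lnorm 2 (rep_h1 (?w k)) powr (1 - ?g)"
        by (rule gn)
      also have "\<dots> \<le> C * (z k * norm k) powr ?g * (norm k * ?S) powr (1 - ?g)"
        using k g1 C by (intro mult_mono powr_mono2 Lnorm_shift_diff_le) (auto simp: z_def)
      also have "\<dots> = C * z k powr ?g * ?S powr (1 - ?g) * (norm k powr ?g * norm k powr (1 - ?g))"
      proof -
        have "0 \<le> z k" by (simp add: z_def)
        then show ?thesis by (simp add: powr_mult mult_ac)
      qed
      also have "norm k powr ?g * norm k powr (1 - ?g) = norm k" using k by (simp add: powr_add[symmetric])
      finally have "(Lnorm r (rep_h1 (?w k)))\<^sup>2 \<le> (C * z k powr ?g * ?S powr (1 - ?g) * norm k)\<^sup>2"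
        by (intro power_mono) auto
      also have "\<dots> = C\<^sup>2 * (z k powr ?g)\<^sup>2 * (?S powr (1 - ?g))\<^sup>2 * (norm k)\<^sup>2" by (simp add: power_mult_distrib)
      also have "(z k powr ?g)\<^sup>2 = z k powr (2 * ?g)" by (simp add: power2_eq_square powr_add[symmetric])
      also have "(?S powr (1 - ?g))\<^sup>2 = ?S powr (2 * (1 - ?g))" by (simp only: power2_eq_square powr_add[symmetric] mult_2)
      finally show ?thesis by (simp only: mult_ac)
    qed
    \<comment> \<open>The factor 6 is twice the 3 of the trilinear estimate, because
      \<open>u\<close> and its translate have the same \<open>L^p\<close> norm.\<close>
    define Kp where "Kp = 6 * Lnorm p (rep_h1 u) powr (p - 2) * (Cp\<^sup>2 * ?S powr (2 * (1 - ?gp)))"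
    define Kq where "Kq = 6 * Lnorm q (rep_h1 u) powr (q - 2) * (Cq\<^sup>2 * ?S powr (2 * (1 - ?gq)))"
    have K0: "0 \<le> Kp" "0 \<le> Kq" by (simp_all add: Kp_def Kq_def)
    have wp: "weighted_difference p u (shift_h1 k u) \<le> Kp * z k powr (2 * ?gp) * (norm k)\<^sup>2" if "k \<noteq> 0" for k
    proof -
      have "weighted_difference p u (shift_h1 k u) \<le> 6 * Lnorm p (rep_h1 u) powr (p - 2) * (Lnorm p (rep_h1 (?w k)))\<^sup>2"
        using weighted_difference_le[OF p, of u "shift_h1 k u"] by (simp add: Lnorm_shift_h1)
      also have "\<dots> \<le> 6 * Lnorm p (rep_h1 u) powr (p - 2) * ((Cp\<^sup>2 * ?S powr (2 * (1 - ?gp))) * z k powr (2 * ?gp) * (norm k)\<^sup>2)"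
        by (intro mult_left_mono L Cp gnp p g that) auto
      finally show ?thesis unfolding Kp_def by (simp only: mult.assoc)
    qed
    have wq: "weighted_difference q u (shift_h1 k u) \<le> Kq * z k powr (2 * ?gq) * (norm k)\<^sup>2" if "k \<noteq> 0" for k
    proof -
      have "weighted_difference q u (shift_h1 k u) \<le> 6 * Lnorm q (rep_h1 u) powr (q - 2) * (Lnorm q (rep_h1 (?w k)))\<^sup>2"
        using weighted_difference_le[OF q, of u "shift_h1 k u"] by (simp add: Lnorm_shift_h1)
      also have "\<dots> \<le> 6 * Lnorm q (rep_h1 u) powr (q - 2) * ((Cq\<^sup>2 * ?S powr (2 * (1 - ?gq))) * z k powr (2 * ?gq) * (norm k)\<^sup>2)"
        by (intro mult_left_mono L Cq gnq q g that) auto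
      finally show ?thesis unfolding Kq_def by (simp only: mult.assoc)
    qed
    define M where "M = (\<bar>\<alpha>\<bar> * (p - 1) * Kp + \<bar>\<beta>\<bar> * (q - 1) * Kq + \<bar>\<nu>\<bar> * ?S\<^sup>2) / \<bar>c\<bar>"
    have M0: "0 \<le> M" unfolding M_def using p q K0 by (intro divide_nonneg_nonneg add_nonneg_nonneg mult_nonneg_nonneg) auto
    have z0: "0 \<le> z k" for k by (simp add: z_def)
    have zle: "(z k)\<^sup>2 \<le> M * (z k powr (2 * ?gp) + z k powr (2 * ?gq) + 1)" if k: "k \<noteq> 0" for k
    proof -
      let ?m = "mass_form (?w k) (?w k)"
      have "\<bar>c\<bar> * grad_form (?w k) (?w k) = \<bar>c * grad_form (?w k) (?w k)\<bar>" by (simp add: abs_mult form_self)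
      also have "\<dots> = \<bar>\<alpha> * D p k + \<beta> * D q k + \<nu> * ?m\<bar>" by (simp only: eq)
      also have "\<dots> \<le> \<bar>\<alpha>\<bar> * \<bar>D p k\<bar> + \<bar>\<beta>\<bar> * \<bar>D q k\<bar> + \<bar>\<nu>\<bar> * ?m"
        using mass0[of k] abs_triangle_ineq[of "\<alpha> * D p k + \<beta> * D q k" "\<nu> * ?m"] abs_triangle_ineq[of "\<alpha> * D p k" "\<beta> * D q k"]
        by (simp add: abs_mult)
      also have "\<dots> \<le> \<bar>\<alpha>\<bar> * ((p - 1) * weighted_difference p u (shift_h1 k u)) +
           \<bar>\<beta>\<bar> * ((q - 1) * weighted_difference q u (shift_h1 k u)) + \<bar>\<nu>\<bar> * (?S\<^sup>2 * (norm k)\<^sup>2)"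
        unfolding D_def by (intro add_mono mult_left_mono power_form_diff_le_weighted p q mass) auto
      also have "\<dots> \<le> \<bar>\<alpha>\<bar> * ((p - 1) * (Kp * z k powr (2 * ?gp) * (norm k)\<^sup>2)) +
           \<bar>\<beta>\<bar> * ((q - 1) * (Kq * z k powr (2 * ?gq) * (norm k)\<^sup>2)) + \<bar>\<nu>\<bar> * (?S\<^sup>2 * (norm k)\<^sup>2)"
        using p q by (intro add_mono mult_left_mono wp wq k order_refl) auto
      also have "\<dots> \<le> ((\<bar>\<alpha>\<bar> * (p - 1) * Kp + \<bar>\<beta>\<bar> * (q - 1) * Kq + \<bar>\<nu>\<bar> * ?S\<^sup>2) *
          (z k powr (2 * ?gp) + z k powr (2 * ?gq) + 1)) * (norm k)\<^sup>2"
      proof -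
        have gen: "A * x + B * y + E * 1 \<le> (A + B + E) * (x + y + 1)"
          if "0 \<le> A" "0 \<le> B" "0 \<le> E" "0 \<le> x" "0 \<le> y" for A B E x y :: real
        proof -
          have "0 \<le> A * y + A + B * x + B + E * x + E * y" using that by simp
          then show ?thesis by (simp add: algebra_simps)
        qed
        have "(\<bar>\<alpha>\<bar> * (p - 1) * Kp) * z k powr (2 * ?gp) + (\<bar>\<beta>\<bar> * (q - 1) * Kq) * z k powr (2 * ?gq) + (\<bar>\<nu>\<bar> * ?S\<^sup>2) * 1
          \<le> (\<bar>\<alpha>\<bar> * (p - 1) * Kp + \<bar>\<beta>\<bar> * (q - 1) * Kq + \<bar>\<nu>\<bar> * ?S\<^sup>2) * (z k powr (2 * ?gp) + z k powr (2 * ?gq) + 1)"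
          using p q K0 by (intro gen mult_nonneg_nonneg) auto
        from mult_right_mono[OF this, of "(norm k)\<^sup>2"] show ?thesis by (simp add: distrib_right mult.assoc)
      qed
      finally have "\<bar>c\<bar> * grad_form (?w k) (?w k) \<le> \<dots>" .
      moreover have "grad_form (?w k) (?w k) = (z k)\<^sup>2 * (norm k)\<^sup>2" using k by (simp add: form_self z_def power_divide)
      ultimately have "(\<bar>c\<bar> * (z k)\<^sup>2) * (norm k)\<^sup>2 \<le> ((\<bar>\<alpha>\<bar> * (p - 1) * Kp + \<bar>\<beta>\<bar> * (q - 1) * Kq + \<bar>\<nu>\<bar> * ?S\<^sup>2) *
          (z k powr (2 * ?gp) + z k powr (2 * ?gq) + 1)) * (norm k)\<^sup>2" by (simp only: mult.assoc)
      then have "\<bar>c\<bar> * (z k)\<^sup>2 \<le> (\<bar>\<alpha>\<bar> * (p - 1) * Kp + \<bar>\<beta>\<bar> * (q - 1) * Kq + \<bar>\<nu>\<bar> * ?S\<^sup>2) *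
          (z k powr (2 * ?gp) + z k powr (2 * ?gq) + 1)"
        by (rule mult_right_le_imp_le) (use k in simp)
      then show ?thesis unfolding M_def using False by (simp add: field_simps)
    qed
    define Z where "Z = max 1 ((3 * M) powr (1 / (2 * (1 - max ?gp ?gq))))"
    have Z: "z k \<le> Z" if "k \<noteq> 0" for k
      unfolding Z_def by (rule powr_self_bound[OF z0 M0 g(1) p(2) g(2) q(2) zle[OF that]])
    define K where "K = Kp * Z powr (2 * ?gp) + Kq * Z powr (2 * ?gq) + Z\<^sup>2"
    have Kle: "Kp * Z powr (2 * ?gp) \<le> K" "Kq * Z powr (2 * ?gq) \<le> K" "Z\<^sup>2 \<le> K"
      unfolding K_def using K0 by auto
    have "weighted_difference p u (shift_h1 k u) \<le> K * (norm k)\<^sup>2 \<and>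
       weighted_difference q u (shift_h1 k u) \<le> K * (norm k)\<^sup>2 \<and>
       grad_form (?w k) (?w k) \<le> K * (norm k)\<^sup>2" for k
    proof (cases "k = 0")
      case True
      have "shift_h1 0 u = u"
      proof -
        have "norm (shift_h1 0 u - u) = 0"
        proof -
          have "AE x in lborel. (norm (rep_h1 (shift_h1 0 u - u) x))\<^sup>2 = 0"
            using shift_h1_diff_AE(1)[of 0 u] by eventually_elim simp
          then have "(L2_square (rep_h1 (shift_h1 0 u - u))) = 0" by (rule integral_eq_zero_AE)
          moreover have "AE x in lborel. (norm (h1_grad (shift_h1 0 u - u) x))\<^sup>2 = 0"
            using shift_h1_diff_AE(2)[of 0 u] by eventually_elim simp
          then have "(L2_square (h1_grad (shift_h1 0 u - u))) = 0" by (rule integral_eq_zero_AE)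
          ultimately show ?thesis using h1_norm_square[of "shift_h1 0 u - u"] by simp
        qed
        then show ?thesis by simp
      qed
      moreover have n0: "Lnorm 2 (rep_h1 (0 :: 'n h1)) = 0" "Lnorm 2 (h1_grad (0 :: 'n h1)) = 0"
        using Lnorm_2_le_h1[of "0 :: 'n h1"] Lnorm_nonneg[of 2 "rep_h1 (0 :: 'n h1)"] Lnorm_nonneg[of 2 "h1_grad (0 :: 'n h1)"]
        by simp_all
      have "AE x in lborel. rep_h1 (0 :: 'n h1) x = 0"
        using n0(1) h1_square_integrable(1)[of "0 :: 'n h1"]
        by (intro Lnorm_eq_0) (auto simp: square_integrable_def powr_numeral)
      then have "weighted_difference r u u = 0" for r
        unfolding weighted_difference_def by (intro integral_eq_zero_AE) (auto elim!: eventually_mono)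
      ultimately show ?thesis using True n0 by (simp add: form_self)
    next
      case False
      note zk = z0[of k] Z[OF False]
      have "Kp * z k powr (2 * ?gp) \<le> Kp * Z powr (2 * ?gp)"
        using g by (intro mult_left_mono powr_mono2 zk K0) auto
      with Kle have 1: "Kp * z k powr (2 * ?gp) \<le> K" by linarith
      have "Kq * z k powr (2 * ?gq) \<le> Kq * Z powr (2 * ?gq)"
        using g by (intro mult_left_mono powr_mono2 zk K0) auto
      with Kle have 2: "Kq * z k powr (2 * ?gq) \<le> K" by linarith
      have "(z k)\<^sup>2 \<le> Z\<^sup>2" by (intro power_mono zk)
      with Kle have 3: "(z k)\<^sup>2 \<le> K" by linarith
      have "grad_form (?w k) (?w k) = (z k)\<^sup>2 * (norm k)\<^sup>2" using False by (simp add: form_self z_def power_divide)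
      also have "\<dots> \<le> K * (norm k)\<^sup>2" by (intro mult_right_mono 3) auto
      finally show ?thesis
        using order_trans[OF wp[OF False] mult_right_mono[OF 1]] order_trans[OF wq[OF False] mult_right_mono[OF 2]]
        by simp
    qed
    then show ?thesis by blast
  qed
qed

section \<open>The Pohozaev identity\<close>

text \<open>
  A smooth bounded substitute for the coordinate \<open>x\<^sub>i\<close>: its derivative \<open>cos (x\<^sub>i / R)\<close> is bounded by \<open>1\<close> and
  tends to \<open>1\<close> as \<open>R \<rightarrow> \<infinity>\<close>.
\<close>
definition cutoff :: "real \<Rightarrow> 'n::finite \<Rightarrow> real^'n \<Rightarrow> real" where
  "cutoff R i x = R * sin (x $ i / R)"

text \<open>Differentiation advances the phase by \<open>pi / 2\<close> and rescales the amplitude,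
  so the family with free \<open>c\<close> and \<open>d\<close> is closed under partial derivatives
  and the induction goes through.\<close>

lemma Ck_sin_nth: "Ck k (\<lambda>x::real^'n::finite. c * sin (b * x $ i + d))"
proof (induction k arbitrary: c d)
  case 0
  show ?case by (auto intro!: continuous_intros)
next
  case (Suc k)
  show ?case
  proof (rule Ck_SucI)
    fix x :: "real^'n"
    have "((\<lambda>x. x $ i) has_derivative (\<lambda>h. h $ i)) (at x)"
      by (rule bounded_linear_imp_has_derivative[OF bounded_linear_vec_nth])
    then show "((\<lambda>x. c * sin (b * x $ i + d)) has_derivative (\<lambda>h. (c * b * h $ i) * sin (b * x $ i + (d + pi / 2)))) (at x)"
      by (auto intro!: derivative_eq_intros simp: sin_add cos_add algebra_simps)
  next
    fix j
    show "Ck k (\<lambda>x. (c * b * axis j 1 $ i) * sin (b * x $ i + (d + pi / 2)))" by (rule Suc)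
  qed
qed

lemma cutoff_Ck: "Ck k (cutoff R i)"
  using Ck_sin_nth[of k R "1 / R" i 0] by (simp add: cutoff_def[abs_def])

lemma cutoff_derivative:
  assumes "R > 0"
  shows "frechet_derivative (cutoff R i) (at x) h = cos (x $ i / R) * h $ i"
proof -
  have "((\<lambda>x. x $ i) has_derivative (\<lambda>h. h $ i)) (at x)"
    by (rule bounded_linear_imp_has_derivative[OF bounded_linear_vec_nth])
  then have "(cutoff R i has_derivative (\<lambda>h. cos (x $ i / R) * h $ i)) (at x)"
    unfolding cutoff_def[abs_def] using assms
    by (auto intro!: derivative_eq_intros simp: field_simps)
  from frechet_derivative_at[OF this] show ?thesis by metis
qed

lemma cutoff_abs_le: "R > 0 \<Longrightarrow> \<bar>cutoff R i x\<bar> \<le> R"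
  by (simp add: cutoff_def abs_mult mult_left_le)

lemma cutoff_measurable [measurable]: "cutoff R i \<in> borel_measurable borel"
  unfolding cutoff_def[abs_def] by measurable

text \<open>The constant 1 does not depend on \<open>R\<close>, because the amplitude
  \<open>R\<close> cancels the frequency \<open>1 / R\<close>.\<close>

lemma cutoff_lipschitz:
  assumes "R > 0"
  shows "\<bar>cutoff R i x - cutoff R i y\<bar> \<le> \<bar>x $ i - y $ i\<bar>"
proof -
  have "\<bar>sin a - sin b\<bar> \<le> \<bar>a - b\<bar>" for a b :: real
  proof -
    have "\<bar>sin a - sin b\<bar> = 2 * \<bar>sin ((a - b) / 2)\<bar> * \<bar>cos ((a + b) / 2)\<bar>"
      by (simp add: sin_diff_sin abs_mult)
    also have "\<dots> \<le> 2 * \<bar>(a - b) / 2\<bar> * 1"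
      by (intro mult_mono abs_sin_x_le_abs_x abs_cos_le_one) auto
    finally show ?thesis by simp
  qed
  from this[of "x $ i / R" "y $ i / R"]
  have "R * \<bar>sin (x $ i / R) - sin (y $ i / R)\<bar> \<le> R * \<bar>x $ i / R - y $ i / R\<bar>"
    using assms by (intro mult_left_mono) auto
  also have "\<dots> = \<bar>R * (x $ i / R - y $ i / R)\<bar>" using assms by (simp add: abs_mult)
  also have "R * (x $ i / R - y $ i / R) = x $ i - y $ i" using assms by (simp add: field_simps)
  finally show ?thesis
    using assms by (simp add: cutoff_def abs_mult right_diff_distrib[symmetric])
qed

definition mult_h1 :: "real \<Rightarrow> 'n::finite \<Rightarrow> 'n h1 \<Rightarrow> 'n h1" where
  "mult_h1 R i w = abs_h1 (\<lambda>x. cutoff R i x *\<^sub>R rep_h1 w x)"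

lemma mult_h1_AE:
  assumes R: "R > 0"
  shows "AE x in lborel. rep_h1 (mult_h1 R i w) x = cutoff R i x *\<^sub>R rep_h1 w x"
    and "AE x in lborel. h1_grad (mult_h1 R i w) x =
      cutoff R i x *\<^sub>R h1_grad w x + (\<chi> j. (cos (x $ i / R) * axis j 1 $ i) *\<^sub>R rep_h1 w x)"
proof -
  have K: "\<bar>cutoff R i x\<bar> \<le> max R 1" for x using cutoff_abs_le[OF R, of i x] by simp
  have K': "\<bar>frechet_derivative (cutoff R i) (at x) (axis j 1)\<bar> \<le> max R 1" for x j
    by (simp add: cutoff_derivative[OF R] axis_def max.coboundedI2)
  note m = weak_gradient_mult[OF h1_sobolev cutoff_Ck K K', of w]
  note * = abs_h1_AE[OF m(1)]
  show "AE x in lborel. rep_h1 (mult_h1 R i w) x = cutoff R i x *\<^sub>R rep_h1 w x"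
    unfolding mult_h1_def by (rule *)
  show "AE x in lborel. h1_grad (mult_h1 R i w) x =
      cutoff R i x *\<^sub>R h1_grad w x + (\<chi> j. (cos (x $ i / R) * axis j 1 $ i) *\<^sub>R rep_h1 w x)"
    using *(2) m(2) unfolding mult_h1_def
    by eventually_elim (simp add: h1_grad_def cutoff_derivative[OF R])
qed

section \<open>Testing with cutoff difference quotients\<close>

definition step :: "'n::finite \<Rightarrow> nat \<Rightarrow> real^'n" where
  "step i n = (1 / real (Suc n)) *\<^sub>R axis i 1"

lemma norm_step: "norm (step i n) = 1 / real (Suc n)"
  by (simp add: step_def norm_axis_1)

lemma integrable_bounded_mult:
  fixes f :: "real^'n::finite \<Rightarrow> real"
  assumes f: "integrable lborel f" and [measurable]: "\<eta> \<in> borel_measurable borel" and b: "\<And>x. \<bar>\<eta> x\<bar> \<le> K"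
  shows "integrable lborel (\<lambda>x. \<eta> x * f x)"
proof (rule Bochner_Integration.integrable_bound)
  show "integrable lborel (\<lambda>x. K * f x)" using f by simp
  have [measurable]: "f \<in> borel_measurable borel" using f by auto
  show "(\<lambda>x. \<eta> x * f x) \<in> borel_measurable lborel" by measurable
  show "AE x in lborel. norm (\<eta> x * f x) \<le> norm (K * f x)"
    using b by (intro AE_I2) (auto simp: abs_mult intro!: mult_right_mono order_trans[OF b])
qed

text \<open>A discrete integration by parts: with the translation moved onto the cutoff, the limit
  exists for merely integrable \<open>f\<close>. The difference quotients of the cutoff are bounded
  by 1 and converge pointwise, so dominated convergence applies.\<close>

lemma cutoff_slope:
  fixes f :: "real^'n::finite \<Rightarrow> real"
  assumes f: "integrable lborel f" and R: "R > 0"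
  shows "(\<lambda>n. real (Suc n) * (LINT x|lborel. cutoff R i x * (f (x + step i n) - f x)))
    \<longlonglongrightarrow> - (LINT x|lborel. cos (x $ i / R) * f x)"
proof -
  have [measurable]: "f \<in> borel_measurable borel" using f by auto
  define s where "s n x = real (Suc n) * (cutoff R i (x + - step i n) - cutoff R i x)" for n x
  have eq: "real (Suc n) * (LINT x|lborel. cutoff R i x * (f (x + step i n) - f x)) = (LINT x|lborel. s n x * f x)" for n
  proof -
    have i1: "integrable lborel (\<lambda>x. cutoff R i x * f (x + step i n))"
      by (rule integrable_bounded_mult[OF integrable_lborel_shift[OF f] _ cutoff_abs_le[OF R]]) measurable
    have i2: "integrable lborel (\<lambda>x. cutoff R i x * f x)"
      by (rule integrable_bounded_mult[OF f _ cutoff_abs_le[OF R]]) measurable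
    have i3: "integrable lborel (\<lambda>x. cutoff R i (x + - step i n) * f x)"
      by (rule integrable_bounded_mult[OF f _ cutoff_abs_le[OF R]]) measurable
    have "(LINT x|lborel. cutoff R i x * (f (x + step i n) - f x)) =
        (LINT x|lborel. cutoff R i x * f (x + step i n)) - (LINT x|lborel. cutoff R i x * f x)"
      unfolding right_diff_distrib by (rule Bochner_Integration.integral_diff[OF i1 i2])
    also have "(LINT x|lborel. cutoff R i x * f (x + step i n)) =
        (LINT x|lborel. cutoff R i (x + - step i n) * f (x + - step i n + step i n))"
      by (rule integral_lborel_shift[symmetric]) measurable
    also have "\<dots> = (LINT x|lborel. cutoff R i (x + - step i n) * f x)" by simp
    also have "\<dots> - (LINT x|lborel. cutoff R i x * f x) =
        (LINT x|lborel. (cutoff R i (x + - step i n) - cutoff R i x) * f x)"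
      unfolding left_diff_distrib by (rule Bochner_Integration.integral_diff[symmetric, OF i3 i2])
    finally show ?thesis unfolding s_def mult.assoc by simp
  qed
  have s_le: "\<bar>s n x\<bar> \<le> 1" for n x
  proof -
    have "\<bar>cutoff R i (x + - step i n) - cutoff R i x\<bar> \<le> 1 / real (Suc n)"
      using cutoff_lipschitz[OF R, of i "x + - step i n" x] by (simp add: step_def)
    then have "real (Suc n) * \<bar>cutoff R i (x + - step i n) - cutoff R i x\<bar> \<le> real (Suc n) * (1 / real (Suc n))"
      by (intro mult_left_mono) auto
    then show ?thesis by (simp add: s_def abs_mult)
  qed
  have s_lim: "(\<lambda>n. s n x) \<longlonglongrightarrow> - cos (x $ i / R)" for x
  proof -
    have "((\<lambda>t. R * sin ((x $ i - t) / R)) has_real_derivative - cos (x $ i / R)) (at 0)"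
      using R by (auto intro!: derivative_eq_intros)
    then have d: "((\<lambda>t. (R * sin ((x $ i - t) / R) - R * sin (x $ i / R)) / t) \<longlongrightarrow> - cos (x $ i / R)) (at 0)"
      by (simp add: has_field_derivative_iff)
    have "filterlim (\<lambda>n. 1 / real (Suc n)) (at 0) sequentially"
      using LIMSEQ_inverse_real_of_nat by (auto simp: filterlim_at inverse_eq_divide)
    from filterlim_compose[OF d this] show ?thesis
      by (simp add: s_def cutoff_def step_def mult.commute)
  qed
  have "(\<lambda>n. LINT x|lborel. s n x * f x) \<longlonglongrightarrow> (LINT x|lborel. (- cos (x $ i / R)) * f x)"
  proof (rule integral_dominated_convergence[where w = "\<lambda>x. \<bar>f x\<bar>"])
    show "AE x in lborel. (\<lambda>n. s n x * f x) \<longlonglongrightarrow> - cos (x $ i / R) * f x"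
      by (intro AE_I2 tendsto_intros s_lim)
    show "AE x in lborel. norm (s n x * f x) \<le> \<bar>f x\<bar>" for n
      using s_le[of n] by (intro AE_I2) (simp add: abs_mult mult_left_le_one_le)
    show "integrable lborel (\<lambda>x. \<bar>f x\<bar>)" by (rule integrable_abs[OF f])
  qed (unfold s_def, measurable)
  then show ?thesis unfolding eq by simp
qed

text \<open>Here \<open>g n\<close> stands for the linear part of the increment of \<open>f\<close>.
  A remainder with integral of order \<open>(norm (step i n))\<^sup>2\<close> is still of order
  \<open>1 / real (Suc n)\<close> after multiplication by \<open>real (Suc n)\<close> and the
  bounded cutoff, so the limit is that of the full increment.\<close>

lemma cutoff_slope_remainder:
  fixes f :: "real^'n::finite \<Rightarrow> real"
  assumes f: "integrable lborel f" and R: "R > 0"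
    and g: "\<And>n. integrable lborel (g n)" and e: "\<And>n. integrable lborel (e n)"
    and le: "\<And>n. AE x in lborel. \<bar>f (x + step i n) - f x - g n x\<bar> \<le> e n x"
    and M: "\<And>n. (LINT x|lborel. e n x) \<le> M * (norm (step i n))\<^sup>2"
  shows "(\<lambda>n. real (Suc n) * (LINT x|lborel. cutoff R i x * g n x)) \<longlonglongrightarrow> - (LINT x|lborel. cos (x $ i / R) * f x)"
proof -
  let ?A = "\<lambda>n. real (Suc n) * (LINT x|lborel. cutoff R i x * (f (x + step i n) - f x))"
  let ?B = "\<lambda>n. real (Suc n) * (LINT x|lborel. cutoff R i x * g n x)"
  have "\<bar>?A n - ?B n\<bar> \<le> R * M * (1 / real (Suc n))" for n
  proof -
    have df: "integrable lborel (\<lambda>x. f (x + step i n) - f x)"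
      using f by (intro Bochner_Integration.integrable_diff integrable_lborel_shift)
    note i = integrable_bounded_mult[OF df cutoff_measurable cutoff_abs_le[OF R]]
      integrable_bounded_mult[OF g cutoff_measurable cutoff_abs_le[OF R]]
    let ?d = "\<lambda>x. cutoff R i x * (f (x + step i n) - f x) - cutoff R i x * g n x"
    have "\<bar>(LINT x|lborel. ?d x)\<bar> \<le> (LINT x|lborel. \<bar>?d x\<bar>)" by (rule integral_abs_bound)
    also have "\<dots> \<le> (LINT x|lborel. R * e n x)"
    proof (rule integral_mono_AE)
      show "integrable lborel (\<lambda>x. \<bar>?d x\<bar>)" by (intro integrable_abs Bochner_Integration.integrable_diff i)
      show "integrable lborel (\<lambda>x. R * e n x)" using e by simp
      show "AE x in lborel. \<bar>?d x\<bar> \<le> R * e n x"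
        using le[of n]
      proof eventually_elim
        case (elim x)
        have "\<bar>?d x\<bar> = \<bar>cutoff R i x\<bar> * \<bar>f (x + step i n) - f x - g n x\<bar>"
          by (simp add: abs_mult[symmetric] right_diff_distrib)
        also have "\<dots> \<le> R * e n x" using elim R by (intro mult_mono cutoff_abs_le) auto
        finally show ?case .
      qed
    qed
    also have "\<dots> = R * (LINT x|lborel. e n x)" by simp
    also have "\<dots> \<le> R * (M * (norm (step i n))\<^sup>2)" using R by (intro mult_left_mono M) auto
    finally have "real (Suc n) * \<bar>LINT x|lborel. ?d x\<bar> \<le> real (Suc n) * (R * (M * (norm (step i n))\<^sup>2))"
      by (intro mult_left_mono) auto
    also have "\<dots> = R * M * (1 / real (Suc n))"
      by (simp add: norm_step power2_eq_square field_simps del: of_nat_Suc)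
    also have "real (Suc n) * \<bar>LINT x|lborel. ?d x\<bar> = \<bar>?A n - ?B n\<bar>"
      by (subst Bochner_Integration.integral_diff[OF i]) (simp add: right_diff_distrib[symmetric] abs_mult del: of_nat_Suc)
    finally show ?thesis .
  qed
  then have "\<forall>\<^sub>F n in sequentially. norm (?A n - ?B n) \<le> R * M * inverse (real (Suc n))"
    by (intro always_eventually) (simp add: inverse_eq_divide)
  moreover have "(\<lambda>n. R * M * inverse (real (Suc n))) \<longlonglongrightarrow> 0"
    using tendsto_mult[OF tendsto_const LIMSEQ_inverse_real_of_nat, of "R * M"] by simp
  ultimately have "(\<lambda>n. ?A n - ?B n) \<longlonglongrightarrow> 0" by (rule Lim_null_comparison)
  from tendsto_diff[OF cutoff_slope[OF f R, of i] this] show ?thesis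
    by (simp del: of_nat_Suc)
qed

lemma cos_rescale_limit:
  fixes f :: "real^'n::finite \<Rightarrow> real"
  assumes f: "integrable lborel f"
  shows "(\<lambda>m. LINT x|lborel. cos (x $ i / real (Suc m)) * f x) \<longlonglongrightarrow> (LINT x|lborel. f x)"
proof (rule integral_dominated_convergence[where w = "\<lambda>x. \<bar>f x\<bar>"])
  have [measurable]: "f \<in> borel_measurable borel" using f by auto
  show "AE x in lborel. (\<lambda>m. cos (x $ i / real (Suc m)) * f x) \<longlonglongrightarrow> f x"
  proof (intro AE_I2)
    fix x :: "real^'n"
    have "(\<lambda>m. x $ i * inverse (real (Suc m))) \<longlonglongrightarrow> x $ i * 0"
      by (intro tendsto_mult tendsto_const LIMSEQ_inverse_real_of_nat)
    then have "(\<lambda>m. cos (x $ i / real (Suc m)) * f x) \<longlonglongrightarrow> cos 0 * f x"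
      by (intro tendsto_mult tendsto_cos tendsto_const) (simp add: divide_inverse)
    then show "(\<lambda>m. cos (x $ i / real (Suc m)) * f x) \<longlonglongrightarrow> f x" by simp
  qed
  show "AE x in lborel. norm (cos (x $ i / real (Suc m)) * f x) \<le> \<bar>f x\<bar>" for m
    by (intro AE_I2) (simp add: abs_mult mult_left_le_one_le del: of_nat_Suc)
  show "integrable lborel (\<lambda>x. \<bar>f x\<bar>)" by (rule integrable_abs[OF f])
  show "(\<lambda>x. cos (x $ i / real (Suc m)) * f x) \<in> borel_measurable lborel" for m by measurable
  show "f \<in> borel_measurable lborel" by measurable
qed

text \<open>Only the \<open>i\<close>-th partial derivative of the cutoff is nonzero, which singles
  out one component of the gradient of \<open>u\<close> in the extra term.\<close>

lemma mult_h1_forms: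
  fixes u w :: "'n::finite h1"
  assumes R: "R > 0"
  shows "mass_form u (mult_h1 R i w) = (LINT x|lborel. cutoff R i x * (rep_h1 u x \<bullet> rep_h1 w x))"
    and "power_form r u (mult_h1 R i w) = (LINT x|lborel. cutoff R i x * (norm (rep_h1 u x) powr (r - 2) * (rep_h1 u x \<bullet> rep_h1 w x)))"
    and "grad_form u (mult_h1 R i w) = (LINT x|lborel. cutoff R i x * (h1_grad u x \<bullet> h1_grad w x)) +
      (LINT x|lborel. (cos (x $ i / R) *\<^sub>R (h1_grad u x $ i)) \<bullet> rep_h1 w x)"
proof -
  have [measurable]: "(\<lambda>x. h1_grad u x $ i) \<in> borel_measurable borel"
    by (rule square_integrable_measurable[OF square_integrable_nth[OF h1_square_integrable(2)]])
  show "mass_form u (mult_h1 R i w) = (LINT x|lborel. cutoff R i x * (rep_h1 u x \<bullet> rep_h1 w x))"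
    unfolding mass_form_def
    by (rule integral_cong_AE, measurable) (use mult_h1_AE(1)[OF R, of i w] in eventually_elim, simp)
  show "power_form r u (mult_h1 R i w) = (LINT x|lborel. cutoff R i x * (norm (rep_h1 u x) powr (r - 2) * (rep_h1 u x \<bullet> rep_h1 w x)))"
    unfolding power_form_def
    by (rule integral_cong_AE, measurable) (use mult_h1_AE(1)[OF R, of i w] in eventually_elim, simp)
  have i1: "integrable lborel (\<lambda>x. cutoff R i x * (h1_grad u x \<bullet> h1_grad w x))"
    by (rule integrable_bounded_mult[OF square_integrable_inner[OF h1_square_integrable(2) h1_square_integrable(2)] _ cutoff_abs_le[OF R]]) measurable
  have s: "square_integrable (\<lambda>x. cos (x $ i / R) *\<^sub>R (h1_grad u x $ i))"
    by (rule square_integrable_bounded_mult[OF square_integrable_nth[OF h1_square_integrable(2)] _ abs_cos_le_one]) measurable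
  have "grad_form u (mult_h1 R i w) = (LINT x|lborel. cutoff R i x * (h1_grad u x \<bullet> h1_grad w x) +
      (cos (x $ i / R) *\<^sub>R (h1_grad u x $ i)) \<bullet> rep_h1 w x)"
    unfolding grad_form_def
  proof (rule integral_cong_AE)
    show "AE x in lborel. h1_grad u x \<bullet> h1_grad (mult_h1 R i w) x = cutoff R i x * (h1_grad u x \<bullet> h1_grad w x) +
        (cos (x $ i / R) *\<^sub>R (h1_grad u x $ i)) \<bullet> rep_h1 w x"
      using mult_h1_AE(2)[OF R, of i w]
    proof eventually_elim
      case (elim x)
      have "h1_grad u x \<bullet> (\<chi> j. (cos (x $ i / R) * axis j 1 $ i) *\<^sub>R rep_h1 w x) =
          (\<Sum>j\<in>UNIV. if j = i then cos (x $ i / R) * (h1_grad u x $ i \<bullet> rep_h1 w x) else 0)"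
        unfolding inner_vec_def by (intro sum.cong) (auto simp: axis_def)
      then show ?case by (simp add: elim inner_add_right)
    qed
  qed measurable
  then show "grad_form u (mult_h1 R i w) = (LINT x|lborel. cutoff R i x * (h1_grad u x \<bullet> h1_grad w x)) +
      (LINT x|lborel. (cos (x $ i / R) *\<^sub>R (h1_grad u x $ i)) \<bullet> rep_h1 w x)"
    by (simp only: Bochner_Integration.integral_add[OF i1 square_integrable_inner[OF s h1_square_integrable(1)]])
qed

lemma norm_square_diff: "(norm b)\<^sup>2 - (norm a)\<^sup>2 - 2 * (a \<bullet> (b - a)) = (norm (b - a))\<^sup>2"
  by (simp add: power2_norm_eq_inner inner_diff_left inner_diff_right inner_commute[of b a])

text \<open>For the square of the norm the remainder is exactly the squared increment, whose
  integral is quadratic in the step by the translation estimate.\<close>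

lemma mass_slope:
  fixes u :: "'n::finite h1"
  assumes R: "R > 0"
  shows "(\<lambda>n. real (Suc n) * mass_form u (mult_h1 R i (shift_h1 (step i n) u - u))) \<longlonglongrightarrow>
    - (LINT x|lborel. cos (x $ i / R) * (norm (rep_h1 u x))\<^sup>2) / 2"
proof -
  let ?w = "\<lambda>n. shift_h1 (step i n) u - u"
  have "(\<lambda>n. real (Suc n) * (LINT x|lborel. cutoff R i x * (2 * (rep_h1 u x \<bullet> rep_h1 (?w n) x)))) \<longlonglongrightarrow>
    - (LINT x|lborel. cos (x $ i / R) * (norm (rep_h1 u x))\<^sup>2)"
  proof (rule cutoff_slope_remainder[OF _ R, where e = "\<lambda>n x. (norm (rep_h1 (?w n) x))\<^sup>2" and M = "(Lnorm 2 (h1_grad u))\<^sup>2"])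
    show "integrable lborel (\<lambda>x. (norm (rep_h1 v x))\<^sup>2)" for v :: "'n h1"
      using h1_square_integrable(1)[of v] by (simp add: square_integrable_def)
    then show "integrable lborel (\<lambda>x. (norm (rep_h1 (?w n) x))\<^sup>2)" for n .
    show "integrable lborel (\<lambda>x. 2 * (rep_h1 u x \<bullet> rep_h1 (?w n) x))" for n
      by (intro integrable_mult_right square_integrable_inner h1_square_integrable)
    show "AE x in lborel. \<bar>(norm (rep_h1 u (x + step i n)))\<^sup>2 - (norm (rep_h1 u x))\<^sup>2 - 2 * (rep_h1 u x \<bullet> rep_h1 (?w n) x)\<bar> \<le> (norm (rep_h1 (?w n) x))\<^sup>2" for n
      using shift_h1_diff_AE(1)[of "step i n" u] by eventually_elim (simp add: norm_square_diff)
    show "(L2_square (rep_h1 (?w n))) \<le> (Lnorm 2 (h1_grad u))\<^sup>2 * (norm (step i n))\<^sup>2" for n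
      using power_mono[OF Lnorm_shift_diff_le[of "step i n" u], of 2]
      by (simp add: form_self(1)[symmetric] mass_form_def power2_norm_eq_inner[symmetric] power_mult_distrib mult.commute)
  qed
  from tendsto_divide[OF this tendsto_const[of 2]] show ?thesis
    unfolding mult_h1_forms[OF R] by (simp add: mult.left_commute[of _ 2])
qed

text \<open>The pointwise Taylor bound integrates to a multiple of
  \<open>weighted_difference\<close>, so the hypothesis on \<open>M\<close> is the quadratic bound
  that the remainder lemma asks for.\<close>

lemma power_slope:
  fixes u :: "'n::finite h1"
  assumes R: "R > 0" and r: "r > 2" "gam CARD('n) r < 1"
    and M: "\<And>k. weighted_difference r u (shift_h1 k u) \<le> M * (norm k)\<^sup>2"
  shows "(\<lambda>n. real (Suc n) * power_form r u (mult_h1 R i (shift_h1 (step i n) u - u))) \<longlonglongrightarrow>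
    - (LINT x|lborel. cos (x $ i / R) * norm (rep_h1 u x) powr r) / r"
proof -
  let ?V = "\<lambda>n. shift_h1 (step i n) u"
  let ?w = "\<lambda>n. ?V n - u"
  let ?e = "\<lambda>n x. r * (r - 1) * ((norm (rep_h1 u x) powr (r - 2) + norm (rep_h1 (?V n) x) powr (r - 2)) * (norm (rep_h1 (?w n) x))\<^sup>2)"
  have "(\<lambda>n. real (Suc n) * (LINT x|lborel. cutoff R i x * (r * (norm (rep_h1 u x) powr (r - 2) * (rep_h1 u x \<bullet> rep_h1 (?w n) x))))) \<longlonglongrightarrow>
    - (LINT x|lborel. cos (x $ i / R) * norm (rep_h1 u x) powr r)"
  proof (rule cutoff_slope_remainder[OF _ R, where e = ?e and M = "r * (r - 1) * M"])
    show "integrable lborel (\<lambda>x. norm (rep_h1 u x) powr r)" by (rule h1_Lr_integrable[OF r])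
    show "integrable lborel (?e n)" for n
      by (intro integrable_mult_right weighted_difference_integrable r)
    show "integrable lborel (\<lambda>x. r * (norm (rep_h1 u x) powr (r - 2) * (rep_h1 u x \<bullet> rep_h1 (?w n) x)))" for n
      by (intro integrable_mult_right power_form_integrable r)
    show "AE x in lborel. \<bar>norm (rep_h1 u (x + step i n)) powr r - norm (rep_h1 u x) powr r -
        r * (norm (rep_h1 u x) powr (r - 2) * (rep_h1 u x \<bullet> rep_h1 (?w n) x))\<bar> \<le> ?e n x" for n
      using shift_h1_diff_AE(1)[of "step i n" u] shift_h1_AE(1)[of "step i n" u]
    proof eventually_elim
      case (elim x)
      show ?case
        using norm_powr_taylor[OF r(1), where a = "rep_h1 u x" and b = "rep_h1 u (x + step i n)"]
        by (simp only: elim mult.assoc)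
    qed
    show "(LINT x|lborel. ?e n x) \<le> r * (r - 1) * M * (norm (step i n))\<^sup>2" for n
    proof -
      have "(LINT x|lborel. ?e n x) = r * (r - 1) * weighted_difference r u (?V n)"
        by (simp add: weighted_difference_def)
      also have "\<dots> \<le> r * (r - 1) * (M * (norm (step i n))\<^sup>2)" using r by (intro mult_left_mono M) auto
      finally show ?thesis by (simp only: mult.assoc)
    qed
  qed
  from tendsto_divide[OF this tendsto_const[of r]] show ?thesis
    using r unfolding mult_h1_forms[OF R] by (simp add: mult.left_commute[of _ r])
qed

text \<open>The product rule produces two terms. The one with the cutoff is again the slope of a
  square; in the other the derivative \<open>cos (x $ i / R)\<close> of the cutoff meets the
  difference quotient of \<open>u\<close> itself, which converges to the \<open>i\<close>-th partial
  derivative in \<open>L^2\<close>.\<close>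

lemma gradient_slope:
  fixes u :: "'n::finite h1"
  assumes R: "R > 0"
    and M: "\<And>k. grad_form (shift_h1 k u - u) (shift_h1 k u - u) \<le> M * (norm k)\<^sup>2"
  shows "(\<lambda>n. real (Suc n) * grad_form u (mult_h1 R i (shift_h1 (step i n) u - u))) \<longlonglongrightarrow>
    - (LINT x|lborel. cos (x $ i / R) * (norm (h1_grad u x))\<^sup>2) / 2 +
      (LINT x|lborel. cos (x $ i / R) * (norm (h1_grad u x $ i))\<^sup>2)"
proof -
  let ?w = "\<lambda>n. shift_h1 (step i n) u - u"
  let ?g = "\<lambda>x. cos (x $ i / R) *\<^sub>R (h1_grad u x $ i)"
  have gsq: "grad_form v v = (L2_square (h1_grad v))" for v :: "'n h1"
    by (simp add: grad_form_def power2_norm_eq_inner)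
  have "(\<lambda>n. real (Suc n) * (LINT x|lborel. cutoff R i x * (2 * (h1_grad u x \<bullet> h1_grad (?w n) x)))) \<longlonglongrightarrow>
    - (LINT x|lborel. cos (x $ i / R) * (norm (h1_grad u x))\<^sup>2)"
  proof (rule cutoff_slope_remainder[OF _ R, where e = "\<lambda>n x. (norm (h1_grad (?w n) x))\<^sup>2" and M = M])
    show "integrable lborel (\<lambda>x. (norm (h1_grad v x))\<^sup>2)" for v :: "'n h1"
      using h1_square_integrable(2)[of v] by (simp add: square_integrable_def)
    then show "integrable lborel (\<lambda>x. (norm (h1_grad (?w n) x))\<^sup>2)" for n .
    show "integrable lborel (\<lambda>x. 2 * (h1_grad u x \<bullet> h1_grad (?w n) x))" for n
      by (intro integrable_mult_right square_integrable_inner h1_square_integrable)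
    show "AE x in lborel. \<bar>(norm (h1_grad u (x + step i n)))\<^sup>2 - (norm (h1_grad u x))\<^sup>2 - 2 * (h1_grad u x \<bullet> h1_grad (?w n) x)\<bar> \<le> (norm (h1_grad (?w n) x))\<^sup>2" for n
      using shift_h1_diff_AE(2)[of "step i n" u] by eventually_elim (simp add: norm_square_diff)
    show "(L2_square (h1_grad (?w n))) \<le> M * (norm (step i n))\<^sup>2" for n
      using M[of "step i n"] by (simp add: gsq)
  qed
  from tendsto_divide[OF this tendsto_const[of 2]]
  have 1: "(\<lambda>n. real (Suc n) * (LINT x|lborel. cutoff R i x * (h1_grad u x \<bullet> h1_grad (?w n) x))) \<longlonglongrightarrow>
    - (LINT x|lborel. cos (x $ i / R) * (norm (h1_grad u x))\<^sup>2) / 2"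
    by (simp add: mult.left_commute[of _ 2])
  have s: "square_integrable ?g" "square_integrable (\<lambda>x. h1_grad u x $ i)"
    by (rule square_integrable_bounded_mult[OF square_integrable_nth[OF h1_square_integrable(2)] _ abs_cos_le_one], measurable)
       (rule square_integrable_nth[OF h1_square_integrable(2)])
  have [measurable]: "(\<lambda>x. h1_grad u x $ i) \<in> borel_measurable borel" by (rule square_integrable_measurable[OF s(2)])
  let ?L = "LINT x|lborel. cos (x $ i / R) * (norm (h1_grad u x $ i))\<^sup>2"
  have L: "?L = (LINT x|lborel. ?g x \<bullet> (h1_grad u x $ i))" by (simp add: power2_norm_eq_inner)
  \<comment> \<open>The bound on the gradient increments is used a second time, now along the whole
    segment, to obtain a rate for the difference quotient.\<close>
  have "\<bar>real (Suc n) * (LINT x|lborel. ?g x \<bullet> rep_h1 (?w n) x) - ?L\<bar> \<le> Lnorm 2 ?g * sqrt \<bar>M\<bar> * inverse (real (Suc n))" for n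
  proof -
    let ?t = "1 / real (Suc n)"
    let ?d = "\<lambda>x. rep_h1 (?w n) x - ?t *\<^sub>R (h1_grad u x $ i)"
    have d: "square_integrable ?d"
      by (rule integral_diff_square_le(1)[OF h1_square_integrable(1) square_integrable_scaleR[OF s(2)]])
    have dd: "dir_deriv (h1_grad u) (step i n) x = ?t *\<^sub>R (h1_grad u x $ i)" for x
    proof -
      have "dir_deriv (h1_grad u) (step i n) x = (\<Sum>j\<in>UNIV. if j = i then ?t *\<^sub>R (h1_grad u x $ i) else 0)"
        unfolding dir_deriv_def step_def by (intro sum.cong) (auto simp: axis_def)
      then show ?thesis by simp
    qed
    have "(L2_square ?d) =
        (LINT x|lborel. (norm (rep_h1 u (x + step i n) - rep_h1 u x - dir_deriv (h1_grad u) (step i n) x))\<^sup>2)"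
      unfolding dd
      by (rule integral_cong_AE, measurable) (use shift_h1_diff_AE(1)[of "step i n" u] in eventually_elim, simp)
    also have "\<dots> \<le> (norm (step i n))\<^sup>2 * (\<bar>M\<bar> * (norm (step i n))\<^sup>2)"
      unfolding h1_grad_def
    proof (rule difference_minus_derivative_L2_le[OF h1_sobolev])
      fix s :: real assume s: "s \<in> {0..1}"
      have "(LINT x|lborel. (norm (weak_gradient (rep_h1 u) (x + s *\<^sub>R step i n) - weak_gradient (rep_h1 u) x))\<^sup>2) =
         grad_form (shift_h1 (s *\<^sub>R step i n) u - u) (shift_h1 (s *\<^sub>R step i n) u - u)"
        unfolding gsq h1_grad_def[symmetric]
        by (rule integral_cong_AE, measurable) (use shift_h1_diff_AE(2)[of "s *\<^sub>R step i n" u] in eventually_elim, simp)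
      also have "\<dots> \<le> M * (norm (s *\<^sub>R step i n))\<^sup>2" by (rule M)
      also have "\<dots> \<le> \<bar>M\<bar> * (norm (step i n))\<^sup>2"
        using s by (intro mult_mono power_mono) (auto simp: mult_left_le_one_le)
      finally show "(LINT x|lborel. (norm (weak_gradient (rep_h1 u) (x + s *\<^sub>R step i n) - weak_gradient (rep_h1 u) x))\<^sup>2) \<le> \<bar>M\<bar> * (norm (step i n))\<^sup>2" .
    qed
    also have "\<dots> = \<bar>M\<bar> * (?t\<^sup>2)\<^sup>2" by (simp add: norm_step power2_eq_square)
    finally have "Lnorm 2 ?d \<le> sqrt (\<bar>M\<bar> * (?t\<^sup>2)\<^sup>2)" unfolding Lnorm_2 by (rule real_sqrt_le_mono)
    also have "\<dots> = sqrt \<bar>M\<bar> * ?t\<^sup>2" by (simp only: real_sqrt_mult real_sqrt_abs abs_power2)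
    finally have Ld: "Lnorm 2 ?d \<le> sqrt \<bar>M\<bar> * ?t\<^sup>2" .
    have "(LINT x|lborel. ?g x \<bullet> ?d x) = (LINT x|lborel. ?g x \<bullet> rep_h1 (?w n) x) - ?t * ?L"
    proof -
      have "(LINT x|lborel. ?g x \<bullet> ?d x) = (LINT x|lborel. ?g x \<bullet> rep_h1 (?w n) x - ?t * (?g x \<bullet> (h1_grad u x $ i)))"
        by (simp only: inner_diff_right inner_scaleR_right)
      also have "\<dots> = (LINT x|lborel. ?g x \<bullet> rep_h1 (?w n) x) - (LINT x|lborel. ?t * (?g x \<bullet> (h1_grad u x $ i)))"
        by (intro Bochner_Integration.integral_diff integrable_mult_right square_integrable_inner s h1_square_integrable)
      finally show ?thesis unfolding L by (simp only: integral_mult_right_zero)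
    qed
    moreover have "\<bar>LINT x|lborel. ?g x \<bullet> ?d x\<bar> \<le> Lnorm 2 ?g * (sqrt \<bar>M\<bar> * ?t\<^sup>2)"
      by (rule order_trans[OF L2_cauchy_schwarz[OF s(1) d]]) (intro mult_left_mono Ld; simp)
    ultimately have "real (Suc n) * \<bar>(LINT x|lborel. ?g x \<bullet> rep_h1 (?w n) x) - ?t * ?L\<bar> \<le> real (Suc n) * (Lnorm 2 ?g * (sqrt \<bar>M\<bar> * ?t\<^sup>2))"
      by (intro mult_left_mono) auto
    also have "\<dots> = Lnorm 2 ?g * sqrt \<bar>M\<bar> * inverse (real (Suc n))"
      by (simp add: power2_eq_square field_simps del: of_nat_Suc)
    also have "real (Suc n) * \<bar>(LINT x|lborel. ?g x \<bullet> rep_h1 (?w n) x) - ?t * ?L\<bar> =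
       \<bar>real (Suc n) * ((LINT x|lborel. ?g x \<bullet> rep_h1 (?w n) x) - ?t * ?L)\<bar>"
      by (simp only: abs_mult abs_of_nat)
    also have "real (Suc n) * ((LINT x|lborel. ?g x \<bullet> rep_h1 (?w n) x) - ?t * ?L) =
       real (Suc n) * (LINT x|lborel. ?g x \<bullet> rep_h1 (?w n) x) - ?L"
      by (simp add: right_diff_distrib del: of_nat_Suc)
    finally show ?thesis .
  qed
  then have "\<forall>\<^sub>F n in sequentially. norm (real (Suc n) * (LINT x|lborel. ?g x \<bullet> rep_h1 (?w n) x) - ?L) \<le> Lnorm 2 ?g * sqrt \<bar>M\<bar> * inverse (real (Suc n))"
    by (intro always_eventually) simp
  moreover have "(\<lambda>n. Lnorm 2 ?g * sqrt \<bar>M\<bar> * inverse (real (Suc n))) \<longlonglongrightarrow> 0"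
    using tendsto_mult[OF tendsto_const LIMSEQ_inverse_real_of_nat, of "Lnorm 2 ?g * sqrt \<bar>M\<bar>"] by simp
  ultimately have "(\<lambda>n. real (Suc n) * (LINT x|lborel. ?g x \<bullet> rep_h1 (?w n) x) - ?L) \<longlonglongrightarrow> 0"
    by (rule Lim_null_comparison)
  then have 2: "(\<lambda>n. real (Suc n) * (LINT x|lborel. ?g x \<bullet> rep_h1 (?w n) x)) \<longlonglongrightarrow> ?L"
    by (rule LIM_zero_cancel)
  show ?thesis
    using tendsto_add[OF 1 2] by (simp only: mult_h1_forms[OF R] distrib_left)
qed

text \<open>The test in direction \<open>i\<close> produces \<open>- T / 2\<close> plus the
  \<open>i\<close>-th part of the gradient term. Summing over \<open>i\<close> completes these parts
  to \<open>T\<close>, and testing with \<open>u\<close> itself removes the mass term;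
  \<open>gam\<close> appears as \<open>N / 2 - N / r\<close>.\<close>

theorem pohozaev_identity:
  fixes u :: "'n::finite h1"
  assumes p: "p > 2" "gam CARD('n) p < 1" and q: "q > 2" "gam CARD('n) q < 1" and qp: "q < p"
    and sol: "weak_solution c \<alpha> \<beta> \<nu> p q u" and nz: "c \<noteq> 0 \<or> \<alpha> \<noteq> 0"
  shows "c * (Lnorm 2 (h1_grad u))\<^sup>2 =
    \<alpha> * gam CARD('n) p * Lnorm p (rep_h1 u) powr p + \<beta> * gam CARD('n) q * Lnorm q (rep_h1 u) powr q"
proof -
  obtain M where M: "\<And>k. weighted_difference p u (shift_h1 k u) \<le> M * (norm k)\<^sup>2"
      "\<And>k. weighted_difference q u (shift_h1 k u) \<le> M * (norm k)\<^sup>2"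
      "\<And>k. c \<noteq> 0 \<Longrightarrow> grad_form (shift_h1 k u - u) (shift_h1 k u - u) \<le> M * (norm k)\<^sup>2"
    using translation_bounds[OF p q qp sol nz] by blast
  let ?I = "\<lambda>R i f. LINT x|lborel. cos (x $ i / R) * f x"
  let ?T = "\<lambda>x. (norm (h1_grad u x))\<^sup>2" and ?X = "\<lambda>x. (norm (rep_h1 u x))\<^sup>2"
  let ?A = "\<lambda>x. norm (rep_h1 u x) powr p" and ?B = "\<lambda>x. norm (rep_h1 u x) powr q"
  let ?Ti = "\<lambda>i x. (norm (h1_grad u x $ i))\<^sup>2"
  have int: "integrable lborel ?T" "integrable lborel ?X" "integrable lborel ?A" "integrable lborel ?B" "integrable lborel (?Ti i)" for i
    using h1_square_integrable[of u] square_integrable_nth[OF h1_square_integrable(2), of u i]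
      h1_Lr_integrable[OF p, of u] h1_Lr_integrable[OF q, of u]
    by (auto simp: square_integrable_def)
  have R: "c * (- ?I R i ?T / 2 + ?I R i (?Ti i)) = \<alpha> * (- ?I R i ?A / p) + \<beta> * (- ?I R i ?B / q) + \<nu> * (- ?I R i ?X / 2)"
    if R: "R > 0" for R i
  proof -
    let ?z = "\<lambda>n. mult_h1 R i (shift_h1 (step i n) u - u)"
    have eq: "c * (real (Suc n) * grad_form u (?z n)) =
        \<alpha> * (real (Suc n) * power_form p u (?z n)) + \<beta> * (real (Suc n) * power_form q u (?z n)) + \<nu> * (real (Suc n) * mass_form u (?z n))" for n
    proof -
      have "real (Suc n) * (c * grad_form u (?z n)) = real (Suc n) * (\<alpha> * power_form p u (?z n) + \<beta> * power_form q u (?z n) + \<nu> * mass_form u (?z n))"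
        using sol unfolding weak_solution_def by simp
      then show ?thesis by (simp add: algebra_simps del: of_nat_Suc)
    qed
    \<comment> \<open>For \<open>c = 0\<close> there is no bound on gradient increments, but then
      the sequence and its limit are both 0.\<close>
    have 1: "(\<lambda>n. c * (real (Suc n) * grad_form u (?z n))) \<longlonglongrightarrow> c * (- ?I R i ?T / 2 + ?I R i (?Ti i))"
    proof (cases "c = 0")
      case False
      show ?thesis by (intro tendsto_mult tendsto_const gradient_slope[OF R M(3)[OF False]])
    qed simp
    have 2: "(\<lambda>n. c * (real (Suc n) * grad_form u (?z n))) \<longlonglongrightarrow> \<alpha> * (- ?I R i ?A / p) + \<beta> * (- ?I R i ?B / q) + \<nu> * (- ?I R i ?X / 2)"
      unfolding eq by (intro tendsto_add tendsto_mult tendsto_const power_slope[OF R p M(1)] power_slope[OF R q M(2)] mass_slope[OF R])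
    show ?thesis by (rule LIMSEQ_unique[OF 1 2])
  qed
  have lim: "c * (- integral\<^sup>L lborel ?T / 2 + integral\<^sup>L lborel (?Ti i)) =
     \<alpha> * (- integral\<^sup>L lborel ?A / p) + \<beta> * (- integral\<^sup>L lborel ?B / q) + \<nu> * (- integral\<^sup>L lborel ?X / 2)" for i
  proof -
    have 1: "(\<lambda>m. c * (- ?I (real (Suc m)) i ?T / 2 + ?I (real (Suc m)) i (?Ti i))) \<longlonglongrightarrow>
        c * (- integral\<^sup>L lborel ?T / 2 + integral\<^sup>L lborel (?Ti i))"
      by (intro tendsto_intros cos_rescale_limit int) auto
    have 2: "(\<lambda>m. c * (- ?I (real (Suc m)) i ?T / 2 + ?I (real (Suc m)) i (?Ti i))) \<longlonglongrightarrow>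
        \<alpha> * (- integral\<^sup>L lborel ?A / p) + \<beta> * (- integral\<^sup>L lborel ?B / q) + \<nu> * (- integral\<^sup>L lborel ?X / 2)"
      unfolding R[OF of_nat_0_less_iff[THEN iffD2, OF zero_less_Suc]]
      by (intro tendsto_intros cos_rescale_limit int) (use p q in auto)
    show ?thesis by (rule LIMSEQ_unique[OF 1 2])
  qed
  define T A B X where "T = integral\<^sup>L lborel ?T" and "A = integral\<^sup>L lborel ?A" and "B = integral\<^sup>L lborel ?B" and "X = integral\<^sup>L lborel ?X"
  have "(\<Sum>i\<in>UNIV. integral\<^sup>L lborel (?Ti i)) = (LINT x|lborel. (\<Sum>i\<in>UNIV. ?Ti i x))"
    by (rule Bochner_Integration.integral_sum[symmetric]) (rule int)
  also have "(\<lambda>x. \<Sum>i\<in>UNIV. ?Ti i x) = ?T"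
    by (rule ext) (simp add: norm_vec_def L2_set_def sum_nonneg)
  finally have sumT: "(\<Sum>i\<in>UNIV. integral\<^sup>L lborel (?Ti i)) = T" by (simp add: T_def)
  let ?N = "real CARD('n)"
  have "(\<Sum>i\<in>(UNIV::'n set). c * (- T / 2 + integral\<^sup>L lborel (?Ti i))) = (\<Sum>i\<in>(UNIV::'n set). \<alpha> * (- A / p) + \<beta> * (- B / q) + \<nu> * (- X / 2))"
    using lim by (simp add: T_def A_def B_def X_def)
  moreover have "(\<Sum>i\<in>(UNIV::'n set). c * (- T / 2 + integral\<^sup>L lborel (?Ti i))) = c * (- ?N * T / 2 + T)"
    by (simp only: sum_distrib_left[symmetric] sum.distrib sumT) simp
  ultimately have s: "c * (- ?N * T / 2 + T) = ?N * (\<alpha> * (- A / p) + \<beta> * (- B / q) + \<nu> * (- X / 2))"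
    by simp
  have LT: "(Lnorm 2 (h1_grad u))\<^sup>2 = T"
    by (simp add: T_def Lnorm_2 Bochner_Integration.integral_nonneg)
  have LA: "Lnorm p (rep_h1 u) powr p = A" "Lnorm q (rep_h1 u) powr q = B"
    using p q by (simp_all add: A_def B_def Lnorm_powr)
  have LX: "mass_form u u = X" by (simp add: X_def mass_form_def power2_norm_eq_inner)
  have neh: "c * T = \<alpha> * A + \<beta> * B + \<nu> * X"
    using sol[unfolded weak_solution_def, rule_format, of u]
    by (simp add: form_self(2) LT power_form_self[OF p] power_form_self[OF q] LA LX)
  have gp: "gam CARD('n) p = ?N / 2 - ?N / p" "gam CARD('n) q = ?N / 2 - ?N / q"
    using p q by (simp_all add: gam_def field_simps)
  \<comment> \<open>Replacing \<open>c * T\<close> on the right by means of \<open>neh\<close> makes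
    the contributions of \<open>\<nu>\<close> cancel.\<close>
  have "c * T = ?N / 2 * (c * T) + ?N * (\<alpha> * (- A / p) + \<beta> * (- B / q) + \<nu> * (- X / 2))"
    using s by (simp add: algebra_simps)
  also have "\<dots> = ?N / 2 * (\<alpha> * A + \<beta> * B + \<nu> * X) + ?N * (\<alpha> * (- A / p) + \<beta> * (- B / q) + \<nu> * (- X / 2))"
    by (simp only: neh)
  also have "\<dots> = \<alpha> * (?N / 2 - ?N / p) * A + \<beta> * (?N / 2 - ?N / q) * B"
    by (simp add: algebra_simps)
  finally show ?thesis unfolding LT LA gp .
qed

section \<open>Level sets, tangent vectors and the main theorem\<close>

lemma surj_pairI:
  fixes f g :: "'a::real_vector \<Rightarrow> real"
  assumes f: "linear f" and g: "linear g" and gu: "g u \<noteq> 0" and ind: "\<And>\<kappa>. \<exists>h. f h \<noteq> \<kappa> * g h"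
  shows "surj (\<lambda>h. (f h, g h))"
proof -
  obtain h where h: "f h \<noteq> f u / g u * g h" using ind by blast
  \<comment> \<open>Subtracting a multiple of \<open>u\<close> moves \<open>h\<close> into the
    kernel of \<open>g\<close>, and the choice of \<open>h\<close> keeps \<open>f k\<close> nonzero;
    so \<open>k\<close> and \<open>u\<close> lead to a triangular system.\<close>
  define k where "k = h - (g h / g u) *\<^sub>R u"
  have gk: "g k = 0" using gu by (simp add: k_def linear_diff[OF g] linear_scale[OF g])
  have fk: "f k \<noteq> 0" using h gu by (simp add: k_def linear_diff[OF f] linear_scale[OF f] mult.commute)
  have "\<exists>z. (f z, g z) = (a, b)" for a b
  proof -
    let ?z = "((a - b / g u * f u) / f k) *\<^sub>R k + (b / g u) *\<^sub>R u"
    have "g ?z = b" using gu gk by (simp add: linear_add[OF g] linear_scale[OF g])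
    moreover have "f ?z = a" using fk by (simp add: linear_add[OF f] linear_scale[OF f])
    ultimately show ?thesis by blast
  qed
  then show ?thesis by (metis surj_def surj_pair)
qed

lemma tangent_vectors_subset_kernel:
  assumes d: "(G has_derivative G') (at u)" and v: "v \<in> tangent_vectors {u. G u = (0::real)} u"
  shows "G' v = 0"
proof -
  obtain \<epsilon> c c' where e: "\<epsilon> > 0" and c: "c 0 = u" "c' 0 = v"
    and M: "\<And>t. t \<in> {-\<epsilon><..<\<epsilon>} \<Longrightarrow> G (c t) = 0 \<and> (c has_vector_derivative c' t) (at t)"
    using v unfolding tangent_vectors_def by auto
  have 0: "0 \<in> {-\<epsilon><..<\<epsilon>}" using e by simp
  have "(c has_derivative (\<lambda>t. t *\<^sub>R v)) (at 0)"
    using M[OF 0] c by (simp add: has_vector_derivative_def)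
  from has_derivative_compose[OF this] d c have "((\<lambda>t. G (c t)) has_derivative (\<lambda>t. G' (t *\<^sub>R v))) (at 0)"
    by simp
  moreover have "((\<lambda>t. G (c t)) has_derivative (\<lambda>t. 0)) (at 0)"
    by (rule has_derivative_transform_within_open[OF has_derivative_const open_greaterThanLessThan 0]) (use M in simp)
  ultimately have "(\<lambda>t. G' (t *\<^sub>R v)) = (\<lambda>t. 0)" by (rule has_derivative_unique)
  from fun_cong[OF this, of 1] show ?thesis by simp
qed

lemma cramer_2:
  fixes a11 a12 a21 a22 b1 b2 x y :: real
  assumes "a11 * x + a12 * y = b1" "a21 * x + a22 * y = b2" "a11 * a22 - a12 * a21 \<noteq> 0"
  shows "x = (b1 * a22 - b2 * a12) / (a11 * a22 - a12 * a21)" "y = (a11 * b2 - a21 * b1) / (a11 * a22 - a12 * a21)"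
proof -
  have "x * (a11 * a22 - a12 * a21) = b1 * a22 - b2 * a12"
    unfolding assms(1,2)[symmetric] by (simp add: algebra_simps)
  then show "x = (b1 * a22 - b2 * a12) / (a11 * a22 - a12 * a21)" using assms(3) by (simp add: field_simps)
  have "y * (a11 * a22 - a12 * a21) = a11 * b2 - a21 * b1"
    unfolding assms(1,2)[symmetric] by (simp add: algebra_simps)
  then show "y = (a11 * b2 - a21 * b1) / (a11 * a22 - a12 * a21)" using assms(3) by (simp add: field_simps)
qed

text \<open>The map \<open>F\<close> sends the coordinates of \<open>u + t v + s1 w1 + s2 w2\<close>
  to \<open>t\<close> and the values of \<open>P\<close> and \<open>G\<close> there. Following its
  local inverse along the points \<open>(t, 0, 0)\<close> yields a curve inside the zero
  set.\<close>

theorem kernel_subset_tangent_vectors: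
  fixes P G :: "'a::real_normed_vector \<Rightarrow> real"
  assumes P: "\<And>u. (P has_derivative blinfun_apply (P' u)) (at u)" "continuous_on UNIV P'"
    and G: "\<And>u. (G has_derivative blinfun_apply (G' u)) (at u)" "continuous_on UNIV G'"
    and u: "P u = 0" "G u = 0" and w1: "P' u w1 = 1" "G' u w1 = 0" and w2: "P' u w2 = 0" "G' u w2 = 1"
    and v: "P' u v = 0" "G' u v = 0"
  shows "v \<in> tangent_vectors {u. P u = 0 \<and> G u = 0} u"
proof -
  define L :: "(real \<times> real \<times> real) \<Rightarrow>\<^sub>L 'a" where "L = Blinfun (\<lambda>z. fst z *\<^sub>R v + fst (snd z) *\<^sub>R w1 + snd (snd z) *\<^sub>R w2)"
  have "bounded_linear (\<lambda>z::real \<times> real \<times> real. fst z *\<^sub>R v + fst (snd z) *\<^sub>R w1 + snd (snd z) *\<^sub>R w2)"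
    by (intro bounded_linear_add bounded_linear_compose[OF bounded_linear_scaleR_left] bounded_linear_fst
        bounded_linear_compose[OF bounded_linear_fst bounded_linear_snd] bounded_linear_compose[OF bounded_linear_snd bounded_linear_snd])
  then have L: "blinfun_apply L z = fst z *\<^sub>R v + fst (snd z) *\<^sub>R w1 + snd (snd z) *\<^sub>R w2" for z
    by (simp add: L_def bounded_linear_Blinfun_apply)
  define c where "c z = u + L z" for z
  define F where "F z = (fst z, P (c z), G (c z))" for z :: "real \<times> real \<times> real"
  define i1 :: "real \<Rightarrow>\<^sub>L (real \<times> real \<times> real)" where "i1 = Blinfun (\<lambda>t. (t, 0, 0))"
  define i2 :: "real \<Rightarrow>\<^sub>L (real \<times> real \<times> real)" where "i2 = Blinfun (\<lambda>t. (0, t, 0))"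
  define i3 :: "real \<Rightarrow>\<^sub>L (real \<times> real \<times> real)" where "i3 = Blinfun (\<lambda>t. (0, 0, t))"
  have i: "blinfun_apply i1 t = (t, 0, 0)" "blinfun_apply i2 t = (0, t, 0)" "blinfun_apply i3 t = (0, 0, t)" for t
    unfolding i1_def i2_def i3_def
    by (subst bounded_linear_Blinfun_apply; auto intro!: bounded_linear_Pair bounded_linear_zero bounded_linear_ident)+
  define F' where "F' z = (i1 o\<^sub>L Blinfun fst) + (i2 o\<^sub>L (P' (c z) o\<^sub>L L)) + (i3 o\<^sub>L (G' (c z) o\<^sub>L L))" for z
  have F': "blinfun_apply (F' z) d = (fst d, P' (c z) (L d), G' (c z) (L d))" for z d
    by (simp add: F'_def plus_blinfun.rep_eq i bounded_linear_Blinfun_apply[OF bounded_linear_fst])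
  have dc: "(c has_derivative blinfun_apply L) (at z)" for z
    unfolding c_def[abs_def] by (auto intro!: derivative_eq_intros)
  have contc: "continuous_on S c" for S
    using dc by (intro continuous_at_imp_continuous_on) (auto intro: has_derivative_continuous)
  have dF: "(F has_derivative blinfun_apply (F' z)) (at z)" for z
    unfolding F_def[abs_def] F'[abs_def]
    by (intro has_derivative_Pair has_derivative_fst has_derivative_ident has_derivative_compose[OF dc P(1)] has_derivative_compose[OF dc G(1)])
  have contF': "continuous_on UNIV F'"
    unfolding F'_def[abs_def]
    by (intro continuous_intros continuous_on_compose2[OF P(2) contc] continuous_on_compose2[OF G(2) contc]
      bounded_bilinear.continuous_on[OF bounded_bilinear_blinfun_compose]) auto
  have c0: "c 0 = u" by (simp add: c_def)
  \<comment> \<open>Since \<open>v\<close> lies in both kernels and \<open>w1\<close>,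
    \<open>w2\<close> are dual to the two differentials, the derivative of \<open>F\<close> at 0 is
    the identity.\<close>
  have "id_blinfun o\<^sub>L F' 0 = id_blinfun"
    by (rule blinfun_eqI) (simp add: F' c0 L blinfun.add_right blinfun.scaleR_right v w1 w2)
  from inverse_function_theorem[OF open_UNIV dF contF' UNIV_I this]
  obtain U V g g' where U: "open U" "0 \<in> U" and V: "open V" "F 0 \<in> V" and hom: "homeomorphism U V F g"
    and dg: "\<And>y. y \<in> V \<Longrightarrow> (g has_derivative g' y) (at y)" by metis
  have F0: "F 0 = 0" using u c0 by (simp add: F_def zero_prod_def)
  have gV: "F (g y) = y" if "y \<in> V" for y using hom that by (simp add: homeomorphism_def)
  have g0: "g 0 = 0" using hom U F0 unfolding homeomorphism_def by metis
  let ?e = "\<lambda>t::real. (t, 0::real, 0::real)"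
  define \<gamma> where "\<gamma> t = c (g (?e t))" for t
  define det where "det x = P' x w1 * G' x w2 - P' x w2 * G' x w1" for x
  have contapp: "continuous_on UNIV (\<lambda>x. P' x h)" "continuous_on UNIV (\<lambda>x. G' x h)" for h
    by (intro continuous_intros P G)+
  have contdet: "continuous_on UNIV det"
    unfolding det_def[abs_def] by (intro continuous_intros contapp)
  have contg: "continuous_on V g" using hom by (simp add: homeomorphism_def)
  have conte: "continuous_on S ?e" for S by (intro continuous_intros)
  define W where "W = {t. ?e t \<in> V}"
  have oW: "open W"
    using open_vimage[OF V(1) conte] unfolding W_def vimage_def by simp
  have cont\<gamma>: "continuous_on W \<gamma>"
    unfolding \<gamma>_def[abs_def]
    by (rule continuous_on_compose2[OF contc[of UNIV]], rule continuous_on_compose2[OF contg conte]) (auto simp: W_def)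
  \<comment> \<open>The determinant is 1 at \<open>u\<close>, so it stays nonzero for small times,
    and the explicit velocity is continuous there.\<close>
  define W' where "W' = W \<inter> {t \<in> W. det (\<gamma> t) \<noteq> 0}"
  have "open {t \<in> W. det (\<gamma> t) \<noteq> 0}"
  proof -
    have "continuous_on W (\<lambda>t. det (\<gamma> t))" by (rule continuous_on_compose2[OF contdet cont\<gamma>]) auto
    from continuous_open_preimage[OF this oW open_Compl[OF closed_singleton]]
    have "open (W \<inter> (\<lambda>t. det (\<gamma> t)) -` (- {0}))" .
    moreover have "W \<inter> (\<lambda>t. det (\<gamma> t)) -` (- {0}) = {t \<in> W. det (\<gamma> t) \<noteq> 0}" by auto
    ultimately show ?thesis by simp
  qed
  then have oW': "open W'" using oW by (auto simp: W'_def)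
  have \<gamma>0: "\<gamma> 0 = u" using g0 by (simp add: \<gamma>_def zero_prod_def[symmetric] c0)
  have "0 \<in> W'"
    using V(2) F0 by (simp add: W'_def W_def \<gamma>0 det_def w1 w2 zero_prod_def)
  then obtain \<epsilon> where \<epsilon>: "\<epsilon> > 0" "ball 0 \<epsilon> \<subseteq> W'" using oW' open_contains_ball by blast
  have ball: "ball 0 \<epsilon> = {-\<epsilon><..<\<epsilon>}" by (auto simp: dist_real_def)
  \<comment> \<open>the inverse function theorem does not provide continuity of the derivative; Cramer's rule does\<close>
  define \<xi> where "\<xi> x = (- P' x v * G' x w2 - (- G' x v) * P' x w2) / det x" for x
  define \<eta> where "\<eta> x = (P' x w1 * (- G' x v) - G' x w1 * (- P' x v)) / det x" for x
  define \<gamma>' where "\<gamma>' t = v + \<xi> (\<gamma> t) *\<^sub>R w1 + \<eta> (\<gamma> t) *\<^sub>R w2" for t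
  have on: "\<gamma> t \<in> {u. P u = 0 \<and> G u = 0}" if "t \<in> W'" for t
  proof -
    have "F (g (?e t)) = ?e t" using that by (intro gV) (auto simp: W'_def W_def)
    then show ?thesis by (simp add: F_def \<gamma>_def)
  qed
  have der: "(\<gamma> has_vector_derivative \<gamma>' t) (at t)" if t: "t \<in> W'" for t
  proof -
    let ?y = "?e t"
    have y: "?y \<in> V" and dt: "det (\<gamma> t) \<noteq> 0" using t by (auto simp: W'_def W_def)
    obtain d1 d2 d3 where d: "g' ?y (1, 0, 0) = (d1, d2, d3)" by (cases "g' ?y (1, 0, 0)")
    have de: "(?e has_derivative (\<lambda>h. (h, 0, 0))) (at t)"
      by (intro has_derivative_Pair has_derivative_ident has_derivative_const)
    have dge: "((\<lambda>t. g (?e t)) has_derivative (\<lambda>h. g' ?y (h, 0, 0))) (at t)"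
      by (rule has_derivative_compose[OF de dg[OF y]])
    have lin: "g' ?y (h, 0, 0) = h *\<^sub>R (d1, d2, d3)" for h
      using linear_scale[OF has_derivative_linear[OF dg[OF y]], of h "(1, 0, 0)"] by (simp add: d)
    have "((\<lambda>z. F (g z)) has_derivative (\<lambda>h. F' (g ?y) (g' ?y h))) (at ?y)"
      by (rule has_derivative_compose[OF dg[OF y] dF])
    moreover have "((\<lambda>z. F (g z)) has_derivative (\<lambda>h. h)) (at ?y)"
      by (rule has_derivative_transform_within_open[OF has_derivative_ident V(1) y]) (simp add: gV)
    ultimately have "(\<lambda>h. F' (g ?y) (g' ?y h)) = (\<lambda>h. h)" by (rule has_derivative_unique)
    from fun_cong[OF this, of "(1, 0, 0)"] have id: "F' (g ?y) (d1, d2, d3) = (1, 0, 0)" by (simp add: d)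
    then have d1: "d1 = 1" by (simp add: F')
    have eq: "P' (\<gamma> t) w1 * d2 + P' (\<gamma> t) w2 * d3 = - P' (\<gamma> t) v" "G' (\<gamma> t) w1 * d2 + G' (\<gamma> t) w2 * d3 = - G' (\<gamma> t) v"
      using id by (simp_all add: F' L d1 \<gamma>_def[symmetric] blinfun.add_right blinfun.scaleR_right algebra_simps)
    have d23: "d2 = \<xi> (\<gamma> t)" "d3 = \<eta> (\<gamma> t)"
      unfolding \<xi>_def \<eta>_def det_def using cramer_2[OF eq] dt unfolding det_def by auto
    have "(\<gamma> has_derivative (\<lambda>h. L (g' ?y (h, 0, 0)))) (at t)"
      unfolding \<gamma>_def[abs_def] by (rule has_derivative_compose[OF dge dc])
    moreover have "L (g' ?y (h, 0, 0)) = h *\<^sub>R \<gamma>' t" for h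
      unfolding lin blinfun.scaleR_right by (simp add: L \<gamma>'_def d1 d23)
    ultimately show ?thesis by (simp add: has_vector_derivative_def)
  qed
  have \<gamma>'0: "\<gamma>' 0 = v" by (simp add: \<gamma>'_def \<gamma>0 \<xi>_def \<eta>_def v)
  have cont: "continuous_on {-\<epsilon><..<\<epsilon>} \<gamma>'"
  proof -
    have sub: "{-\<epsilon><..<\<epsilon>} \<subseteq> W" "\<And>t. t \<in> {-\<epsilon><..<\<epsilon>} \<Longrightarrow> det (\<gamma> t) \<noteq> 0"
      using \<epsilon>(2) unfolding ball W'_def by auto
    note c = continuous_on_compose2[OF _ continuous_on_subset[OF cont\<gamma> sub(1)] subset_UNIV]
    show ?thesis
      unfolding \<gamma>'_def[abs_def] \<xi>_def \<eta>_def
      by (intro continuous_intros c[OF P(2)] c[OF G(2)] c[OF contdet]) (use sub in auto)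
  qed
  show ?thesis
    unfolding tangent_vectors_def
    using \<epsilon> \<gamma>0 \<gamma>'0 on der cont unfolding ball by (intro CollectI exI[of _ \<epsilon>] conjI exI[of _ \<gamma>] exI[of _ \<gamma>']) auto
qed

text \<open>The two relations determine \<open>g * A\<close> and \<open>\<mu> * g' * B\<close> as
  fixed fractions of \<open>T\<close>. The bounds on \<open>A\<close> and \<open>B\<close> then give
  \<open>1 \<le> X T^(x-1)\<close> and \<open>T^(1-y) \<le> Y\<close>; eliminating \<open>T\<close>
  makes \<open>X^(1-y) Y^(x-1)\<close> at least 1, against the smallness assumption. Logarithms turn
  the comparison of products of powers into a linear one.\<close>

lemma pohozaev_case_A:
  fixes p q g g' \<mu> K K' m m' T A B :: real
  assumes pos: "p > 0" "q > 0" "g > 0" "g' > 0" "\<mu> > 0" "K > 0" "K' > 0" "m > 0" "m' > 0" "T > 0"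
    and gp: "g * p > 2" and gq: "g' * q < 2"
    and hyp: "(\<mu> * m') powr (g * p - 2) * m powr (2 - g' * q) <
      (p * (2 - g' * q) / (2 * K * (g * p - g' * q))) powr (2 - g' * q) *
      (q * (g * p - 2) / (2 * K' * (g * p - g' * q))) powr (g * p - 2)"
    and A: "A \<le> K * T powr (g * p / 2) * m" and B: "B \<le> K' * T powr (g' * q / 2) * m'"
    and T: "T = g * A + \<mu> * g' * B" "2 * T = p * g\<^sup>2 * A + \<mu> * q * g'\<^sup>2 * B"
  shows False
proof -
  define x y where "x = g * p / 2" and "y = g' * q / 2"
  have x: "x > 1" and y: "y > 0" "y < 1" and xy: "x - y > 0" using gp gq pos by (auto simp: x_def y_def)
  have gx: "g * p = 2 * x" "g' * q = 2 * y" by (simp_all add: x_def y_def)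
  define X where "X = g * K * m * (x - y) / (1 - y)"
  define Y where "Y = \<mu> * g' * K' * m' * (x - y) / (x - 1)"
  have X0: "X > 0" and Y0: "Y > 0" using pos x y xy by (auto simp: X_def Y_def)
  have T2: "T = x * (g * A) + y * (\<mu> * g' * B)"
  proof -
    have "2 * T = (g * p) * (g * A) + (g' * q) * (\<mu> * g' * B)" using T(2) by (simp add: power2_eq_square mult_ac)
    then show ?thesis unfolding gx by simp
  qed
  have TA: "T * (1 - y) = (g * A) * (x - y)" using T(1) T2 by (simp add: algebra_simps)
  have TB: "T * (x - 1) = (\<mu> * g' * B) * (x - y)" using T(1) T2 by (simp add: algebra_simps)
  have "T * (1 - y) \<le> g * (K * T powr x * m) * (x - y)"
    unfolding TA using A pos xy by (intro mult_right_mono mult_left_mono) (auto simp: x_def)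
  then have "T \<le> X * T powr x" unfolding X_def using y by (simp add: field_simps)
  then have "ln T \<le> ln (X * T powr x)" using pos X0 by simp
  then have lX: "0 \<le> ln X + (x - 1) * ln T" using pos X0 by (simp add: ln_mult ln_powr algebra_simps)
  have "T * (x - 1) \<le> \<mu> * g' * (K' * T powr y * m') * (x - y)"
    unfolding TB using B pos xy by (intro mult_right_mono mult_left_mono) (auto simp: y_def)
  then have "T \<le> Y * T powr y" unfolding Y_def using x by (simp add: field_simps)
  then have "ln T \<le> ln (Y * T powr y)" using pos Y0 by simp
  then have lY: "(1 - y) * ln T \<le> ln Y" using pos Y0 by (simp add: ln_mult ln_powr algebra_simps)
  have "0 \<le> (1 - y) * (ln X + (x - 1) * ln T)" using lX y by simp
  also have "\<dots> = (1 - y) * ln X + (x - 1) * ((1 - y) * ln T)" by (simp add: algebra_simps)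
  also have "\<dots> \<le> (1 - y) * ln X + (x - 1) * ln Y" using lY x by (intro add_left_mono mult_left_mono) auto
  finally have 1: "0 \<le> (1 - y) * ln X + (x - 1) * ln Y" .
  \<comment> \<open>The bound \<open>ln t \<le> t - 1\<close> shows that
    \<open>x^(1-y) y^(x-1)\<close> is at most 1, so the presence of this factor in the threshold of
    \<open>hyp\<close> does no harm.\<close>
  have "(1 - y) * ln x + (x - 1) * ln y \<le> (1 - y) * (x - 1) + (x - 1) * (y - 1)"
    using x y by (intro add_mono mult_left_mono ln_le_minus_one) auto
  also have "\<dots> = 0" by (simp add: algebra_simps)
  finally have 2: "(1 - y) * ln x + (x - 1) * ln y \<le> 0" .
  \<comment> \<open>The constants of \<open>hyp\<close> are expressed through \<open>X\<close> and
    \<open>Y\<close>, so that after taking logarithms the terms in \<open>m\<close> and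
    \<open>\<mu> * m'\<close> cancel.\<close>
  have b1: "p * (2 - g' * q) / (2 * K * (g * p - g' * q)) = x * m / X"
  proof -
    have "x * m / X = (g * p / 2) * m / (g * K * m * (x - y) / (1 - y))" by (simp add: X_def x_def)
    also have "\<dots> = p * (1 - y) / (2 * K * (x - y))" using pos y xy by (simp add: field_simps)
    also have "\<dots> = (2 * (p * (1 - y))) / (2 * (2 * K * (x - y)))" by simp
    also have "\<dots> = p * (2 - g' * q) / (2 * K * (g * p - g' * q))"
      unfolding gx by (rule arg_cong2[where f = "(/)"]) (simp_all add: algebra_simps)
    finally show ?thesis by simp
  qed
  have b2: "q * (g * p - 2) / (2 * K' * (g * p - g' * q)) = y * (\<mu> * m') / Y"
  proof -
    have "y * (\<mu> * m') / Y = (g' * q / 2) * (\<mu> * m') / (\<mu> * g' * K' * m' * (x - y) / (x - 1))" by (simp add: Y_def y_def)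
    also have "\<dots> = q * (x - 1) / (2 * K' * (x - y))" using pos x xy by (simp add: field_simps)
    also have "\<dots> = (2 * (q * (x - 1))) / (2 * (2 * K' * (x - y)))" by simp
    also have "\<dots> = q * (g * p - 2) / (2 * K' * (g * p - g' * q))"
      unfolding gx by (rule arg_cong2[where f = "(/)"]) (simp_all add: algebra_simps)
    finally show ?thesis by simp
  qed
  have lnlt: "ln ((\<mu> * m') powr (2 * x - 2) * m powr (2 - 2 * y)) < ln ((x * m / X) powr (2 - 2 * y) * (y * (\<mu> * m') / Y) powr (2 * x - 2))"
    using hyp[unfolded b1 b2, unfolded gx] pos X0 Y0 x y by (subst ln_less_cancel_iff) auto
  have "(2 * x - 2) * ln (\<mu> * m') + (2 - 2 * y) * ln m <
      (2 - 2 * y) * (ln x + ln m - ln X) + (2 * x - 2) * (ln y + ln (\<mu> * m') - ln Y)"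
  proof -
    have mm: "\<mu> * m' > 0" using pos by simp
    have "ln ((\<mu> * m') powr (2 * x - 2) * m powr (2 - 2 * y)) = (2 * x - 2) * ln (\<mu> * m') + (2 - 2 * y) * ln m"
      using mm pos by (subst ln_mult) (auto simp: ln_powr)
    moreover have "ln ((x * m / X) powr (2 - 2 * y) * (y * (\<mu> * m') / Y) powr (2 * x - 2)) =
        (2 - 2 * y) * ln (x * m / X) + (2 * x - 2) * ln (y * (\<mu> * m') / Y)"
      using mm pos x y X0 Y0 by (subst ln_mult) (auto simp: ln_powr)
    moreover have "ln (x * m / X) = ln x + ln m - ln X"
      using pos x X0 by (subst ln_div) (auto simp: ln_mult)
    moreover have "ln (y * (\<mu> * m') / Y) = ln y + ln (\<mu> * m') - ln Y"
    proof -
      have "ln (y * (\<mu> * m') / Y) = ln (y * (\<mu> * m')) - ln Y" using mm y Y0 by (subst ln_div) auto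
      also have "ln (y * (\<mu> * m')) = ln y + ln (\<mu> * m')" using mm y by (subst ln_mult) auto
      finally show ?thesis .
    qed
    ultimately show ?thesis using lnlt by (simp only:)
  qed
  then have "0 < (2 - 2 * y) * (ln x - ln X) + (2 * x - 2) * (ln y - ln Y)" by (simp add: algebra_simps)
  also have "\<dots> = 2 * (((1 - y) * ln x + (x - 1) * ln y) - ((1 - y) * ln X + (x - 1) * ln Y))" by (simp add: algebra_simps)
  finally have 3: "0 < 2 * (((1 - y) * ln x + (x - 1) * ln y) - ((1 - y) * ln X + (x - 1) * ln Y))" .
  have "\<not> 0 < 2 * (s - t)" if "0 \<le> t" "s \<le> 0" for s t :: real using that by simp
  from this[OF 1 2] 3 show False by contradiction
qed

text \<open>Dividing by the positive product of norms shows that the quotient for \<open>u\<close>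
  is a lower bound of all admissible constants, hence at most their infimum; so the infimum itself
  satisfies the inequality at \<open>u\<close>.\<close>

lemma gn_const_le:
  fixes u :: "'n::finite h1"
  assumes r: "r > 2" "gam CARD('n) r < 1" and pos: "Lnorm 2 (h1_grad u) > 0" "Lnorm 2 (rep_h1 u) > 0"
  shows "Lnorm r (rep_h1 u) \<le> gn_const TYPE('n) r * (Lnorm 2 (h1_grad u) powr gam CARD('n) r * Lnorm 2 (rep_h1 u) powr (1 - gam CARD('n) r))"
proof -
  let ?K = "Lnorm 2 (h1_grad u) powr gam CARD('n) r * Lnorm 2 (rep_h1 u) powr (1 - gam CARD('n) r)"
  have K: "?K > 0" using pos by simp
  have "Lnorm r (rep_h1 u) / ?K \<le> gn_const TYPE('n) r"
    unfolding gn_const_def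
  proof (rule cInf_greatest)
    show "{C. \<forall>u :: 'n h1. Lnorm r (rep_h1 u) \<le> C * Lnorm 2 (h1_grad u) powr gam CARD('n) r * Lnorm 2 (rep_h1 u) powr (1 - gam CARD('n) r)} \<noteq> {}"
      using gagliardo_nirenberg_h1[OF r] by blast
    fix C assume "C \<in> {C. \<forall>u :: 'n h1. Lnorm r (rep_h1 u) \<le> C * Lnorm 2 (h1_grad u) powr gam CARD('n) r * Lnorm 2 (rep_h1 u) powr (1 - gam CARD('n) r)}"
    then have "Lnorm r (rep_h1 u) \<le> C * ?K" by (simp add: mult.assoc)
    then show "Lnorm r (rep_h1 u) / ?K \<le> C" using K by (simp add: pos_divide_le_eq)
  qed
  then show ?thesis using K by (simp add: pos_divide_le_eq)
qed

text \<open>The claim amounts to \<open>N (r - 2) < 2 r\<close>, which is subcriticality for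
  \<open>N \<ge> 3\<close> and automatic for \<open>N\<close> at most 2.\<close>

lemma gam_less_1:
  assumes "ereal r < sobolev_exponent N" "N > 0" "r > 0"
  shows "gam N r < 1"
proof -
  have "real N * (r - 2) < 2 * r"
  proof (cases "N \<ge> 3")
    case True
    then have "r < 2 * real N / (real N - 2)" using assms(1) by (simp add: sobolev_exponent_def)
    then show ?thesis using True by (simp add: field_simps)
  next
    case False
    then have "real N \<le> 2" by simp
    then have "real N * r \<le> 2 * r" using assms(3) by (intro mult_right_mono) auto
    then show ?thesis using assms(2) by (simp add: algebra_simps)
  qed
  then show ?thesis using assms(3) by (simp add: gam_def)
qed

lemma gam_mult: "r > 0 \<Longrightarrow> gam N r * r = real N * (r - 2) / 2"
  by (simp add: gam_def)

lemma mass_sphere_eq: "mass_sphere a = {u :: 'n::finite h1. (Lnorm 2 (rep_h1 u))\<^sup>2 - a\<^sup>2 = 0}"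
  by (simp add: mass_sphere_def form_self(1)[symmetric] mass_form_def power2_norm_eq_inner)

theorem proposition1p11:
  fixes N :: nat and p q a \<mu> :: real
  assumes N: "N = CARD('n::finite)"
    and p: "mass_critical_exponent N < p" "ereal p < sobolev_exponent N"
    and a: "a > 0"
    and cases:
      "(2 < q \<and> q < mass_critical_exponent N \<and> \<mu> > 0 \<and>
        (\<mu> * a powr ((1 - gam N q) * q)) powr (gam N p * p - 2)
          * (a powr ((1 - gam N p) * p)) powr (2 - gam N q * q)
        < (p * (2 - gam N q * q)
             / (2 * gn_const TYPE('n) p powr p * (gam N p * p - gam N q * q))) powr (2 - gam N q * q)
          * (q * (gam N p * p - 2)
             / (2 * gn_const TYPE('n) q powr q * (gam N p * p - gam N q * q))) powr (gam N p * p - 2))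
       \<or>
       (q = mass_critical_exponent N \<and> \<mu> > 0 \<and>
        \<mu> * a powr (4 / real N)
        < mass_critical_exponent N
            / (2 * gn_const TYPE('n) (mass_critical_exponent N) powr mass_critical_exponent N))
       \<or>
       (2 < q \<and> q \<le> mass_critical_exponent N \<and> \<mu> < 0 \<and>
        (\<bar>\<mu>\<bar> * a powr (q * (1 - gam N q))) powr (p * gam N p - 2)
          * a powr (p * (1 - gam N p) * (2 - q * gam N q))
        < ((1 - gam N p) / (gn_const TYPE('n) q powr q * (gam N p - gam N q))) powr (p * gam N p - 2)
          * (1 / (gam N p * gn_const TYPE('n) p powr p)) powr (2 - q * gam N q))"
  shows "smooth_codim1_in (pohozaev_functional p q \<mu>) (\<lambda>u. (Lnorm 2 (rep_h1 u))\<^sup>2 - a\<^sup>2)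
           (pohozaev_set p q a \<mu> :: 'n h1 set) (mass_sphere a) \<and>
         (\<forall>u \<in> (pohozaev_set p q a \<mu> :: 'n h1 set).
            critical_point_on (energy p q \<mu>) (pohozaev_set p q a \<mu>) u \<longrightarrow>
            critical_point_on (energy p q \<mu>) (mass_sphere a) u)"
proof -
  let ?gp = "gam N p" and ?gq = "gam N q"
  let ?P = "pohozaev_functional p q \<mu> :: 'n h1 \<Rightarrow> real"
  let ?G = "\<lambda>u :: 'n h1. (Lnorm 2 (rep_h1 u))\<^sup>2 - a\<^sup>2"
  have N0: "N > 0" using N by simp
  have crit: "mass_critical_exponent N > 2" using N0 by (simp add: mass_critical_exponent_def)
  have q2: "q > 2" "q \<le> mass_critical_exponent N" using cases crit by auto
  have p2: "p > 2" and qp: "q < p" using p q2 crit by auto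
  have gp1: "?gp < 1" by (rule gam_less_1[OF p(2) N0]) (use p2 in simp)
  have "ereal q < sobolev_exponent N" using qp p(2) by (meson ereal_less(1) less_ereal.simps(1) less_trans)
  then have gq1: "?gq < 1" by (rule gam_less_1[OF _ N0]) (use q2 in simp)
  have g0: "?gp > 0" "?gq > 0" using p2 q2 N0 by (simp_all add: gam_def)
  have gm: "?gp * p = real N * (p - 2) / 2" "?gq * q = real N * (q - 2) / 2"
    using p2 q2 by (simp_all add: gam_mult)
  have Nc: "real N * (mass_critical_exponent N - 2) = 4" using N0 by (simp add: mass_critical_exponent_def)
  have "real N * (mass_critical_exponent N - 2) < real N * (p - 2)" using p N0 by simp
  then have gpp: "?gp * p > 2" unfolding gm Nc by simp
  have "real N * (q - 2) \<le> real N * (mass_critical_exponent N - 2)" using q2 N0 by simp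
  then have gqq: "?gq * q \<le> 2" unfolding gm Nc by simp
  note hp = p2 gp1[unfolded N] and hq = q2(1) gq1[unfolded N]

  have LP: "?P u = grad_form u u + (- ?gp) * Lnorm p (rep_h1 u) powr p + (- (\<mu> * ?gq)) * Lnorm q (rep_h1 u) powr q" for u
    by (simp add: pohozaev_functional_def form_self(2) N)
  have PC: "C1_functional ?P"
    unfolding LP[abs_def]
    by (intro C1_functional_add C1_functional_cmult gradient_C1(2) power_C1(2)[OF hp] power_C1(2)[OF hq])
  have GC: "C1_functional ?G"
    using C1_functional_add[OF mass_C1(2) C1_functional_const[of "- a\<^sup>2"]] by (simp add: form_self(1))
  define dP where "dP u h = 2 * grad_form u h + (- ?gp) * (p * power_form p u h) + (- (\<mu> * ?gq)) * (q * power_form q u h)" for u h :: "'n h1"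
  define dG where "dG u h = 2 * mass_form u h" for u h :: "'n h1"
  define dE where "dE u h = grad_form u h - power_form p u h - \<mu> * power_form q u h" for u h :: "'n h1"
  have dP: "(?P has_derivative dP u) (at u)" for u
    unfolding LP[abs_def] dP_def[abs_def]
    by (intro has_derivative_add has_derivative_mult_right gradient_C1(1) power_C1(1)[OF hp] power_C1(1)[OF hq])
  have dG: "(?G has_derivative dG u) (at u)" for u
  proof -
    have "((\<lambda>u :: 'n h1. mass_form u u - a\<^sup>2) has_derivative (\<lambda>h. 2 * mass_form u h - 0)) (at u)"
      by (intro has_derivative_diff mass_C1(1) has_derivative_const)
    then show ?thesis by (simp add: form_self(1) dG_def[abs_def])
  qed
  have dE: "(energy p q \<mu> has_derivative dE u) (at u)" for u :: "'n h1"
  proof -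
    have "energy p q \<mu> v = 1 / 2 * grad_form v v - 1 / p * Lnorm p (rep_h1 v) powr p - \<mu> / q * Lnorm q (rep_h1 v) powr q" for v :: "'n h1"
    proof -
      have i: "integrable lborel (\<lambda>x. (norm (h1_grad v x))\<^sup>2)"
        using h1_square_integrable(2)[of v] by (simp add: square_integrable_def)
      have "energy p q \<mu> v = 1 / 2 * (L2_square (h1_grad v)) - 1 / p * (LINT x|lborel. norm (rep_h1 v x) powr p)
          - \<mu> / q * (LINT x|lborel. norm (rep_h1 v x) powr q)"
        unfolding energy_def using i h1_Lr_integrable[OF hp, of v] h1_Lr_integrable[OF hq, of v] by simp
      then show ?thesis
        by (simp only: Lnorm_h1_powr[OF hp] Lnorm_h1_powr[OF hq] grad_form_def power2_norm_eq_inner)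
    qed
    then have E: "energy p q \<mu> = (\<lambda>v :: 'n h1. 1 / 2 * grad_form v v - 1 / p * Lnorm p (rep_h1 v) powr p - \<mu> / q * Lnorm q (rep_h1 v) powr q)"
      by (rule ext)
    have "dE u = (\<lambda>h. 1 / 2 * (2 * grad_form u h) - 1 / p * (p * power_form p u h) - \<mu> / q * (q * power_form q u h))"
      using p2 q2 by (simp add: dE_def[abs_def])
    then show ?thesis unfolding E
      by (simp only:) (intro has_derivative_diff has_derivative_mult_right gradient_C1(1) power_C1(1)[OF hp] power_C1(1)[OF hq])
  qed
  have S_eq: "mass_sphere a = {u. ?G u = 0}" by (rule mass_sphere_eq)
  have M_eq: "pohozaev_set p q a \<mu> = {u. ?P u = 0 \<and> ?G u = 0}"
    unfolding pohozaev_set_def S_eq by auto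

  have nondeg: "2 * (Lnorm 2 (h1_grad u))\<^sup>2 \<noteq> p * ?gp\<^sup>2 * Lnorm p (rep_h1 u) powr p + \<mu> * q * ?gq\<^sup>2 * Lnorm q (rep_h1 u) powr q"
    and uu: "mass_form u u = a\<^sup>2"
    if u: "u \<in> pohozaev_set p q a \<mu>" for u :: "'n h1"
  proof -
    have Pu: "?P u = 0" and Gu: "(Lnorm 2 (rep_h1 u))\<^sup>2 = a\<^sup>2" using u unfolding M_eq by auto
    then show "mass_form u u = a\<^sup>2" by (simp add: form_self(1))
    have X: "Lnorm 2 (rep_h1 u) = a" using Gu a by (simp add: power2_eq_iff_nonneg)
    let ?T = "(Lnorm 2 (h1_grad u))\<^sup>2" and ?A = "Lnorm p (rep_h1 u) powr p" and ?B = "Lnorm q (rep_h1 u) powr q"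
    have Lp: "Lnorm p (rep_h1 u) > 0" and Lq: "Lnorm q (rep_h1 u) > 0"
    proof -
      have "Lnorm r (rep_h1 u) \<noteq> 0" if r: "r > 2" "gam CARD('n) r < 1" for r
      proof
        assume "Lnorm r (rep_h1 u) = 0"
        from Lnorm_eq_0[OF this h1_Lr_integrable[OF r]] have "AE x in lborel. rep_h1 u x = 0" .
        then have "mass_form u u = 0" unfolding mass_form_def
          by (intro integral_eq_zero_AE) (auto elim!: eventually_mono)
        then show False using X a by (simp add: form_self(1))
      qed
      from this[OF hp] this[OF hq] show "Lnorm p (rep_h1 u) > 0" "Lnorm q (rep_h1 u) > 0"
        using Lnorm_nonneg[of p "rep_h1 u"] Lnorm_nonneg[of q "rep_h1 u"] by linarith+
    qed
    have A: "?A > 0" and B: "?B > 0" using Lp Lq by simp_all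
    \<comment> \<open>A vanishing gradient would force the \<open>L^p\<close> norm of
      \<open>u\<close> to vanish as well. Positivity is what allows division by the norms in
      \<open>gn_const_le\<close> and logarithms of \<open>?T\<close>.\<close>
    have T: "Lnorm 2 (h1_grad u) > 0"
    proof (rule ccontr)
      assume "\<not> ?thesis"
      then have z: "Lnorm 2 (h1_grad u) = 0" using Lnorm_nonneg[of 2 "h1_grad u"] by linarith
      obtain C where "Lnorm p (rep_h1 u) \<le> C * Lnorm 2 (h1_grad u) powr gam CARD('n) p * Lnorm 2 (rep_h1 u) powr (1 - gam CARD('n) p)"
        using gagliardo_nirenberg_h1[OF hp] by blast
      then show False using z Lp by simp
    qed
    have eq1: "?T = ?gp * ?A + \<mu> * ?gq * ?B" using Pu by (simp add: LP form_self(2))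
    show "2 * ?T \<noteq> p * ?gp\<^sup>2 * ?A + \<mu> * q * ?gq\<^sup>2 * ?B"
    proof
      assume eq2: "2 * ?T = p * ?gp\<^sup>2 * ?A + \<mu> * q * ?gq\<^sup>2 * ?B"
      \<comment> \<open>Elimination of the gradient term. The left side is positive because
        \<open>p\<close> is mass supercritical, so the sign of the right side distinguishes the
        cases.\<close>
      have eq3: "(?gp * p - 2) * (?gp * ?A) = (2 - ?gq * q) * (\<mu> * (?gq * ?B))"
        using eq1 eq2 by (simp add: power2_eq_square algebra_simps)
      have pos: "(?gp * p - 2) * (?gp * ?A) > 0" using gpp g0 A by simp
      have gB: "?gq * ?B > 0" using g0 B by simp
      consider "2 < q" "q < mass_critical_exponent N" "\<mu> > 0"
          "(\<mu> * a powr ((1 - ?gq) * q)) powr (?gp * p - 2) * (a powr ((1 - ?gp) * p)) powr (2 - ?gq * q)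
           < (p * (2 - ?gq * q) / (2 * gn_const TYPE('n) p powr p * (?gp * p - ?gq * q))) powr (2 - ?gq * q)
            * (q * (?gp * p - 2) / (2 * gn_const TYPE('n) q powr q * (?gp * p - ?gq * q))) powr (?gp * p - 2)"
        | "q = mass_critical_exponent N" | "\<mu> < 0"
        using cases by blast
      then show False
      proof cases
        case 1
        have "real N * (q - 2) < real N * (mass_critical_exponent N - 2)" using 1 N0 by simp
        then have gqq': "?gq * q < 2" unfolding gm Nc by simp
        have gn: "Lnorm r (rep_h1 u) powr r \<le> gn_const TYPE('n) r powr r * ?T powr (gam N r * r / 2) * a powr ((1 - gam N r) * r)"
          and gn0: "gn_const TYPE('n) r powr r > 0"
          if r: "r > 2" "gam CARD('n) r < 1" and L: "Lnorm r (rep_h1 u) > 0" for r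
        proof -
          have le: "Lnorm r (rep_h1 u) \<le> gn_const TYPE('n) r * (Lnorm 2 (h1_grad u) powr gam N r * a powr (1 - gam N r))"
            using gn_const_le[OF r T] X a by (simp add: N)
          have "Lnorm 2 (h1_grad u) powr gam N r * a powr (1 - gam N r) > 0" using T a by simp
          with le L have c: "gn_const TYPE('n) r > 0" by (metis less_le_trans zero_less_mult_pos2)
          then show "gn_const TYPE('n) r powr r > 0" by simp
          have "Lnorm r (rep_h1 u) powr r \<le> (gn_const TYPE('n) r * (Lnorm 2 (h1_grad u) powr gam N r * a powr (1 - gam N r))) powr r"
            using le r by (intro powr_mono2) auto
          also have "\<dots> = gn_const TYPE('n) r powr r * Lnorm 2 (h1_grad u) powr (gam N r * r) * a powr ((1 - gam N r) * r)"
            using c T a by (simp add: powr_mult powr_powr)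
          also have "Lnorm 2 (h1_grad u) powr (gam N r * r) = ?T powr (gam N r * r / 2)"
            using T by (simp add: powr_numeral[symmetric] powr_powr del: powr_numeral)
          finally show "Lnorm r (rep_h1 u) powr r \<le> gn_const TYPE('n) r powr r * ?T powr (gam N r * r / 2) * a powr ((1 - gam N r) * r)" .
        qed
        show False
          by (rule pohozaev_case_A[OF _ _ g0 1(3) gn0[OF hp Lp] gn0[OF hq Lq] _ _ _ gpp gqq' 1(4) gn[OF hp Lp] gn[OF hq Lq] eq1 eq2])
             (use p2 q2 a T in auto)
      next
        case 2
        then have "?gq * q = 2" unfolding gm using Nc by simp
        then have "(2 - ?gq * q) * (\<mu> * (?gq * ?B)) = 0" by simp
        then show False using pos unfolding eq3 by (simp only: less_irrefl)
      next
        case 3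
        then have "\<mu> * (?gq * ?B) \<le> 0" using gB by (simp add: mult_le_0_iff)
        then have "(2 - ?gq * q) * (\<mu> * (?gq * ?B)) \<le> 0"
          using gqq mult_nonneg_nonpos[of "2 - ?gq * q" "\<mu> * (?gq * ?B)"] by simp
        then show False using pos unfolding eq3 by (rule leD[THEN notE])
      qed
    qed
  qed

  have surj: "surj (\<lambda>h. (dP u h, dG u h))" if u: "u \<in> pohozaev_set p q a \<mu>" for u :: "'n h1"
  proof (rule surj_pairI)
    show "linear (dP u)" by (rule has_derivative_linear[OF dP])
    show "linear (dG u)" by (rule has_derivative_linear[OF dG])
    \<comment> \<open>In direction \<open>u\<close> the mass functional has derivative
      \<open>2 * a\<^sup>2\<close>.\<close>
    show "dG u u \<noteq> 0" using uu[OF u] a by (simp add: dG_def)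
    fix \<kappa>
    show "\<exists>h. dP u h \<noteq> \<kappa> * dG u h"
    proof (rule ccontr)
      assume "\<not> ?thesis"
      then have "weak_solution 2 (p * ?gp) (\<mu> * q * ?gq) (2 * \<kappa>) p q u"
        unfolding weak_solution_def dP_def dG_def by (simp add: algebra_simps)
      from pohozaev_identity[OF hp hq qp this]
      have "2 * (Lnorm 2 (h1_grad u))\<^sup>2 = p * ?gp * ?gp * Lnorm p (rep_h1 u) powr p + \<mu> * q * ?gq * ?gq * Lnorm q (rep_h1 u) powr q"
        by (simp add: N)
      then show False using nondeg[OF u] by (simp add: power2_eq_square mult.assoc)
    qed
  qed

  have smooth: "smooth_codim1_in ?P ?G (pohozaev_set p q a \<mu>) (mass_sphere a)"
  proof -
    have fd: "frechet_derivative ?P (at u) = dP u" "frechet_derivative ?G (at u) = dG u" for u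
      using frechet_derivative_at[OF dP] frechet_derivative_at[OF dG] by metis+
    show ?thesis
      unfolding smooth_codim1_in_def fd using S_eq M_eq PC GC surj by blast
  qed

  have crit_point: "critical_point_on (energy p q \<mu>) (mass_sphere a) u"
    if u: "u \<in> pohozaev_set p q a \<mu>" and c: "critical_point_on (energy p q \<mu>) (pohozaev_set p q a \<mu>) u" for u :: "'n h1"
  proof -
    obtain E' where E': "(energy p q \<mu> has_derivative E') (at u)" "\<And>v. v \<in> tangent_vectors (pohozaev_set p q a \<mu>) u \<Longrightarrow> E' v = 0"
      using c unfolding critical_point_on_def by blast
    have EE: "E' = dE u" by (rule has_derivative_unique[OF E'(1) dE])
    \<comment> \<open>Surjectivity provides vectors dual to the two differentials; they parametrise
      curves in the Pohozaev set, and the values of \<open>dE u\<close> on them are the Lagrange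
      multipliers.\<close>
    from surjD[OF surj[OF u], of "(1, 0)"] obtain w1 where w1: "dP u w1 = 1" "dG u w1 = 0" by auto
    from surjD[OF surj[OF u], of "(0, 1)"] obtain w2 where w2: "dP u w2 = 0" "dG u w2 = 1" by auto
    obtain P' where P': "\<And>u. (?P has_derivative blinfun_apply (P' u)) (at u)" "continuous_on UNIV P'"
      using PC unfolding C1_functional_def by blast
    obtain G' where G': "\<And>u. (?G has_derivative blinfun_apply (G' u)) (at u)" "continuous_on UNIV G'"
      using GC unfolding C1_functional_def by blast
    have PG: "blinfun_apply (P' u) = dP u" "blinfun_apply (G' u) = dG u"
      by (rule has_derivative_unique[OF P'(1) dP] has_derivative_unique[OF G'(1) dG])+
    have ker: "dE u v = 0" if "dP u v = 0" "dG u v = 0" for v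
    proof -
      have "v \<in> tangent_vectors {u. ?P u = 0 \<and> ?G u = 0} u"
        using u unfolding M_eq
        by (intro kernel_subset_tangent_vectors[OF P' G', where ?w1.0 = w1 and ?w2.0 = w2]) (auto simp: PG w1 w2 that)
      then show ?thesis using E'(2) EE unfolding M_eq by simp
    qed
    define \<nu> \<kappa> where "\<nu> = dE u w1" and "\<kappa> = dE u w2"
    have linE: "linear (dE u)" and linP: "linear (dP u)" and linG: "linear (dG u)"
      by (rule has_derivative_linear[OF dE] has_derivative_linear[OF dP] has_derivative_linear[OF dG])+
    have mult: "dE u h = \<nu> * dP u h + \<kappa> * dG u h" for h
    proof -
      let ?k = "h - dP u h *\<^sub>R w1 - dG u h *\<^sub>R w2"
      have "dE u ?k = 0"
        by (rule ker) (simp_all add: linear_diff[OF linP] linear_scale[OF linP] linear_diff[OF linG] linear_scale[OF linG] w1 w2)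
      moreover have "dE u ?k = dE u h - dP u h * dE u w1 - dG u h * dE u w2"
        by (simp only: linear_diff[OF linE] linear_scale[OF linE] real_scaleR_def)
      ultimately show ?thesis by (simp add: \<nu>_def \<kappa>_def mult.commute)
    qed
    have "weak_solution (1 - 2 * \<nu>) (1 - \<nu> * p * ?gp) (\<mu> * (1 - \<nu> * q * ?gq)) (2 * \<kappa>) p q u"
      unfolding weak_solution_def
    proof
      fix h
      show "(1 - 2 * \<nu>) * grad_form u h = (1 - \<nu> * p * ?gp) * power_form p u h + \<mu> * (1 - \<nu> * q * ?gq) * power_form q u h + 2 * \<kappa> * mass_form u h"
        using mult[of h] unfolding dE_def dP_def dG_def by (simp add: algebra_simps)
    qed
    \<comment> \<open>Both leading coefficients vanish only if \<open>\<nu> = 1 / 2\<close> and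
      \<open>?gp * p = 2\<close>, which \<open>gpp\<close> excludes.\<close>
    moreover have "1 - 2 * \<nu> \<noteq> 0 \<or> 1 - \<nu> * p * ?gp \<noteq> 0"
    proof (cases "\<nu> = 1 / 2")
      case True
      have "\<nu> * p * ?gp = ?gp * p / 2" unfolding True by simp
      then show ?thesis using gpp by linarith
    qed simp
    ultimately have id: "(1 - 2 * \<nu>) * (Lnorm 2 (h1_grad u))\<^sup>2 = (1 - \<nu> * p * ?gp) * ?gp * Lnorm p (rep_h1 u) powr p
        + \<mu> * (1 - \<nu> * q * ?gq) * ?gq * Lnorm q (rep_h1 u) powr q"
      using pohozaev_identity[OF hp hq qp] by (simp add: N)
    moreover have "(Lnorm 2 (h1_grad u))\<^sup>2 = ?gp * Lnorm p (rep_h1 u) powr p + \<mu> * ?gq * Lnorm q (rep_h1 u) powr q"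
      using u unfolding M_eq by (simp add: LP form_self(2))
    \<comment> \<open>Subtracting the Pohozaev constraint cancels all terms free of
      \<open>\<nu>\<close>.\<close>
    ultimately have "\<nu> * (2 * (Lnorm 2 (h1_grad u))\<^sup>2 - (p * ?gp\<^sup>2 * Lnorm p (rep_h1 u) powr p + \<mu> * q * ?gq\<^sup>2 * Lnorm q (rep_h1 u) powr q)) = 0"
      by (simp add: power2_eq_square algebra_simps)
    then have "\<nu> = 0" using nondeg[OF u] by simp
    then have EG: "dE u h = \<kappa> * dG u h" for h using mult[of h] by simp
    show ?thesis
      unfolding critical_point_on_def
    proof (intro conjI exI[of _ "dE u"] ballI dE)
      show "u \<in> mass_sphere a" using u unfolding pohozaev_set_def by simp
      fix v assume "v \<in> tangent_vectors (mass_sphere a) u"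
      then have "dG u v = 0" unfolding S_eq by (rule tangent_vectors_subset_kernel[OF dG])
      then show "dE u v = 0" by (simp add: EG)
    qed
  qed
  show ?thesis using smooth crit_point by blast
qed

end
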